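(* For each $d\in\mathbb N$ let $U$, $\mu_0$, and the processes $X^\epsilon=(X^\epsilon_t)_{t\in[0,1]}$ and $\widetilde X^{\epsilon,h}=(\widetilde X^{\epsilon,h}_t)_{t\in[0,1]}$ be as in the context, with $\epsilon=\epsilon(d)>0$ and $h=h(d)\in(0,1]$, and let $\mu^\epsilon$, $\widetilde\mu^{\epsilon,h}$ be the laws of $X^\epsilon$, $\widetilde X^{\epsilon,h}$ on the space $C([0,1];\mathbb R^d)$ of continuous paths (Borel $\sigma$-algebra of the uniform metric). For any $q\ge0$, if $$M^2\vee L^4\vee K^{-1}\vee\sup_{t}\|\partial_tx_t^\star\|^2=O(d^q),\qquad\mu_0(V)=O(d^{q+1}),$$ $$h\vee\epsilon\vee\frac h\epsilon\frac{L^2}{K}=o(1),\qquad\frac h\epsilon d=O(1),$$ as $d\to\infty$, then $$\|\mu^\epsilon-\widetilde\mu^{\epsilon,h}\|_{\mathrm{tv}}=O\Big(\sqrt{\frac{h}{\epsilon^2}d^{4q+1}}\Big).$$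
   Context: $V(x)=\|x\|^2$; $\mu_0(V)=\int V\mathrm d\mu_0$; $\|\nu-\nu'\|_{\mathrm{tv}}=\sup_A|\nu(A)-\nu'(A)|$. For arrays $A(x)$, $\|A\|_p:=\sup_x\|A(x)\|_{\mathrm{H.S.}}/(1+\|x\|^{2p})$ (Hilbert–Schmidt norm = root of sum of squared entries). $C_{1,2}^{p}([0,1]\times\mathbb R^d)$: functions $f_t(x)$ continuously differentiable in $t$ and twice continuously differentiable in $x$ with $\sup_t\|f_t\|_p,\sup_t\|\partial_tf_t\|_p,\sup_t\|\nabla f_t\|_p,\sup_t\|\nabla^{(2)}f_t\|_p<\infty$. Standing assumptions on $U:[0,1]\times\mathbb R^d\to\mathbb R^+$ (for each $d$, constants may depend on $d$): (i) $U\in C_{1,2}^{p_0}([0,1]\times\mathbb R^d)$ for some $p_0\ge1$; (ii) for some $L<\infty$, $\sup_t\|\nabla U_t(x)-\nabla U_t(y)\|\le L\|x-y\|$ for all $x,y$; (iii) $\sup_t\|\nabla U_t(x)\|\le L(1+\|x\|)$ for all $x$; (iv) for some $K>0$, $\inf_{t,x}\sum_{i,j}v_i\frac{\partial^2U_t(x)}{\partial x_i\partial x_j}v_j\ge K\|v\|^2$ for all $v$; $x_t^\star$ denotes the unique minimizer of $U_t$ and $x_0^\star=0$; (v) for some $M<\infty$, $\|\nabla U_t(x)-\nabla U_s(x)\|\le M|t-s|\sqrt{1+\|x-x_{t\wedge s}^\star\|^2}$ for all $x,t,s$; (vi) the third-order $x$-derivatives of $U_t(x)$ exist, are continuous, and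 are bounded uniformly in $t,x$. Processes, driven by the same $d$-dimensional Brownian motion $B$ and with the same $\mathcal F_0$-measurable initial value $X_0^\epsilon\sim\mu_0$: for $t\in[0,1]$, $X_t^\epsilon=X_0^\epsilon-\epsilon^{-1}\int_0^t\nabla U_s(X_s^\epsilon)\mathrm ds+\sqrt{2\epsilon^{-1}}B_t$, and $\widetilde X_t^{\epsilon,h}=X_0^\epsilon-\epsilon^{-1}\int_0^t\widetilde{\nabla U}_s(\widetilde X_s^{\epsilon,h})\mathrm ds+\sqrt{2\epsilon^{-1}}B_t$, where $\widetilde{\nabla U}_t(\widetilde X_t^{\epsilon,h}):=\sum_{k=0}^{\lfloor1/h\rfloor-1}\nabla U_{kh}(\widetilde X_{kh}^{\epsilon,h})\mathbb I_{[kh,(k+1)h)}(t)$ (Euler–Maruyama scheme). *)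

theory Defs
  imports "HOL-Probability.Probability" "HOL-Library.Landau_Symbols"
begin

section \<open>The space \<open>R\<^sup>d\<close>, with \<open>d\<close> a term variable\<close>

text \<open>
  The dimension tends to infinity, so it cannot be a type. A point of \<open>R\<^sup>d\<close> is a function
  \<^typ>\<open>nat \<Rightarrow> real\<close> vanishing at all indices \<open>\<ge> d\<close>, as in the library's
  \<^const>\<open>Euclidean_space\<close>.
\<close>

abbreviation Rd :: "nat \<Rightarrow> (nat \<Rightarrow> real) set" where
  "Rd d \<equiv> topspace (Euclidean_space d)"

definition enorm :: "nat \<Rightarrow> (nat \<Rightarrow> real) \<Rightarrow> real" where
  "enorm d x = L2_set x {..<d}"

definition edist :: "nat \<Rightarrow> (nat \<Rightarrow> real) \<Rightarrow> (nat \<Rightarrow> real) \<Rightarrow> real" where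
  "edist d x y = enorm d (\<lambda>i. x i - y i)"

definition Rd_metric :: "nat \<Rightarrow> (nat \<Rightarrow> real) metric" where
  "Rd_metric d = metric (Rd d, edist d)"

lemma Metric_space_Rd: "Metric_space (Rd d) (edist d)"
proof
  fix x y z :: "nat \<Rightarrow> real"
  show "0 \<le> edist d x y" by (simp add: edist_def enorm_def)
  show "edist d x y = edist d y x"
    by (simp add: edist_def enorm_def L2_set_def power2_commute)
  assume x: "x \<in> Rd d" and y: "y \<in> Rd d"
  show "edist d x y = 0 \<longleftrightarrow> x = y"
  proof
    assume "edist d x y = 0"
    then have "\<forall>i<d. x i = y i" by (simp add: edist_def enorm_def L2_set_eq_0_iff)
    moreover have "\<forall>i\<ge>d. x i = 0" "\<forall>i\<ge>d. y i = 0"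
      using x y by (simp_all add: topspace_Euclidean_space)
    ultimately have "x i = y i" for i by (cases "i < d") simp_all
    then show "x = y" ..
  qed (simp add: edist_def enorm_def L2_set_def)
  have "edist d x z = L2_set (\<lambda>i. (x i - y i) + (y i - z i)) {..<d}"
    by (simp add: edist_def enorm_def)
  also have "\<dots> \<le> edist d x y + edist d y z"
    unfolding edist_def enorm_def by (rule L2_set_triangle_ineq)
  finally show "edist d x z \<le> edist d x y + edist d y z" .
qed

lemma mspace_Rd_metric [simp]: "mspace (Rd_metric d) = Rd d"
  and mdist_Rd_metric [simp]: "mdist (Rd_metric d) = edist d"
  by (simp_all add: Rd_metric_def Metric_space.mspace_metric Metric_space.mdist_metric
        Metric_space_Rd)

lemma mtopology_of_Rd_metric: "mtopology_of (Rd_metric d) = Euclidean_space d"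
proof -
  interpret Metric_space "Rd d" "edist d" by (rule Metric_space_Rd)
  have top: "mtopology_of (Rd_metric d) = mtopology" by (simp add: mtopology_of_def)
  define T where "T = mtopology"
  have T: "topspace T = {x. \<forall>i\<ge>d. x i = 0}"
    unfolding T_def topspace_mtopology by (rule topspace_Euclidean_space)
  have 1: "continuous_map T (Euclidean_space d) (\<lambda>x. x)"
  proof -
    have "continuous_map T euclideanreal (\<lambda>x. x i)" for i
    proof (cases "i < d")
      case True
      have *: "\<bar>x i - y i\<bar> \<le> edist d x y" for x y
      proof -
        have "\<bar>x i - y i\<bar> \<le> L2_set (\<lambda>i. \<bar>x i - y i\<bar>) {..<d}"
          using True by (intro member_le_L2_set) auto
        then show ?thesis by (simp add: edist_def enorm_def L2_set_def)
      qed
      show ?thesis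
        unfolding T_def mtopology_is_euclidean[symmetric]
          metric_continuous_map[OF Met_TC.Metric_space_axioms]
      proof (intro conjI ballI allI impI)
        fix a and e :: real assume "0 < e"
        then show "\<exists>\<delta>>0. \<forall>x. x \<in> Rd d \<and> edist d a x < \<delta> \<longrightarrow> dist (a i) (x i) < e"
          using * by (intro exI[of _ e]) (auto simp: dist_real_def intro: le_less_trans)
      qed simp
    next
      case False
      have "continuous_map T euclideanreal (\<lambda>x. 0)" by simp
      moreover have "\<And>x. x \<in> topspace T \<Longrightarrow> 0 = x i" using False by (simp add: T)
      ultimately show ?thesis by (rule continuous_map_eq)
    qed
    then show ?thesis
      by (simp add: Euclidean_space_def continuous_map_in_subtopology
          continuous_map_componentwise_UNIV T)
  qed
  have 2: "continuous_map (Euclidean_space d) mtopology (\<lambda>x. x)"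
  proof -
    have cont: "continuous_map (Euclidean_space d) euclideanreal (edist d x)" for x
    proof -
      have "continuous_map (Euclidean_space d) euclideanreal (\<lambda>y. y i)" for i
        unfolding Euclidean_space_def
        by (rule continuous_map_from_subtopology) (rule continuous_map_product_projection, simp)
      then have *: "continuous_map (Euclidean_space d) euclideanreal (\<lambda>y. \<Sum>i<d. (x i - y i)\<^sup>2)"
        by (intro continuous_map_sum continuous_map_real_pow continuous_map_diff) simp_all
      have "continuous_map euclideanreal euclideanreal sqrt"
        using continuous_on_real_sqrt[OF continuous_on_id] by simp
      from continuous_map_compose[OF * this] show ?thesis
        by (simp add: edist_def[abs_def] enorm_def L2_set_def o_def)
    qed
    show ?thesis
      unfolding continuous_map_to_metric
    proof (intro ballI allI impI)
      fix x and e :: real assume x: "x \<in> Rd d" "0 < e"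
      have "openin (Euclidean_space d) {y \<in> Rd d. edist d x y \<in> {..<e}}"
        by (rule openin_continuous_map_preimage[OF cont]) simp
      moreover have "{y \<in> Rd d. edist d x y \<in> {..<e}} = mball x e"
        unfolding mball_def using x by blast
      ultimately show "\<exists>U. openin (Euclidean_space d) U \<and> x \<in> U \<and> (\<forall>y\<in>U. y \<in> mball x e)"
        using x centre_in_mball_iff by metis
    qed
  qed
  have "openin T S \<longleftrightarrow> openin (Euclidean_space d) S" for S
  proof
    assume S: "openin T S"
    have "{x \<in> Rd d. x \<in> S} = S"
      using openin_subset[OF S] unfolding T topspace_Euclidean_space by blast
    then show "openin (Euclidean_space d) S"
      using openin_continuous_map_preimage[OF 2[folded T_def] S] by (rule subst)
  next
    assume S: "openin (Euclidean_space d) S"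
    have "{x \<in> topspace T. x \<in> S} = S"
      using openin_subset[OF S] unfolding T topspace_Euclidean_space by blast
    then show "openin T S"
      using openin_continuous_map_preimage[OF 1 S] by (rule subst)
  qed
  then have "T = Euclidean_space d" unfolding topology_eq by blast
  then show ?thesis by (simp only: top T_def)
qed

definition borel_of :: "'a topology \<Rightarrow> 'a measure" where
  "borel_of T = sigma (topspace T) {S. openin T S}"

text \<open>
  \<open>C([0,1]; R\<^sup>d)\<close> with the uniform metric. Paths are extensional, i.e. \<^const>\<open>undefined\<close> outside
  \<open>[0,1]\<close>.
\<close>

definition path_borel :: "nat \<Rightarrow> (real \<Rightarrow> nat \<Rightarrow> real) measure" where
  "path_borel d = borel_of (mtopology_of (cfunspace (top_of_set {0..1}) (Rd_metric d)))"

definition tv_dist :: "'a measure \<Rightarrow> 'a measure \<Rightarrow> real" where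
  "tv_dist \<nu> \<nu>' = (SUP A\<in>sets \<nu>. \<bar>measure \<nu> A - measure \<nu>' A\<bar>)"


section \<open>Smoothness classes\<close>

definition pderivative :: "nat \<Rightarrow> ((nat \<Rightarrow> real) \<Rightarrow> real) \<Rightarrow> (nat \<Rightarrow> real) \<Rightarrow> real" where
  "pderivative i f x = deriv (\<lambda>s. f (x(i := s))) (x i)"

fun cont_diff :: "nat \<Rightarrow> nat \<Rightarrow> ((nat \<Rightarrow> real) \<Rightarrow> real) \<Rightarrow> bool" where
  "cont_diff d 0 f \<longleftrightarrow> continuous_map (Euclidean_space d) euclideanreal f"
| "cont_diff d (Suc k) f \<longleftrightarrow> continuous_map (Euclidean_space d) euclideanreal f \<and>
     (\<forall>i<d. (\<forall>x\<in>Rd d. (\<lambda>s. f (x(i := s))) differentiable at (x i)) \<and>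
            cont_diff d k (pderivative i f))"

text \<open>
  An array-valued function is given by its entries \<open>a j\<close>, with \<open>j\<close> ranging over an index set
  \<open>J\<close>; a scalar function is an array over a singleton.
\<close>

definition growth_norm ::
    "nat \<Rightarrow> real \<Rightarrow> 'j set \<Rightarrow> ('j \<Rightarrow> (nat \<Rightarrow> real) \<Rightarrow> real) \<Rightarrow> ereal" where
  "growth_norm d p J a =
     (SUP x\<in>Rd d. ereal (L2_set (\<lambda>j. a j x) J / (1 + enorm d x powr (2 * p))))"

text \<open>One-sided at the endpoints of \<open>[0,1]\<close>.\<close>

definition time_deriv :: "(real \<Rightarrow> real) \<Rightarrow> real \<Rightarrow> real" where
  "time_deriv g t = vector_derivative g (at t within {0..1})"

definition C12 :: "nat \<Rightarrow> real \<Rightarrow> (real \<Rightarrow> (nat \<Rightarrow> real) \<Rightarrow> real) \<Rightarrow> bool" where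
  "C12 d p f \<longleftrightarrow>
     (\<forall>x\<in>Rd d. (\<forall>t\<in>{0..1}. (\<lambda>s. f s x) differentiable (at t within {0..1})) \<and>
               continuous_on {0..1} (time_deriv (\<lambda>s. f s x))) \<and>
     (\<forall>t\<in>{0..1}. cont_diff d 2 (f t)) \<and>
     (SUP t\<in>{0..1}. growth_norm d p {()} (\<lambda>_. f t)) < \<infinity> \<and>
     (SUP t\<in>{0..1}. growth_norm d p {()} (\<lambda>_ x. time_deriv (\<lambda>s. f s x) t)) < \<infinity> \<and>
     (SUP t\<in>{0..1}. growth_norm d p {..<d} (\<lambda>i. pderivative i (f t))) < \<infinity> \<and>
     (SUP t\<in>{0..1}. growth_norm d p ({..<d} \<times> {..<d})
                      (\<lambda>(i, j). pderivative i (pderivative j (f t)))) < \<infinity>"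


section \<open>The potential\<close>

definition minimizer :: "nat \<Rightarrow> (real \<Rightarrow> (nat \<Rightarrow> real) \<Rightarrow> real) \<Rightarrow> real \<Rightarrow> nat \<Rightarrow> real" where
  "minimizer d U t = arg_min_on (U t) (Rd d)"

definition potential ::
    "nat \<Rightarrow> (real \<Rightarrow> (nat \<Rightarrow> real) \<Rightarrow> real) \<Rightarrow> real \<Rightarrow> real \<Rightarrow> real \<Rightarrow> bool" where
  "potential d U L K M \<longleftrightarrow>
     (\<forall>t\<in>{0..1}. \<forall>x\<in>Rd d. 0 \<le> U t x) \<and>
     (\<exists>p\<ge>1. C12 d p U) \<and>
     (\<forall>t\<in>{0..1}. \<forall>x\<in>Rd d. \<forall>y\<in>Rd d.
        enorm d (\<lambda>i. pderivative i (U t) x - pderivative i (U t) y) \<le> L * edist d x y) \<and>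
     (\<forall>t\<in>{0..1}. \<forall>x\<in>Rd d. enorm d (\<lambda>i. pderivative i (U t) x) \<le> L * (1 + enorm d x)) \<and>
     0 < K \<and>
     (\<forall>t\<in>{0..1}. \<forall>x\<in>Rd d. \<forall>v\<in>Rd d.
        (\<Sum>i<d. \<Sum>j<d. v i * pderivative i (pderivative j (U t)) x * v j) \<ge> K * (enorm d v)\<^sup>2) \<and>
     minimizer d U 0 = (\<lambda>_. 0) \<and>
     (\<forall>t\<in>{0..1}. \<forall>s\<in>{0..1}. \<forall>x\<in>Rd d.
        enorm d (\<lambda>i. pderivative i (U t) x - pderivative i (U s) x)
          \<le> M * \<bar>t - s\<bar> * sqrt (1 + (edist d x (minimizer d U (min t s)))\<^sup>2)) \<and>
     (\<forall>t\<in>{0..1}. cont_diff d 3 (U t)) \<and>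
     (\<exists>C. \<forall>t\<in>{0..1}. \<forall>x\<in>Rd d. \<forall>i<d. \<forall>j<d. \<forall>k<d.
        \<bar>pderivative i (pderivative j (pderivative k (U t))) x\<bar> \<le> C)"


section \<open>Brownian motion and the two processes\<close>

text \<open>
  The \<open>d\<close>-dimensional Brownian motion on \<open>[0,1]\<close> relative to the filtration \<open>F\<close>, as a random
  element of path space. Only \<open>F t\<close> with \<open>t \<in> [0,1]\<close> matters.
\<close>

definition brownian_motion ::
    "'w measure \<Rightarrow> (real \<Rightarrow> 'w measure) \<Rightarrow> nat \<Rightarrow> ('w \<Rightarrow> real \<Rightarrow> nat \<Rightarrow> real) \<Rightarrow> bool" where
  "brownian_motion \<Omega> F d B \<longleftrightarrow>
     prob_space \<Omega> \<and> filtration (space \<Omega>) F \<and> (\<forall>t. sets (F t) \<subseteq> sets \<Omega>) \<and>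
     B \<in> \<Omega> \<rightarrow>\<^sub>M path_borel d \<and>
     (\<forall>t\<in>{0..1}. (\<lambda>\<omega>. B \<omega> t) \<in> F t \<rightarrow>\<^sub>M borel_of (Euclidean_space d)) \<and>
     (AE \<omega> in \<Omega>. B \<omega> 0 = (\<lambda>_. 0)) \<and>
     (\<forall>s t. 0 \<le> s \<and> s < t \<and> t \<le> 1 \<longrightarrow>
        prob_space.indep_set \<Omega> (sets (F s))
          (sets (vimage_algebra (space \<Omega>) (\<lambda>\<omega>. \<lambda>i\<in>{..<d}. B \<omega> t i - B \<omega> s i)
                   (\<Pi>\<^sub>M i\<in>{..<d}. borel))) \<and>
        distr \<Omega> (\<Pi>\<^sub>M i\<in>{..<d}. borel) (\<lambda>\<omega>. \<lambda>i\<in>{..<d}. B \<omega> t i - B \<omega> s i)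
          = (\<Pi>\<^sub>M i\<in>{..<d}. density lborel (normal_density 0 (sqrt (t - s)))))"

text \<open>
  The integrated equation along a single path \<open>x\<close>, where \<open>b s i\<close> is the \<open>i\<close>-th coordinate of the
  (unscaled, negated) drift at time \<open>s\<close>.
\<close>

definition path_eq ::
    "nat \<Rightarrow> real \<Rightarrow> (real \<Rightarrow> nat \<Rightarrow> real) \<Rightarrow> (nat \<Rightarrow> real) \<Rightarrow> (real \<Rightarrow> nat \<Rightarrow> real)
      \<Rightarrow> (real \<Rightarrow> nat \<Rightarrow> real) \<Rightarrow> bool" where
  "path_eq d \<epsilon> b x0 w x \<longleftrightarrow>
     (\<forall>t\<in>{0..1}. \<forall>i<d. x t i = x0 i - (1 / \<epsilon>) * (LBINT s:{0..t}. b s i) + sqrt (2 / \<epsilon>) * w t i)"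

definition langevin_drift ::
    "(real \<Rightarrow> (nat \<Rightarrow> real) \<Rightarrow> real) \<Rightarrow> (real \<Rightarrow> nat \<Rightarrow> real) \<Rightarrow> real \<Rightarrow> nat \<Rightarrow> real" where
  "langevin_drift U x s i = pderivative i (U s) (x s)"

definition euler_drift ::
    "(real \<Rightarrow> (nat \<Rightarrow> real) \<Rightarrow> real) \<Rightarrow> real \<Rightarrow> (real \<Rightarrow> nat \<Rightarrow> real) \<Rightarrow> real \<Rightarrow> nat \<Rightarrow> real" where
  "euler_drift U h x s i =
     (\<Sum>k<nat \<lfloor>1 / h\<rfloor>. pderivative i (U (real k * h)) (x (real k * h))
        * indicator {real k * h ..< (real k + 1) * h} s)"

end

(*
On a partition of [0,1] containing all Euler times, the Euler scheme Y and the Euler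
discretisation of X on that finer partition are the same functional of Gaussian increments,
except that for Y the increments are shifted by the predictable drift discrepancy. A discrete
Girsanov argument bounds the distance of their laws by the square root of the relative entropy,
which is (1/(4 eps)) times the time integral of the mean square drift discrepancy of Y. This bound does
not depend on the partition, and the fine discretisation converges pathwise to X as the mesh
tends to 0; so it passes to Lipschitz functionals of the paths (approximated through Bernstein
polynomials) and, by regularity of Borel measures, to the total variation distance.
The mean square discrepancy is controlled by the contraction of the gradient step
towards the moving minimiser.
*)

theory Submission
  imports Defs
begin

section \<open>Calculus on \<open>R\<^sup>d\<close> and the potential\<close>

text \<open>The noise is additive: it cancels in the difference between \<open>X\<close> and its
  fine discretisation, so their closeness is an ordinary Gronwall estimate along each path, without
  stochastic integrals, and the change of measure concerns finitely many Gaussian vectors only. The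
  direction of the relative entropy matters. It is an expectation under the original measure, where
  the noise is centred and the discrepancy is evaluated along \<open>Y\<close>; hence second moments
  of \<open>Y\<close> suffice and no exponential moment of the drift enters. If 1/h is not an
  integer, the Euler drift vanishes on the last piece of [0,1]. There the full gradient is the
  discrepancy, but only for a time of at most h. The equation of \<open>Y\<close> holds almost
  surely and the filtration need not be complete, so \<open>Y\<close> is replaced by a version
  \<open>Y'\<close> that is adapted and obeys its recursion at every sample point. The exponent 4q+1
  is q + (3q+1): the mean square distance of the scheme from the minimiser is O(d^(3q+1)), and M^2,
  or L^2 bounded by 1 + L^4, contributes d^q. In the term with L^4 the factor d is absorbed by h
  d/\<epsilon> = O(1).\<close>

lemma Rd_iff: "x \<in> Rd d \<longleftrightarrow> (\<forall>i\<ge>d. x i = 0)"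
  by (simp add: topspace_Euclidean_space)

lemma Euclidean_space_top_of_set: "Euclidean_space d = top_of_set (Rd d)"
  unfolding Euclidean_space_def topspace_subtopology topspace_product_topology
  by (simp add: euclidean_product_topology)

lemma continuous_map_Euclidean_space_iff:
  "continuous_map (Euclidean_space d) euclidean f \<longleftrightarrow> continuous_on (Rd d) f"
  by (subst Euclidean_space_top_of_set) simp

lemma enorm_nonneg [simp]: "0 \<le> enorm d x"
  by (simp add: enorm_def)

lemma edist_nonneg [simp]: "0 \<le> edist d x y"
  by (simp add: edist_def)

lemma enorm_power2: "(enorm d x)\<^sup>2 = (\<Sum>i<d. (x i)\<^sup>2)"
  by (simp add: enorm_def L2_set_def sum_nonneg)

lemma edist_power2: "(edist d x y)\<^sup>2 = (\<Sum>i<d. (x i - y i)\<^sup>2)"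
  by (simp add: edist_def enorm_power2)

lemma enorm_triangle: "enorm d (\<lambda>i. x i + y i) \<le> enorm d x + enorm d y"
  unfolding enorm_def by (rule L2_set_triangle_ineq)

lemma enorm_minus: "enorm d (\<lambda>i. x i - y i) = enorm d (\<lambda>i. y i - x i)"
  by (simp add: enorm_def L2_set_def power2_commute)

lemma enorm_Cauchy_Schwarz: "\<bar>\<Sum>i<d. x i * y i\<bar> \<le> enorm d x * enorm d y"
proof -
  have "\<bar>\<Sum>i<d. x i * y i\<bar> \<le> (\<Sum>i<d. \<bar>x i\<bar> * \<bar>y i\<bar>)"
    by (rule order_trans[OF sum_abs]) (simp add: abs_mult)
  also have "\<dots> \<le> enorm d x * enorm d y"
    unfolding enorm_def by (rule L2_set_mult_ineq)
  finally show ?thesis .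
qed

lemma abs_le_enorm: "i < d \<Longrightarrow> \<bar>x i\<bar> \<le> enorm d x"
  using member_le_L2_set[of "{..<d}" i "\<lambda>i. \<bar>x i\<bar>"]
  by (simp add: enorm_def L2_set_def)

lemma enorm_le_sum: "enorm d x \<le> (\<Sum>i<d. \<bar>x i\<bar>)"
  unfolding enorm_def by (rule L2_set_le_sum_abs)

lemma enorm_add_power2_le: "(enorm d (\<lambda>i. x i + y i))\<^sup>2 \<le> 2 * (enorm d x)\<^sup>2 + 2 * (enorm d y)\<^sup>2"
proof -
  have "(x i + y i)\<^sup>2 \<le> 2 * (x i)\<^sup>2 + 2 * (y i)\<^sup>2" for i
    using sum_squares_bound[of "x i" "y i"] by (simp add: power2_sum)
  then show ?thesis
    unfolding enorm_power2 sum_distrib_left sum.distrib[symmetric] by (rule sum_mono)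
qed

lemma enorm_cong: "(\<And>i. i < d \<Longrightarrow> x i = y i) \<Longrightarrow> enorm d x = enorm d y"
  unfolding enorm_def by (rule L2_set_cong) auto

lemma tendsto_fun_coordinatewise:
  fixes f :: "'a \<Rightarrow> 'i \<Rightarrow> 'b::topological_space"
  assumes "\<And>i. ((\<lambda>x. f x i) \<longlongrightarrow> l i) F"
  shows "(f \<longlongrightarrow> l) F"
  using assms
  by (simp flip: limitin_canonical_iff euclidean_product_topology add: limitin_componentwise)

text \<open>Partial derivatives are defined coordinatewise; the increment along a segment is telescoped
  into \<open>d\<close> increments each in one coordinate, and the mean value theorem is applied to each.\<close>

lemma cont_diff_directional_derivative:
  assumes f: "cont_diff d (Suc 0) f" and y: "y \<in> Rd d" and v: "v \<in> Rd d"
  shows "((\<lambda>s. f (\<lambda>i. y i + s * v i)) has_real_derivative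
           (\<Sum>i<d. v i * pderivative i f (\<lambda>i. y i + s * v i))) (at s)"
proof -
  define z where "z = (\<lambda>i. y i + s * v i)"
  have z: "z \<in> Rd d" using y v by (simp add: z_def Rd_iff)
  \<comment> \<open>Intermediate points between \<open>z\<close> and its displacement by
    \<open>\<tau>\<close> times \<open>v\<close>: the coordinates below \<open>k\<close> have
    already moved.\<close>
  define p where "p \<tau> k = (\<lambda>i. if i < k then z i + \<tau> * v i else z i)" for \<tau> :: real and k :: nat
  have pRd: "p \<tau> k \<in> Rd d" for \<tau> k using z v by (simp add: p_def Rd_iff)
  have "\<exists>\<theta>. \<bar>\<theta> i\<bar> \<le> \<bar>\<tau>\<bar> \<and> f (p \<tau> (Suc i)) - f (p \<tau> i)
           = \<tau> * v i * pderivative i f ((p \<tau> i)(i := z i + \<theta> i * v i))"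
    if i: "i < d" for i :: nat and \<tau> :: real
  proof -
    define g where "g r = f ((p \<tau> i)(i := z i + r * v i))" for r
    have g': "(g has_real_derivative v i * pderivative i f ((p \<tau> i)(i := z i + r * v i))) (at r)" for r
    proof -
      let ?x = "(p \<tau> i)(i := z i + r * v i)"
      have "?x \<in> Rd d" using pRd[of \<tau> i] i by (simp add: Rd_iff)
      with f i have "(\<lambda>s. f (?x(i := s))) differentiable at (?x i)"
        unfolding cont_diff.simps by blast
      then have D: "((\<lambda>s. f (?x(i := s))) has_real_derivative pderivative i f ?x) (at (z i + r * v i))"
        unfolding pderivative_def by (metis DERIV_deriv_iff_real_differentiable fun_upd_same)
      have "((\<lambda>r. z i + r * v i) has_real_derivative v i) (at r)"
        by (auto intro!: derivative_eq_intros)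
      from DERIV_chain2[OF D this] show ?thesis
        by (simp add: g_def[abs_def] mult.commute)
    qed
    have e: "f (p \<tau> (Suc i)) = g \<tau>" "f (p \<tau> i) = g 0"
      by (auto simp: g_def p_def intro!: arg_cong[where f=f])
    have "\<exists>\<theta>. \<bar>\<theta>\<bar> \<le> \<bar>\<tau>\<bar> \<and> g \<tau> - g 0 = \<tau> * (v i * pderivative i f ((p \<tau> i)(i := z i + \<theta> * v i)))"
    proof (cases "\<tau> = 0")
      case False
      then consider "0 < \<tau>" | "\<tau> < 0" by linarith
      then show ?thesis
      proof cases
        case 1
        from MVT2[OF 1 g'] obtain \<theta> where "0 < \<theta>" "\<theta> < \<tau>"
          "g \<tau> - g 0 = (\<tau> - 0) * (v i * pderivative i f ((p \<tau> i)(i := z i + \<theta> * v i)))" by blast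
        then show ?thesis by (intro exI[of _ \<theta>]) auto
      next
        case 2
        from MVT2[OF 2 g'] obtain \<theta> where "\<tau> < \<theta>" "\<theta> < 0"
          "g 0 - g \<tau> = (0 - \<tau>) * (v i * pderivative i f ((p \<tau> i)(i := z i + \<theta> * v i)))" by blast
        then show ?thesis by (intro exI[of _ \<theta>]) auto
      qed
    qed simp
    then obtain \<theta>' where "\<bar>\<theta>'\<bar> \<le> \<bar>\<tau>\<bar>" "g \<tau> - g 0 = \<tau> * (v i * pderivative i f ((p \<tau> i)(i := z i + \<theta>' * v i)))"
      by blast
    then show ?thesis by (intro exI[of _ "\<lambda>_. \<theta>'"]) (simp add: e)
  qed
  then have "\<forall>i \<tau>. \<exists>\<theta>. i < d \<longrightarrow> \<bar>\<theta>\<bar> \<le> \<bar>\<tau>\<bar> \<and> f (p \<tau> (Suc i)) - f (p \<tau> i)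
           = \<tau> * v i * pderivative i f ((p \<tau> i)(i := z i + \<theta> * v i))"
    by metis
  then obtain \<theta> where \<theta>: "\<And>i \<tau>. i < d \<Longrightarrow> \<bar>\<theta> i \<tau>\<bar> \<le> \<bar>\<tau>\<bar>"
    "\<And>i \<tau>. i < d \<Longrightarrow> f (p \<tau> (Suc i)) - f (p \<tau> i)
           = \<tau> * v i * pderivative i f ((p \<tau> i)(i := z i + \<theta> i \<tau> * v i))"
    by metis
  have lim: "((\<lambda>\<tau>. \<Sum>i<d. v i * pderivative i f ((p \<tau> i)(i := z i + \<theta> i \<tau> * v i)))
      \<longlongrightarrow> (\<Sum>i<d. v i * pderivative i f z)) (at 0)"
  proof (intro tendsto_sum tendsto_mult tendsto_const)
    fix i assume "i \<in> {..<d}"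
    then have i: "i < d" by simp
    have c: "continuous_on (Rd d) (pderivative i f)"
      using f i by (simp flip: continuous_map_Euclidean_space_iff)
    \<comment> \<open>The mean value parameters are not known to depend continuously on \<tau>;
      being bounded by it suffices for the evaluation points to tend to \<open>z\<close>.\<close>
    have t0: "((\<lambda>\<tau>. \<theta> i \<tau>) \<longlongrightarrow> 0) (at 0)"
      by (rule tendsto_0_le[where f="\<lambda>\<tau>. \<tau>" and K=1]) (use \<theta>(1)[OF i] in auto)
    have "((\<lambda>\<tau>. (p \<tau> i)(i := z i + \<theta> i \<tau> * v i)) \<longlongrightarrow> z) (at 0)"
    proof (rule tendsto_fun_coordinatewise)
      fix k
      have "((\<lambda>\<tau>. z i + \<theta> i \<tau> * v i) \<longlongrightarrow> z i) (at 0)"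
        using tendsto_add[OF tendsto_const[of "z i"] tendsto_mult_left_zero[OF t0, of "v i"]] by simp
      moreover have "((\<lambda>\<tau>. z k + \<tau> * v k) \<longlongrightarrow> z k) (at 0)"
        by (auto intro!: tendsto_eq_intros)
      ultimately show "((\<lambda>\<tau>. ((p \<tau> i)(i := z i + \<theta> i \<tau> * v i)) k) \<longlongrightarrow> z k) (at 0)"
        by (cases "k = i"; cases "k < i") (simp_all add: p_def)
    qed
    moreover have "\<forall>\<^sub>F \<tau> in at 0. (p \<tau> i)(i := z i + \<theta> i \<tau> * v i) \<in> Rd d"
      using pRd i by (intro always_eventually allI) (simp add: Rd_iff)
    ultimately show "((\<lambda>\<tau>. pderivative i f ((p \<tau> i)(i := z i + \<theta> i \<tau> * v i)))
        \<longlongrightarrow> pderivative i f z) (at 0)"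
      by (rule continuous_on_tendsto_compose[OF c _ z])
  qed
  have eq: "(\<Sum>i<d. v i * pderivative i f ((p \<tau> i)(i := z i + \<theta> i \<tau> * v i)))
      = (f (\<lambda>i. y i + (s + \<tau>) * v i) - f z) / \<tau>" if "\<tau> \<noteq> 0" for \<tau>
  proof -
    have "p \<tau> d = (\<lambda>i. y i + (s + \<tau>) * v i)"
      using v y by (auto simp: p_def z_def Rd_iff algebra_simps)
    moreover have "p \<tau> 0 = z" by (simp add: p_def)
    ultimately have "f (\<lambda>i. y i + (s + \<tau>) * v i) - f z = (\<Sum>i<d. f (p \<tau> (Suc i)) - f (p \<tau> i))"
      by (simp add: sum_lessThan_telescope[where f="\<lambda>k. f (p \<tau> k)"])
    also have "\<dots> = \<tau> * (\<Sum>i<d. v i * pderivative i f ((p \<tau> i)(i := z i + \<theta> i \<tau> * v i)))"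
      using \<theta>(2) by (simp add: sum_distrib_left mult.assoc)
    finally show ?thesis using that by simp
  qed
  have "\<forall>\<^sub>F \<tau> in at 0. (\<Sum>i<d. v i * pderivative i f ((p \<tau> i)(i := z i + \<theta> i \<tau> * v i)))
      = (f (\<lambda>i. y i + (s + \<tau>) * v i) - f z) / \<tau>"
    unfolding eventually_at_filter by (intro always_eventually allI impI eq)
  with lim have "((\<lambda>\<tau>. (f (\<lambda>i. y i + (s + \<tau>) * v i) - f z) / \<tau>)
      \<longlongrightarrow> (\<Sum>i<d. v i * pderivative i f z)) (at 0)"
    by (rule Lim_transform_eventually)
  then show ?thesis by (simp add: DERIV_def z_def)
qed

section \<open>Strong convexity: monotone gradient and existence of a minimiser\<close>

locale strongly_convex_gradient =
  fixes d :: nat and f :: "(nat \<Rightarrow> real) \<Rightarrow> real" and K :: real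
  assumes cont_diff2: "cont_diff d 2 f" and K_pos: "0 < K"
    and hessian: "\<And>x v. x \<in> Rd d \<Longrightarrow> v \<in> Rd d \<Longrightarrow>
      (\<Sum>i<d. \<Sum>j<d. v i * pderivative i (pderivative j f) x * v j) \<ge> K * (enorm d v)\<^sup>2"
begin

lemma cont_diff_pderivative: "i < d \<Longrightarrow> cont_diff d (Suc 0) (pderivative i f)"
  using cont_diff2 by (simp add: numeral_2_eq_2)

lemma cont_diff1: "cont_diff d (Suc 0) f"
  using cont_diff2 by (auto simp: numeral_2_eq_2)

text \<open>The Hessian form in the direction x - y is the derivative of the directional derivative
  along the segment from y to x, so a single application of the mean value theorem suffices.\<close>

lemma gradient_strongly_monotone:
  assumes x: "x \<in> Rd d" and y: "y \<in> Rd d"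
  shows "K * (edist d x y)\<^sup>2 \<le> (\<Sum>i<d. (pderivative i f x - pderivative i f y) * (x i - y i))"
proof -
  define v where "v = (\<lambda>i. x i - y i)"
  have v: "v \<in> Rd d" using x y by (simp add: v_def Rd_iff)
  define g where "g s = (\<Sum>j<d. v j * pderivative j f (\<lambda>i. y i + s * v i))" for s
  have "(g has_real_derivative (\<Sum>j<d. v j * (\<Sum>i<d. v i * pderivative i (pderivative j f) (\<lambda>i. y i + s * v i)))) (at s)" for s
    unfolding g_def[abs_def]
    by (intro derivative_intros) (auto intro!: DERIV_cmult cont_diff_directional_derivative y v cont_diff_pderivative)
  from MVT2[of 0 1 g, OF _ this] obtain \<theta> where
    \<theta>: "g 1 - g 0 = (\<Sum>j<d. v j * (\<Sum>i<d. v i * pderivative i (pderivative j f) (\<lambda>i. y i + \<theta> * v i)))"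
    by auto
  also have "\<dots> = (\<Sum>i<d. \<Sum>j<d. v i * pderivative i (pderivative j f) (\<lambda>i. y i + \<theta> * v i) * v j)"
    by (subst sum.swap) (simp add: sum_distrib_left mult_ac)
  also have "\<dots> \<ge> K * (enorm d v)\<^sup>2"
    by (rule hessian[OF _ v]) (use y v in \<open>simp add: Rd_iff\<close>)
  finally have "K * (enorm d v)\<^sup>2 \<le> g 1 - g 0" .
  moreover have "g 1 - g 0 = (\<Sum>i<d. (pderivative i f x - pderivative i f y) * (x i - y i))"
    by (simp add: g_def v_def sum_subtractf[symmetric] algebra_simps)
  ultimately show ?thesis by (simp add: v_def edist_def)
qed

text \<open>Along the ray through \<open>x\<close>, subtracting the quadratic leaves a function
  whose slope never falls below the slope of \<open>f\<close> at the origin. The resulting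
  coercivity confines the minimisation to a compact set.\<close>

lemma quadratic_lower_bound:
  assumes x: "x \<in> Rd d"
  shows "f (\<lambda>_. 0) + (\<Sum>i<d. x i * pderivative i f (\<lambda>_. 0)) + K / 2 * (enorm d x)\<^sup>2 \<le> f x"
proof -
  have z: "(\<lambda>_. 0) \<in> Rd d" by (simp add: Rd_iff)
  define g where "g s = f (\<lambda>i. 0 + s * x i) - K / 2 * (enorm d x)\<^sup>2 * s\<^sup>2" for s :: real
  have "(g has_real_derivative (\<Sum>i<d. x i * pderivative i f (\<lambda>i. 0 + s * x i)) - K * (enorm d x)\<^sup>2 * s) (at s)" for s
    unfolding g_def[abs_def]
    by (rule derivative_eq_intros cont_diff_directional_derivative[OF cont_diff1 z x] refl | simp)+
  from MVT2[of 0 1 g, OF _ this] obtain s where s: "0 < s"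
    "g 1 - g 0 = (\<Sum>i<d. x i * pderivative i f (\<lambda>i. s * x i)) - K * (enorm d x)\<^sup>2 * s"
    by auto
  have sx: "(\<lambda>i. s * x i) \<in> Rd d" using x by (simp add: Rd_iff)
  \<comment> \<open>Strong monotonicity between \<open>s * x\<close> and the origin; dividing by s >
    0 bounds the slope at s from below.\<close>
  have "K * (s\<^sup>2 * (enorm d x)\<^sup>2) \<le> s * (\<Sum>i<d. (pderivative i f (\<lambda>i. s * x i) - pderivative i f (\<lambda>_. 0)) * x i)"
    using gradient_strongly_monotone[OF sx z]
    by (simp add: edist_power2 enorm_power2 power_mult_distrib sum_distrib_left mult_ac)
  then have "s * (K * s * (enorm d x)\<^sup>2) \<le> s * (\<Sum>i<d. (pderivative i f (\<lambda>i. s * x i) - pderivative i f (\<lambda>_. 0)) * x i)"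
    by (simp add: power2_eq_square mult_ac)
  then have "K * s * (enorm d x)\<^sup>2 \<le> (\<Sum>i<d. (pderivative i f (\<lambda>i. s * x i) - pderivative i f (\<lambda>_. 0)) * x i)"
    using s(1) by simp
  then have "(\<Sum>i<d. x i * pderivative i f (\<lambda>_. 0)) \<le> g 1 - g 0"
    unfolding s(2) by (simp add: algebra_simps sum_subtractf)
  then show ?thesis by (simp add: g_def)
qed

lemma ex_minimizer: "\<exists>x\<in>Rd d. \<forall>y\<in>Rd d. f x \<le> f y"
proof -
  define G where "G = enorm d (\<lambda>i. pderivative i f (\<lambda>_. 0))"
  \<comment> \<open>Beyond this radius K/2 |y|^2 exceeds |y| G, the largest possible loss through
    the linear term at the origin. The compact set is a cube, so that compactness comes from the
    product topology.\<close>
  define R where "R = 2 * G / K"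
  have R: "0 \<le> R" using K_pos by (simp add: R_def G_def)
  define S where "S = PiE UNIV (\<lambda>i. if i < d then {-R..R} else {0::real})"
  have "compactin (product_topology (\<lambda>_. euclidean) UNIV) S"
    unfolding S_def compactin_PiE by auto
  then have comp: "compact S" by (simp add: euclidean_product_topology)
  have z: "(\<lambda>_. 0) \<in> S" using R by (auto simp: S_def PiE_iff)
  have SR: "S \<subseteq> Rd d"
  proof
    fix x assume "x \<in> S"
    then have "x i \<in> (if i < d then {-R..R} else {0::real})" for i
      unfolding S_def by (rule PiE_mem) simp
    from this show "x \<in> Rd d" unfolding Rd_iff by (metis not_le singletonD)
  qed
  have "continuous_on (Rd d) f" using cont_diff1 by (simp flip: continuous_map_Euclidean_space_iff)
  then have "continuous_on S f" using SR by (rule continuous_on_subset)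
  with comp z obtain x where x: "x \<in> S" "\<And>y. y \<in> S \<Longrightarrow> f x \<le> f y"
    using continuous_attains_inf[of S f] by blast
  have "f x \<le> f y" if y: "y \<in> Rd d" for y
  proof (cases "enorm d y \<le> R")
    case True
    have "- R \<le> y i \<and> y i \<le> R" if "i < d" for i
      using abs_le_enorm[OF that, of y] True by linarith
    then have "y \<in> S" using y by (auto simp: S_def PiE_iff Rd_iff)
    then show ?thesis by (rule x(2))
  next
    case False
    have "\<bar>\<Sum>i<d. y i * pderivative i f (\<lambda>_. 0)\<bar> \<le> enorm d y * G"
      unfolding G_def by (rule enorm_Cauchy_Schwarz)
    moreover have "enorm d y * G \<le> K / 2 * (enorm d y)\<^sup>2"
    proof -
      have "G \<le> K / 2 * enorm d y" using False K_pos by (simp add: R_def field_simps)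
      then have "enorm d y * G \<le> enorm d y * (K / 2 * enorm d y)" by (rule mult_left_mono) simp
      then show ?thesis by (simp add: power2_eq_square mult_ac)
    qed
    ultimately have "f (\<lambda>_. 0) \<le> f y" using quadratic_lower_bound[OF y] by linarith
    with x(2)[OF z] show ?thesis by linarith
  qed
  then show ?thesis using x(1) SR by blast
qed

text \<open>\<open>arg_min_on\<close> is a choice and says nothing until some minimiser is known to
  exist. The partial derivatives vanish by Fermat's criterion in each coordinate, since changing a
  coordinate below \<open>d\<close> stays in \<open>Rd d\<close>.\<close>

lemma arg_min_on_Rd:
  shows arg_min_on_mem_Rd: "arg_min_on f (Rd d) \<in> Rd d"
    and pderivative_arg_min_on: "i < d \<Longrightarrow> pderivative i f (arg_min_on f (Rd d)) = 0"
proof -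
  let ?m = "arg_min_on f (Rd d)"
  obtain x where "x \<in> Rd d" "\<forall>y\<in>Rd d. f x \<le> f y" using ex_minimizer by blast
  then have "is_arg_min f (\<lambda>x. x \<in> Rd d) x" by (auto simp: is_arg_min_linorder)
  then have "is_arg_min f (\<lambda>x. x \<in> Rd d) ?m"
    unfolding arg_min_on_def arg_min_def by (metis someI_ex)
  then have m: "?m \<in> Rd d" "\<And>y. y \<in> Rd d \<Longrightarrow> f ?m \<le> f y" by (auto simp: is_arg_min_linorder)
  show "?m \<in> Rd d" by (rule m)
  assume i: "i < d"
  have "(\<lambda>s. f (?m(i := s))) differentiable at (?m i)"
    using cont_diff1 i m(1) by simp
  then have "((\<lambda>s. f (?m(i := s))) has_real_derivative pderivative i f ?m) (at (?m i))"
    unfolding pderivative_def by (simp add: DERIV_deriv_iff_real_differentiable)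
  moreover have "f (?m(i := ?m i)) \<le> f (?m(i := s))" for s
    using m(1) i by (simp, intro m(2)) (auto simp: Rd_iff)
  ultimately show "pderivative i f ?m = 0"
    by (intro DERIV_local_min[of _ _ _ 1]) auto
qed

end

section \<open>The time-dependent potential and its moving minimiser\<close>

locale potential_data =
  fixes d :: nat and U :: "real \<Rightarrow> (nat \<Rightarrow> real) \<Rightarrow> real" and L K M :: real
  assumes pot: "potential d U L K M" and d_pos: "1 \<le> d"
    and minimizer_differentiable: "\<And>t i. t \<in> {0..1} \<Longrightarrow> i < d \<Longrightarrow>
      (\<lambda>s. minimizer d U s i) differentiable (at t within {0..1})"
begin

abbreviation grad :: "real \<Rightarrow> (nat \<Rightarrow> real) \<Rightarrow> nat \<Rightarrow> real" where
  "grad t x \<equiv> (\<lambda>i. pderivative i (U t) x)"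

abbreviation m :: "real \<Rightarrow> nat \<Rightarrow> real" where
  "m \<equiv> minimizer d U"

text \<open>A supremum of reals, hence an upper bound only once boundedness is established;
  \<open>bdd_above_minimizer_speed\<close> derives it from the Lipschitz bound on the
  minimiser.\<close>

definition S2 :: real where
  "S2 = (SUP t\<in>{0..1}. (enorm d (\<lambda>i. time_deriv (\<lambda>s. minimizer d U s i) t))\<^sup>2)"

lemma K_pos: "0 < K"
  and grad_Lipschitz: "t \<in> {0..1} \<Longrightarrow> x \<in> Rd d \<Longrightarrow> y \<in> Rd d \<Longrightarrow>
        enorm d (\<lambda>i. grad t x i - grad t y i) \<le> L * edist d x y"
  and minimizer_0: "m 0 = (\<lambda>_. 0)"
  and grad_time: "t \<in> {0..1} \<Longrightarrow> s \<in> {0..1} \<Longrightarrow> x \<in> Rd d \<Longrightarrow>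
        enorm d (\<lambda>i. grad t x i - grad s x i) \<le> M * \<bar>t - s\<bar> * sqrt (1 + (edist d x (m (min t s)))\<^sup>2)"
  using pot unfolding potential_def by blast+

lemma strongly_convex: "t \<in> {0..1} \<Longrightarrow> strongly_convex_gradient d (U t) K"
  using pot unfolding potential_def strongly_convex_gradient_def C12_def by blast

lemma minimizer_mem: "t \<in> {0..1} \<Longrightarrow> m t \<in> Rd d"
  and grad_minimizer: "t \<in> {0..1} \<Longrightarrow> i < d \<Longrightarrow> grad t (m t) i = 0"
  using strongly_convex_gradient.arg_min_on_Rd[OF strongly_convex] by (auto simp: minimizer_def)

lemmas grad_monotone = strongly_convex_gradient.gradient_strongly_monotone[OF strongly_convex]

lemma K_edist_le_grad:
  assumes "t \<in> {0..1}" "x \<in> Rd d" "y \<in> Rd d"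
  shows "K * edist d x y \<le> enorm d (\<lambda>i. grad t x i - grad t y i)"
proof -
  have "K * (edist d x y)\<^sup>2 \<le> \<bar>\<Sum>i<d. (grad t x i - grad t y i) * (x i - y i)\<bar>"
    using grad_monotone[OF assms] by linarith
  also have "\<dots> \<le> enorm d (\<lambda>i. grad t x i - grad t y i) * edist d x y"
    unfolding edist_def by (rule enorm_Cauchy_Schwarz)
  finally have "(K * edist d x y) * edist d x y \<le> enorm d (\<lambda>i. grad t x i - grad t y i) * edist d x y"
    by (simp add: power2_eq_square mult_ac)
  then show ?thesis
    by (cases "edist d x y = 0") (simp, metis edist_nonneg mult_right_le_imp_le order_le_imp_less_or_eq)
qed

text \<open>The lower and upper Lipschitz bounds of the gradient are compared on a unit vector;
  \<open>1 \<le> d\<close> provides one.\<close>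

lemma K_le_L: "K \<le> L"
proof -
  define e :: "nat \<Rightarrow> real" where "e i = (if i = 0 then 1 else 0)" for i
  have e: "e \<in> Rd d" "(\<lambda>_. 0) \<in> Rd d" using d_pos by (auto simp: Rd_iff e_def)
  have "(edist d e (\<lambda>_. 0))\<^sup>2 = (\<Sum>i<d. if i = 0 then 1 else 0)"
    unfolding edist_power2 by (rule sum.cong) (auto simp: e_def)
  also have "\<dots> = 1" using d_pos by simp
  finally have "edist d e (\<lambda>_. 0) = 1" using edist_nonneg[of d e "\<lambda>_. 0"] by (auto simp: power2_eq_1_iff)
  then show ?thesis using order_trans[OF K_edist_le_grad grad_Lipschitz, of 0 e "\<lambda>_. 0"] e by simp
qed

lemma L_pos: "0 < L" using K_pos K_le_L by linarith

lemma M_nonneg: "0 \<le> M"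
proof -
  have "0 \<le> M * \<bar>1 - 0\<bar> * sqrt (1 + (edist d (\<lambda>_. 0) (m (min 1 0)))\<^sup>2)"
    by (rule order_trans[OF enorm_nonneg grad_time]) (auto simp: Rd_iff)
  then show ?thesis
    using add_pos_nonneg[OF zero_less_one zero_le_power2[of "edist d (\<lambda>_. 0) (m 0)"]]
    by (auto simp: zero_le_mult_iff)
qed

text \<open>The displacement is read off from the gradient at time t, which vanishes at
  \<open>m t\<close>, evaluated at \<open>m s\<close>, where the gradient at time s vanishes. For s
  \<le> t the weight in condition (v) is centred at \<open>m s\<close> itself, so the square root
  equals 1.\<close>

lemma minimizer_Lipschitz_aux:
  assumes "s \<le> t" "s \<in> {0..1}" "t \<in> {0..1}"
  shows "K * edist d (m s) (m t) \<le> M * \<bar>t - s\<bar>"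
proof -
  have "K * edist d (m s) (m t) \<le> enorm d (\<lambda>i. grad t (m s) i - grad t (m t) i)"
    by (rule K_edist_le_grad) (use assms in \<open>auto intro: minimizer_mem\<close>)
  also have "\<dots> = enorm d (\<lambda>i. grad t (m s) i - grad s (m s) i)"
    by (rule enorm_cong) (use assms in \<open>simp add: grad_minimizer\<close>)
  also have "\<dots> \<le> M * \<bar>t - s\<bar>"
    using grad_time[OF assms(3,2) minimizer_mem[OF assms(2)]] assms(1)
    by (simp add: min_def edist_def enorm_def L2_set_def split: if_splits)
  finally show ?thesis .
qed

lemma edist_commute: "edist d x y = edist d y x"
  unfolding edist_def by (rule enorm_minus)

lemma minimizer_Lipschitz:
  assumes "s \<in> {0..1}" "t \<in> {0..1}"
  shows "edist d (m s) (m t) \<le> M / K * \<bar>t - s\<bar>"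
proof -
  have "K * edist d (m s) (m t) \<le> M * \<bar>t - s\<bar>"
    using minimizer_Lipschitz_aux[of s t] minimizer_Lipschitz_aux[of t s] assms
      edist_commute[of "m s" "m t"] abs_minus_commute[of s t] by (cases "s \<le> t") simp_all
  then show ?thesis using K_pos by (simp add: field_simps)
qed

lemma minimizer_has_derivative:
  assumes "t \<in> {0..1}" "i < d"
  shows "((\<lambda>s. m s i) has_real_derivative time_deriv (\<lambda>s. m s i) t) (at t within {0..1})"
  using minimizer_differentiable[OF assms]
  unfolding time_deriv_def has_real_derivative_iff_has_vector_derivative
  by (simp add: vector_derivative_works)

lemma time_deriv_minimizer_le:
  assumes t: "t \<in> {0..1}" and i: "i < d"
  shows "\<bar>time_deriv (\<lambda>s. m s i) t\<bar> \<le> M / K"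
proof -
  have nb: "at t within {0..1} \<noteq> bot" using t by (subst trivial_limit_within) (simp add: islimpt_Icc)
  have "((\<lambda>s. (m s i - m t i) / (s - t)) \<longlongrightarrow> time_deriv (\<lambda>s. m s i) t) (at t within {0..1})"
    using minimizer_has_derivative[OF assms] by (simp add: has_field_derivative_iff)
  then have "((\<lambda>s. \<bar>(m s i - m t i) / (s - t)\<bar>) \<longlongrightarrow> \<bar>time_deriv (\<lambda>s. m s i) t\<bar>) (at t within {0..1})"
    by (rule tendsto_rabs)
  moreover have "\<forall>\<^sub>F s in at t within {0..1}. \<bar>(m s i - m t i) / (s - t)\<bar> \<le> M / K"
    unfolding eventually_at_filter
  proof (intro always_eventually allI impI)
    fix s :: real assume s: "s \<noteq> t" "s \<in> {0..1}"
    have "\<bar>m s i - m t i\<bar> \<le> M / K * \<bar>t - s\<bar>"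
      using abs_le_enorm[OF i, of "\<lambda>i. m s i - m t i"] minimizer_Lipschitz[OF s(2) t]
      by (simp add: edist_def)
    then show "\<bar>(m s i - m t i) / (s - t)\<bar> \<le> M / K"
      using s(1) by (simp add: abs_divide divide_le_eq abs_minus_commute)
  qed
  ultimately show ?thesis by (rule tendsto_upperbound[OF _ _ nb])
qed

lemma bdd_above_minimizer_speed:
  "bdd_above ((\<lambda>t. (enorm d (\<lambda>i. time_deriv (\<lambda>s. m s i) t))\<^sup>2) ` {0..1})"
proof (rule bdd_aboveI2)
  fix t :: real assume t: "t \<in> {0..1}"
  have "(time_deriv (\<lambda>s. m s i) t)\<^sup>2 \<le> (M / K)\<^sup>2" if "i < d" for i
    using time_deriv_minimizer_le[OF t that] M_nonneg K_pos by (intro abs_le_square_iff[THEN iffD1]) simp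
  then have "(\<Sum>i<d. (time_deriv (\<lambda>s. m s i) t)\<^sup>2) \<le> (\<Sum>i<d. (M / K)\<^sup>2)"
    by (intro sum_mono) simp
  then show "(enorm d (\<lambda>i. time_deriv (\<lambda>s. m s i) t))\<^sup>2 \<le> real d * (M / K)\<^sup>2"
    by (simp add: enorm_power2)
qed

lemma minimizer_speed: "t \<in> {0..1} \<Longrightarrow> (enorm d (\<lambda>i. time_deriv (\<lambda>s. m s i) t))\<^sup>2 \<le> S2"
  unfolding S2_def by (rule cSUP_upper[OF _ bdd_above_minimizer_speed])

lemma S2_nonneg: "0 \<le> S2"
  using order_trans[OF zero_le_power2 minimizer_speed[of 0]] by simp

text \<open>The mean value theorem is applied to the scalar function
  \<open>r \<mapsto> (m t - m s) \<bullet> m r\<close>.\<close>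

lemma minimizer_edist_power2_le:
  assumes "s \<in> {0..1}" "t \<in> {0..1}" "s < t"
  shows "(edist d (m t) (m s))\<^sup>2 \<le> S2 * (t - s)\<^sup>2"
proof -
  define v where "v = (\<lambda>i. m t i - m s i)"
  define \<phi> where "\<phi> r = (\<Sum>i<d. v i * m r i)" for r
  have "(\<phi> has_real_derivative (\<Sum>i<d. v i * time_deriv (\<lambda>s. m s i) r)) (at r within {s..t})"
    if "s \<le> r" "r \<le> t" for r
    unfolding \<phi>_def[abs_def]
    by (intro DERIV_sum DERIV_cmult DERIV_subset[OF minimizer_has_derivative])
       (use assms that in auto)
  then have "(\<phi> has_derivative (*) (\<Sum>i<d. v i * time_deriv (\<lambda>s. m s i) r)) (at r within {s..t})"
    if "s \<le> r" "r \<le> t" for r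
    using that by (simp add: has_field_derivative_def)
  from mvt_simple[OF assms(3) this] obtain r where r: "r \<in> {s<..<t}"
    "\<phi> t - \<phi> s = (\<Sum>i<d. v i * time_deriv (\<lambda>s. m s i) r) * (t - s)" by blast
  have r01: "r \<in> {0..1}" using r assms by auto
  have "(enorm d v)\<^sup>2 = \<phi> t - \<phi> s"
    unfolding enorm_power2 \<phi>_def v_def sum_subtractf[symmetric]
    by (rule sum.cong) (auto simp: power2_eq_square algebra_simps)
  also have "\<dots> \<le> (enorm d v * enorm d (\<lambda>i. time_deriv (\<lambda>s. m s i) r)) * (t - s)"
    unfolding r(2) using enorm_Cauchy_Schwarz[where d=d and x=v and y="\<lambda>i. time_deriv (\<lambda>s. m s i) r"] assms(3)
    by (intro mult_right_mono) auto
  finally have "enorm d v * enorm d v \<le> enorm d v * (enorm d (\<lambda>i. time_deriv (\<lambda>s. m s i) r) * (t - s))"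
    by (simp add: power2_eq_square mult_ac)
  then have "enorm d v \<le> enorm d (\<lambda>i. time_deriv (\<lambda>s. m s i) r) * (t - s)"
    by (cases "enorm d v = 0")
      (use assms(3) in simp, metis enorm_nonneg mult_left_le_imp_le order_le_imp_less_or_eq)
  then have "(enorm d v)\<^sup>2 \<le> (enorm d (\<lambda>i. time_deriv (\<lambda>s. m s i) r) * (t - s))\<^sup>2"
    by (rule power_mono) simp
  also have "\<dots> \<le> S2 * (t - s)\<^sup>2"
    unfolding power_mult_distrib by (intro mult_right_mono minimizer_speed r01) simp
  finally show ?thesis by (simp add: v_def edist_def)
qed

text \<open>Both estimates are taken relative to \<open>m t\<close>, where the gradient vanishes:
  strong monotonicity controls the cross term, and the Lipschitz bound controls the term of order
  \<tau>^2.\<close>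

lemma gradient_step_contraction:
  assumes t: "t \<in> {0..1}" and x: "x \<in> Rd d" and \<tau>: "0 \<le> \<tau>"
  shows "(enorm d (\<lambda>i. x i - m t i - \<tau> * grad t x i))\<^sup>2
    \<le> (1 - 2 * \<tau> * K + \<tau>\<^sup>2 * L\<^sup>2) * (edist d x (m t))\<^sup>2"
proof -
  let ?G = "\<Sum>i<d. (grad t x i - grad t (m t) i) * (x i - m t i)"
  have mt: "m t \<in> Rd d" using minimizer_mem[OF t] .
  have g0: "enorm d (grad t x) = enorm d (\<lambda>i. grad t x i - grad t (m t) i)"
    by (rule enorm_cong) (simp add: grad_minimizer[OF t])
  have "(enorm d (\<lambda>i. x i - m t i - \<tau> * grad t x i))\<^sup>2
      = (\<Sum>i<d. (x i - m t i)\<^sup>2 - 2 * \<tau> * ((grad t x i - grad t (m t) i) * (x i - m t i)) + \<tau>\<^sup>2 * (grad t x i)\<^sup>2)"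
    unfolding enorm_power2 by (rule sum.cong) (auto simp: grad_minimizer[OF t] power2_eq_square algebra_simps)
  also have "\<dots> = (edist d x (m t))\<^sup>2 - 2 * \<tau> * ?G + \<tau>\<^sup>2 * (enorm d (grad t x))\<^sup>2"
    by (simp add: sum.distrib sum_subtractf sum_distrib_left edist_power2 enorm_power2)
  also have "\<dots> \<le> (edist d x (m t))\<^sup>2 - 2 * \<tau> * (K * (edist d x (m t))\<^sup>2) + \<tau>\<^sup>2 * (L * edist d x (m t))\<^sup>2"
    unfolding g0
    by (intro add_mono diff_mono mult_left_mono power_mono grad_Lipschitz grad_monotone t x mt) (use \<tau> in auto)
  finally show ?thesis by (simp add: power_mult_distrib algebra_simps)
qed

lemma grad_growth: "t \<in> {0..1} \<Longrightarrow> x \<in> Rd d \<Longrightarrow> enorm d (grad t x) \<le> L * edist d x (m t)"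
  using grad_Lipschitz[OF _ _ minimizer_mem, of t x t]
  by (subst enorm_cong[of d _ "\<lambda>i. grad t x i - grad t (m t) i"]) (simp_all add: grad_minimizer)

text \<open>The intermediate value is the gradient at the later time in the position
  \<open>y\<close>; with \<open>s \<le> t\<close> the weight of condition (v) is then centred at
  \<open>m s\<close>.\<close>

lemma grad_diff_power2_le:
  assumes "t \<in> {0..1}" "s \<in> {0..1}" "s \<le> t" "x \<in> Rd d" "y \<in> Rd d"
  shows "(enorm d (\<lambda>i. grad t x i - grad s y i))\<^sup>2
    \<le> 2 * L\<^sup>2 * (edist d x y)\<^sup>2 + 2 * M\<^sup>2 * (t - s)\<^sup>2 * (1 + (edist d y (m s))\<^sup>2)"
proof -
  have "(enorm d (\<lambda>i. (grad t x i - grad t y i) + (grad t y i - grad s y i)))\<^sup>2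
    \<le> 2 * (enorm d (\<lambda>i. grad t x i - grad t y i))\<^sup>2 + 2 * (enorm d (\<lambda>i. grad t y i - grad s y i))\<^sup>2"
    by (rule enorm_add_power2_le)
  also have "\<dots> \<le> 2 * (L * edist d x y)\<^sup>2 + 2 * (M * \<bar>t - s\<bar> * sqrt (1 + (edist d y (m (min t s)))\<^sup>2))\<^sup>2"
    by (intro add_mono mult_left_mono power_mono grad_Lipschitz grad_time assms) auto
  finally show ?thesis
    using assms(3) by (simp add: power_mult_distrib min_absorb2 add_nonneg_nonneg)
qed

lemma grad_continuous_on: "t \<in> {0..1} \<Longrightarrow> i < d \<Longrightarrow> continuous_on (Rd d) (\<lambda>x. grad t x i)"
  using strongly_convex_gradient.cont_diff_pderivative[OF strongly_convex]
  by (simp flip: continuous_map_Euclidean_space_iff)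

text \<open>Joint continuity is obtained by moving first in space with the Lipschitz bound and then
  in time with condition (v).\<close>

lemma continuous_on_grad_path:
  assumes x: "\<And>t. t \<in> {0..1} \<Longrightarrow> x t \<in> Rd d"
    and c: "\<And>i. i < d \<Longrightarrow> continuous_on {0..1} (\<lambda>t. x t i)"
    and i: "i < d"
  shows "continuous_on {0..1} (\<lambda>t. grad t (x t) i)"
  unfolding continuous_on_def
proof
  fix t :: real assume t: "t \<in> {0..1}"
  let ?b = "\<lambda>s. L * edist d (x s) (x t) + M * \<bar>s - t\<bar> * sqrt (1 + (edist d (x t) (m (min s t)))\<^sup>2)"
  \<comment> \<open>A majorant with continuous dependence on s: the minimiser at
    \<open>min s t\<close> is replaced by the fixed one at \<open>t\<close> plus its Lipschitz
    displacement.\<close>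
  let ?c = "\<lambda>s. L * (\<Sum>i<d. \<bar>x s i - x t i\<bar>) + M * \<bar>s - t\<bar> * sqrt (1 + (edist d (x t) (m t) + M / K * \<bar>s - t\<bar>)\<^sup>2)"
  have le: "\<bar>grad s (x s) i - grad t (x t) i\<bar> \<le> ?c s" if s: "s \<in> {0..1}" for s
  proof -
    have st: "min s t \<in> {0..1}" using s t by auto
    have "\<bar>grad s (x s) i - grad t (x t) i\<bar> \<le> enorm d (\<lambda>i. (grad s (x s) i - grad s (x t) i) + (grad s (x t) i - grad t (x t) i))"
      using abs_le_enorm[OF i, of "\<lambda>i. (grad s (x s) i - grad s (x t) i) + (grad s (x t) i - grad t (x t) i)"] by simp
    also have "\<dots> \<le> ?b s"
      by (rule order_trans[OF enorm_triangle]) (intro add_mono grad_Lipschitz grad_time s t x)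
    also have "\<dots> \<le> ?c s"
    proof (rule add_mono[OF mult_left_mono mult_left_mono[OF real_sqrt_le_mono[OF add_left_mono[OF power_mono]]]])
      show "edist d (x s) (x t) \<le> (\<Sum>i<d. \<bar>x s i - x t i\<bar>)"
        unfolding edist_def by (rule enorm_le_sum)
      have "edist d (x t) (m (min s t)) \<le> edist d (x t) (m t) + edist d (m t) (m (min s t))"
        using Metric_space.triangle[OF Metric_space_Rd x[OF t] minimizer_mem[OF t] minimizer_mem[OF st]] .
      moreover have "edist d (m t) (m (min s t)) \<le> M / K * \<bar>min s t - t\<bar>"
        by (rule minimizer_Lipschitz[OF t st])
      moreover have "M / K * \<bar>min s t - t\<bar> \<le> M / K * \<bar>s - t\<bar>"
        using M_nonneg K_pos by (intro mult_left_mono) auto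
      ultimately show "edist d (x t) (m (min s t)) \<le> edist d (x t) (m t) + M / K * \<bar>s - t\<bar>" by linarith
    qed (use L_pos M_nonneg in simp_all)
    finally show ?thesis .
  qed
  have "\<forall>\<^sub>F s in at t within {0..1}. norm (grad s (x s) i - grad t (x t) i) \<le> norm (?c s) * 1"
    unfolding eventually_at_filter real_norm_def mult_1_right
    by (intro always_eventually allI impI order_trans[OF le abs_ge_self])
  moreover have "(?c \<longlongrightarrow> 0) (at t within {0..1})"
  proof -
    have "((\<lambda>s. \<bar>x s i - x t i\<bar>) \<longlongrightarrow> 0) (at t within {0..1})" if "i < d" for i
      using c[OF that] t by (intro tendsto_rabs_zero LIM_zero) (simp add: continuous_on_def)
    then have 1: "((\<lambda>s. \<Sum>i<d. \<bar>x s i - x t i\<bar>) \<longlongrightarrow> 0) (at t within {0..1})"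
      by (intro tendsto_null_sum) simp
    have 2: "((\<lambda>s. \<bar>s - t\<bar>) \<longlongrightarrow> 0) (at t within {0..1})"
      by (intro tendsto_rabs_zero LIM_zero tendsto_ident_at)
    have "(?c \<longlongrightarrow> L * 0 + M * 0 * sqrt (1 + (edist d (x t) (m t) + M / K * 0)\<^sup>2)) (at t within {0..1})"
      by (intro tendsto_intros 1 2)
    then show ?thesis by simp
  qed
  ultimately have "((\<lambda>s. grad s (x s) i - grad t (x t) i) \<longlongrightarrow> 0) (at t within {0..1})"
    by (rule tendsto_0_le[rotated])
  then show "((\<lambda>s. grad s (x s) i) \<longlongrightarrow> grad t (x t) i) (at t within {0..1})"
    by (rule LIM_zero_cancel)
qed

end

section \<open>Discrete Girsanov transformation\<close>

abbreviation gauss :: "real \<Rightarrow> real measure" where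
  "gauss s \<equiv> density lborel (\<lambda>x. ennreal (normal_density 0 s x))"

text \<open>The exponential is the ratio of the densities at \<open>x + v\<close> and at
  \<open>x\<close>; the substitution is translation invariance of Lebesgue measure. Nonnegative
  integrals keep integrability questions out of the later inductions.\<close>

lemma nn_integral_gauss_shift:
  assumes s: "0 < s" and [measurable]: "f \<in> borel_measurable borel"
  shows "(\<integral>\<^sup>+x. f x \<partial>gauss s)
    = (\<integral>\<^sup>+x. f (x + v) * ennreal (exp (- ((2 * v * x + v\<^sup>2) / (2 * s\<^sup>2)))) \<partial>gauss s)"
proof -
  have *: "normal_density 0 s (x + v) = normal_density 0 s x * exp (- ((2 * v * x + v\<^sup>2) / (2 * s\<^sup>2)))" for x
    by (simp add: normal_density_def exp_add[symmetric] field_simps power2_eq_square flip: add_divide_distrib)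
  have "(\<integral>\<^sup>+x. f x \<partial>gauss s) = (\<integral>\<^sup>+x. normal_density 0 s x * f x \<partial>lborel)"
    by (rule nn_integral_density) auto
  also have "\<dots> = (\<integral>\<^sup>+x. normal_density 0 s (v + 1 * x) * f (v + 1 * x) \<partial>lborel)"
    by (subst nn_integral_real_affine[where c=1 and t=v]) auto
  also have "\<dots> = (\<integral>\<^sup>+x. normal_density 0 s x
      * (f (x + v) * ennreal (exp (- ((2 * v * x + v\<^sup>2) / (2 * s\<^sup>2))))) \<partial>lborel)"
    unfolding mult_1 add.commute[of v] * by (intro nn_integral_cong) (simp only: ennreal_mult' normal_density_nonneg mult_ac exp_ge_zero)
  also have "\<dots> = (\<integral>\<^sup>+x. f (x + v) * ennreal (exp (- ((2 * v * x + v\<^sup>2) / (2 * s\<^sup>2)))) \<partial>gauss s)"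
    by (rule nn_integral_density[symmetric]) auto
  finally show ?thesis .
qed

lemma nn_integral_PiM_gauss_shift:
  assumes s: "0 < s" and "finite I" and "f \<in> borel_measurable (PiM I (\<lambda>_. borel))"
  shows "(\<integral>\<^sup>+z. f z \<partial>PiM I (\<lambda>_. gauss s))
    = (\<integral>\<^sup>+z. f (\<lambda>i\<in>I. z i + v i) * ennreal (exp (- (\<Sum>i\<in>I. (2 * v i * z i + (v i)\<^sup>2) / (2 * s\<^sup>2))))
        \<partial>PiM I (\<lambda>_. gauss s))"
  using assms(2,3)
proof (induction I arbitrary: f rule: finite_induct)
  case empty
  then show ?case by (simp add: PiM_empty nn_integral_count_space_finite)
next
  case (insert i I)
  interpret prob_space "gauss s" using s by (rule prob_space_normal_density)
  interpret product_sigma_finite "\<lambda>_. gauss s" ..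
  note [measurable] = insert.prems
  have upd: "(\<lambda>x. f (x(i := y))) \<in> borel_measurable (PiM I (\<lambda>_. borel))" for y
    by (rule measurable_compose[OF measurable_fun_upd insert.prems]) (use insert.hyps in auto)
  have upd2 [measurable]: "(\<lambda>p. f ((fst p)(i := snd p))) \<in> borel_measurable (PiM I (\<lambda>_. borel) \<Otimes>\<^sub>M borel)"
    by (rule measurable_compose[OF measurable_fun_upd insert.prems]) (use insert.hyps in auto)
  let ?r = "\<lambda>i y. ennreal (exp (- ((2 * v i * y + (v i)\<^sup>2) / (2 * s\<^sup>2))))"
  let ?R = "\<lambda>z. ennreal (exp (- (\<Sum>i\<in>I. (2 * v i * z i + (v i)\<^sup>2) / (2 * s\<^sup>2))))"
  have m1: "f \<in> borel_measurable (PiM (insert i I) (\<lambda>_. gauss s))" by measurable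
  have m2: "(\<lambda>z. f (\<lambda>k\<in>insert i I. z k + v k) *
      ennreal (exp (- (\<Sum>i\<in>insert i I. (2 * v i * z i + (v i)\<^sup>2) / (2 * s\<^sup>2)))))
      \<in> borel_measurable (PiM (insert i I) (\<lambda>_. gauss s))"
    by measurable
  have "(\<integral>\<^sup>+z. f z \<partial>PiM (insert i I) (\<lambda>_. gauss s))
      = (\<integral>\<^sup>+x. (\<integral>\<^sup>+y. f (x(i := y)) \<partial>gauss s) \<partial>PiM I (\<lambda>_. gauss s))"
    by (rule product_nn_integral_insert[OF insert.hyps m1])
  \<comment> \<open>The new coordinate is translated with the others held fixed; the induction
    hypothesis then translates those.\<close>
  also have "\<dots> = (\<integral>\<^sup>+x. (\<integral>\<^sup>+y. f (x(i := y + v i)) * ?r i y \<partial>gauss s) \<partial>PiM I (\<lambda>_. gauss s))"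
  proof (rule nn_integral_cong)
    fix x assume "x \<in> space (PiM I (\<lambda>_. gauss s))"
    then have "x \<in> space (PiM I (\<lambda>_. borel))" by (simp add: space_PiM)
    from measurable_compose[OF measurable_Pair1'[OF this] upd2]
    have "(\<lambda>y. f (x(i := y))) \<in> borel_measurable borel" by simp
    then show "(\<integral>\<^sup>+y. f (x(i := y)) \<partial>gauss s) = (\<integral>\<^sup>+y. f (x(i := y + v i)) * ?r i y \<partial>gauss s)"
      by (rule nn_integral_gauss_shift[OF s])
  qed
  also have "\<dots> = (\<integral>\<^sup>+x. (\<integral>\<^sup>+y. f ((\<lambda>k\<in>I. x k + v k)(i := y + v i)) * ?r i y \<partial>gauss s) * ?R x
      \<partial>PiM I (\<lambda>_. gauss s))"
  proof (rule insert.IH)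
    have "(\<lambda>p. f ((fst p)(i := snd p + v i)) * ?r i (snd p)) \<in> borel_measurable (PiM I (\<lambda>_. borel) \<Otimes>\<^sub>M gauss s)"
      using measurable_compose[of "\<lambda>p. (fst p, snd p + v i)" "PiM I (\<lambda>_. borel) \<Otimes>\<^sub>M gauss s", OF _ upd2] by simp
    then show "(\<lambda>x. \<integral>\<^sup>+y. f (x(i := y + v i)) * ?r i y \<partial>gauss s) \<in> borel_measurable (PiM I (\<lambda>_. borel))"
      by (intro borel_measurable_nn_integral) (simp add: case_prod_beta')
  qed
  also have "\<dots> = (\<integral>\<^sup>+x. (\<integral>\<^sup>+y. f (\<lambda>k\<in>insert i I. (x(i := y)) k + v k) *
      ennreal (exp (- (\<Sum>k\<in>insert i I. (2 * v k * (x(i := y)) k + (v k)\<^sup>2) / (2 * s\<^sup>2)))) \<partial>gauss s)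
      \<partial>PiM I (\<lambda>_. gauss s))"
  proof (rule nn_integral_cong)
    fix x assume "x \<in> space (PiM I (\<lambda>_. gauss s))"
    then have x: "(\<lambda>k\<in>I. x k + v k) \<in> space (PiM I (\<lambda>_. borel))" by (simp add: space_PiM)
    from measurable_compose[OF measurable_Pair1'[OF this] upd2]
    have "(\<lambda>y. f ((\<lambda>k\<in>I. x k + v k)(i := y))) \<in> borel_measurable borel" by simp
    then have [measurable]: "(\<lambda>y. f ((\<lambda>k\<in>I. x k + v k)(i := y + v i))) \<in> borel_measurable borel"
      by (rule measurable_compose[rotated]) simp
    have e: "(\<lambda>k\<in>insert i I. (x(i := y)) k + v k) = (\<lambda>k\<in>I. x k + v k)(i := y + v i)" for y
      using insert.hyps by auto
    have "(\<Sum>k\<in>insert i I. (2 * v k * (x(i := y)) k + (v k)\<^sup>2) / (2 * s\<^sup>2))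
        = (2 * v i * y + (v i)\<^sup>2) / (2 * s\<^sup>2) + (\<Sum>k\<in>I. (2 * v k * x k + (v k)\<^sup>2) / (2 * s\<^sup>2))" for y
      using insert.hyps by (simp, intro sum.cong) auto
    then have e2: "ennreal (exp (- (\<Sum>k\<in>insert i I. (2 * v k * (x(i := y)) k + (v k)\<^sup>2) / (2 * s\<^sup>2)))) = ?r i y * ?R x" for y
      by (simp only: minus_add_distrib exp_add ennreal_mult' exp_ge_zero)
    show "(\<integral>\<^sup>+y. f ((\<lambda>k\<in>I. x k + v k)(i := y + v i)) * ?r i y \<partial>gauss s) * ?R x =
      (\<integral>\<^sup>+y. f (\<lambda>k\<in>insert i I. (x(i := y)) k + v k) *
      ennreal (exp (- (\<Sum>k\<in>insert i I. (2 * v k * (x(i := y)) k + (v k)\<^sup>2) / (2 * s\<^sup>2)))) \<partial>gauss s)"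
      unfolding e e2 mult.assoc[symmetric] by (rule nn_integral_multc[symmetric]) measurable
  qed
  also have "\<dots> = (\<integral>\<^sup>+z. f (\<lambda>k\<in>insert i I. z k + v k) *
      ennreal (exp (- (\<Sum>i\<in>insert i I. (2 * v i * z i + (v i)\<^sup>2) / (2 * s\<^sup>2)))) \<partial>PiM (insert i I) (\<lambda>_. gauss s))"
    by (rule product_nn_integral_insert[OF insert.hyps m2, symmetric])
  finally show ?case .
qed

section \<open>Independence of a random vector from a sigma-algebra\<close>

lemma (in prob_space) distr_Pair_indep_set:
  assumes G: "space G = space M" "sets G \<subseteq> sets M" and X: "X \<in> M \<rightarrow>\<^sub>M P"
    and ind: "indep_set (sets G) (sets (vimage_algebra (space M) X P))"
  shows "distr M G (\<lambda>\<omega>. \<omega>) \<Otimes>\<^sub>M distr M P X = distr M (G \<Otimes>\<^sub>M P) (\<lambda>\<omega>. (\<omega>, X \<omega>))"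
proof -
  have id: "(\<lambda>\<omega>. \<omega>) \<in> M \<rightarrow>\<^sub>M G"
    using G by (intro measurableI) (auto simp: Int_absorb2 sets.sets_into_space subset_iff)
  interpret D: prob_space "distr M P X" by (rule prob_space_distr[OF X])
  interpret E: prob_space "distr M G (\<lambda>\<omega>. \<omega>)" by (rule prob_space_distr[OF id])
  show ?thesis
  proof (rule pair_measure_eqI)
    fix A B assume "A \<in> sets (distr M G (\<lambda>\<omega>. \<omega>))" "B \<in> sets (distr M P X)"
    then have AB: "A \<in> sets G" "B \<in> sets P" by auto
    have sp: "A \<subseteq> space M" using sets.sets_into_space[OF AB(1)] G by simp
    have "X -` B \<inter> space M \<in> sets (vimage_algebra (space M) X P)"
      using AB(2) by (rule in_vimage_algebra)
    with ind AB(1) have "prob (A \<inter> (X -` B \<inter> space M)) = prob A * prob (X -` B \<inter> space M)"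
      unfolding indep_sets2_eq by blast
    moreover have "A \<inter> (X -` B \<inter> space M) = (\<lambda>\<omega>. (\<omega>, X \<omega>)) -` (A \<times> B) \<inter> space M"
      "(\<lambda>\<omega>. \<omega>) -` A \<inter> space M = A" using sp by auto
    ultimately show "emeasure (distr M G (\<lambda>\<omega>. \<omega>)) A * emeasure (distr M P X) B =
      emeasure (distr M (G \<Otimes>\<^sub>M P) (\<lambda>\<omega>. (\<omega>, X \<omega>))) (A \<times> B)"
      using AB id X by (simp add: emeasure_distr emeasure_eq_measure ennreal_mult'')
  qed (auto intro: D.sigma_finite_measure_axioms E.sigma_finite_measure_axioms)
qed

text \<open>The freezing property: given \<open>G\<close>, the first argument is constant and
  \<open>X\<close> is averaged over its law. The whole sample point, seen through \<open>G\<close>,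
  serves as first component, so no particular \<open>G\<close>-measurable variable has to be singled
  out.\<close>

lemma (in prob_space) nn_integral_indep_set:
  assumes G: "space G = space M" "sets G \<subseteq> sets M" and X: "X \<in> M \<rightarrow>\<^sub>M P"
    and ind: "indep_set (sets G) (sets (vimage_algebra (space M) X P))"
    and f: "f \<in> borel_measurable (G \<Otimes>\<^sub>M P)"
  shows "(\<integral>\<^sup>+\<omega>. f (\<omega>, X \<omega>) \<partial>M) = (\<integral>\<^sup>+\<omega>. (\<integral>\<^sup>+z. f (\<omega>, z) \<partial>distr M P X) \<partial>M)"
proof -
  have id: "(\<lambda>\<omega>. \<omega>) \<in> M \<rightarrow>\<^sub>M G"
    using G by (intro measurableI) (auto simp: Int_absorb2 sets.sets_into_space subset_iff)
  interpret D: prob_space "distr M P X" by (rule prob_space_distr[OF X])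
  have f': "f \<in> borel_measurable (distr M G (\<lambda>\<omega>. \<omega>) \<Otimes>\<^sub>M distr M P X)"
    using f by (simp cong: measurable_cong_sets)
  have "(\<integral>\<^sup>+\<omega>. f (\<omega>, X \<omega>) \<partial>M) = (\<integral>\<^sup>+p. f p \<partial>distr M (G \<Otimes>\<^sub>M P) (\<lambda>\<omega>. (\<omega>, X \<omega>)))"
    using id X f by (subst nn_integral_distr) auto
  also have "\<dots> = (\<integral>\<^sup>+\<omega>. (\<integral>\<^sup>+z. f (\<omega>, z) \<partial>distr M P X) \<partial>distr M G (\<lambda>\<omega>. \<omega>))"
    unfolding distr_Pair_indep_set[OF G X ind, symmetric] by (rule D.nn_integral_fst[OF f', symmetric])
  also have "\<dots> = (\<integral>\<^sup>+\<omega>. (\<integral>\<^sup>+z. f (\<omega>, z) \<partial>distr M P X) \<partial>M)"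
    using f by (intro nn_integral_distr[OF id] D.borel_measurable_nn_integral) (simp add: case_prod_beta' cong: measurable_cong_sets)
  finally show ?thesis .
qed

lemma (in prob_space) gauss_component_moments:
  assumes X: "X \<in> M \<rightarrow>\<^sub>M PiM {..<d} (\<lambda>_. borel)"
    and D: "distr M (PiM {..<d} (\<lambda>_. borel)) X = PiM {..<d} (\<lambda>_. gauss \<sigma>)"
    and \<sigma>: "0 < \<sigma>" and i: "i < d"
  shows "integrable M (\<lambda>\<omega>. X \<omega> i)" "expectation (\<lambda>\<omega>. X \<omega> i) = 0"
    "integrable M (\<lambda>\<omega>. (X \<omega> i)\<^sup>2)" "expectation (\<lambda>\<omega>. (X \<omega> i)\<^sup>2) = \<sigma>\<^sup>2"
proof -
  have Xi [measurable]: "(\<lambda>\<omega>. X \<omega> i) \<in> borel_measurable M"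
    using measurable_compose[OF X measurable_component_singleton[of i]] i by simp
  have "distr M borel (\<lambda>\<omega>. X \<omega> i) = distr (distr M (PiM {..<d} (\<lambda>_. borel)) X) borel (\<lambda>z. z i)"
    using X i by (subst distr_distr) (auto simp: comp_def)
  also have "\<dots> = distr (PiM {..<d} (\<lambda>_. gauss \<sigma>)) (gauss \<sigma>) (\<lambda>z. z i)"
    unfolding D by (rule distr_cong) auto
  also have "\<dots> = gauss \<sigma>"
    using i by (intro distr_PiM_component prob_space_normal_density \<sigma>) auto
  finally have "distributed M lborel (\<lambda>\<omega>. X \<omega> i) (\<lambda>x. ennreal (normal_density 0 \<sigma> x))"
    by (simp add: distributed_def cong: distr_cong)
  note dist = distributed_integrable[OF this _ normal_density_nonneg, symmetric]
    distributed_integral[OF this _ normal_density_nonneg, symmetric]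
  have 1: "integrable lborel (\<lambda>x. normal_density 0 \<sigma> x * x)"
    using integrable_normal_moment_nz_1[OF \<sigma>, of 0] .
  have 2: "integrable lborel (\<lambda>x. normal_density 0 \<sigma> x * x\<^sup>2)"
    using integrable_normal_moment[OF \<sigma>, of 0 2] by simp
  have 3: "(\<integral>x. normal_density 0 \<sigma> x * x\<^sup>2 \<partial>lborel) = \<sigma>\<^sup>2"
    using integral_normal_moment_even[OF \<sigma>, of 0 1] by (simp add: fact_numeral power2_eq_square field_simps)
  show "integrable M (\<lambda>\<omega>. X \<omega> i)" using dist(1)[of "\<lambda>x. x"] 1 by simp
  show "expectation (\<lambda>\<omega>. X \<omega> i) = 0"
    using dist(2)[of "\<lambda>x. x"] integral_normal_moment_nz_1[OF \<sigma>, of 0] by simp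
  show "integrable M (\<lambda>\<omega>. (X \<omega> i)\<^sup>2)" using dist(1)[of "\<lambda>x. x\<^sup>2"] 2 by simp
  show "expectation (\<lambda>\<omega>. (X \<omega> i)\<^sup>2) = \<sigma>\<^sup>2" using dist(2)[of "\<lambda>x. x\<^sup>2"] 3 by simp
qed

lemma (in prob_space) integral_mult_indep_set:
  fixes Y :: "'a \<Rightarrow> real"
  assumes G: "space G = space M" "sets G \<subseteq> sets M" and X: "X \<in> M \<rightarrow>\<^sub>M P"
    and ind: "indep_set (sets G) (sets (vimage_algebra (space M) X P))"
    and Y: "Y \<in> borel_measurable G" "integrable M Y" and g: "g \<in> borel_measurable P" "integrable M (\<lambda>\<omega>. g (X \<omega>))"
  shows integrable_mult_indep_set: "integrable M (\<lambda>\<omega>. Y \<omega> * g (X \<omega>))"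
    and expectation_mult_indep_set: "expectation (\<lambda>\<omega>. Y \<omega> * g (X \<omega>)) = expectation Y * expectation (\<lambda>\<omega>. g (X \<omega>))"
proof -
  have "indep_var borel Y borel (\<lambda>\<omega>. g (X \<omega>))"
    unfolding indep_var_eq
  proof (intro conjI)
    have "sigma_sets (space M) {Y -` A \<inter> space M |A. A \<in> sets borel} \<subseteq> sets G"
      unfolding G(1)[symmetric] by (rule sets.sigma_sets_subset) (use Y(1) in auto)
    moreover have "sigma_sets (space M) {(\<lambda>\<omega>. g (X \<omega>)) -` A \<inter> space M |A. A \<in> sets borel}
        \<subseteq> sets (vimage_algebra (space M) X P)"
    proof -
      have "(\<lambda>\<omega>. g (X \<omega>)) \<in> borel_measurable (vimage_algebra (space M) X P)"
        using X by (intro measurable_compose[OF measurable_vimage_algebra1 g(1)]) (auto simp: measurable_space)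
      then show ?thesis
        using sets.sigma_sets_subset[of "{(\<lambda>\<omega>. g (X \<omega>)) -` A \<inter> space M |A. A \<in> sets borel}" "vimage_algebra (space M) X P"]
        using measurable_sets[of "\<lambda>\<omega>. g (X \<omega>)" "vimage_algebra (space M) X P" borel] by fastforce
    qed
    ultimately show "indep_set (sigma_sets (space M) {Y -` A \<inter> space M |A. A \<in> sets borel})
        (sigma_sets (space M) {(\<lambda>\<omega>. g (X \<omega>)) -` A \<inter> space M |A. A \<in> sets borel})"
      using ind unfolding indep_sets2_eq by blast
  qed (use Y(2) g(2) in auto)
  from indep_var_integrable[OF this Y(2) g(2)] indep_var_lebesgue_integral[OF this Y(2) g(2)]
  show "integrable M (\<lambda>\<omega>. Y \<omega> * g (X \<omega>))"
    "expectation (\<lambda>\<omega>. Y \<omega> * g (X \<omega>)) = expectation Y * expectation (\<lambda>\<omega>. g (X \<omega>))" .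
qed

text \<open>Takes the place of Pinsker's inequality. If exp y is a density of mean one, the right
  side integrates to relative entropy over 2a plus 2a, and a is free to be optimised. The root
  \<open>r\<close> of the density appears because (r - 1)^2 is bounded by the entropy integrand, as
  for the Hellinger distance.\<close>

lemma abs_minus_one_le_exp:
  fixes y a :: real
  assumes a: "0 < a"
  shows "\<bar>exp y - 1\<bar> \<le> (exp y - 1 - y) / (2 * a) + a * (exp y + 1)"
proof -
  define r where "r = exp (y / 2)"
  have r: "0 < r" "exp y = r\<^sup>2" by (auto simp: r_def power2_eq_square simp flip: exp_add)
  have h: "(r - 1)\<^sup>2 \<le> exp y - 1 - y"
    using exp_ge_add_one_self[of "y / 2"] unfolding r(2) power2_diff r_def[symmetric] by simp
  have "\<bar>exp y - 1\<bar> = \<bar>r - 1\<bar> * (r + 1)"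
  proof -
    have "r\<^sup>2 - 1 = (r - 1) * (r + 1)" by (simp add: power2_eq_square algebra_simps)
    then show ?thesis using r(1) by (simp add: r(2) abs_mult)
  qed
  \<comment> \<open>Young's inequality for the product, with the weight \<open>a\<close> on the
    factor r + 1.\<close>
  also have "\<dots> \<le> (r - 1)\<^sup>2 / (2 * a) + a / 2 * (r + 1)\<^sup>2"
  proof -
    have "0 \<le> (\<bar>r - 1\<bar> - a * (r + 1))\<^sup>2 / (2 * a)" using a by simp
    then show ?thesis using a by (simp add: power2_diff power_mult_distrib field_simps power2_eq_square)
  qed
  also have "a / 2 * (r + 1)\<^sup>2 \<le> a / 2 * (2 * (r\<^sup>2 + 1))"
    using a zero_le_power2[of "r - 1"] by (intro mult_left_mono) (auto simp: power2_eq_square algebra_simps)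
  also have "(r - 1)\<^sup>2 / (2 * a) \<le> (exp y - 1 - y) / (2 * a)" using h a by (intro divide_right_mono) auto
  finally show ?thesis by (simp add: r(2) algebra_simps)
qed

text \<open>\<open>\<xi> j\<close> is revealed only at step \<open>j + 1\<close>, whereas
  \<open>v j\<close> is known at step \<open>j\<close>: this predictability allows the shift to be
  frozen while the increment is averaged. The variance may differ from step to step, since the grids
  are not uniform.\<close>

locale discrete_girsanov = prob_space +
  fixes N d :: nat and F :: "nat \<Rightarrow> 'a measure" and \<xi> v :: "nat \<Rightarrow> 'a \<Rightarrow> nat \<Rightarrow> real" and s :: "nat \<Rightarrow> real"
  assumes space_F: "\<And>j. j \<le> N \<Longrightarrow> space (F j) = space M"
    and sets_F: "\<And>j. j \<le> N \<Longrightarrow> sets (F j) \<subseteq> sets M"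
    and F_mono: "\<And>j k. j \<le> k \<Longrightarrow> k \<le> N \<Longrightarrow> sets (F j) \<subseteq> sets (F k)"
    and \<xi>_adapted: "\<And>j. j < N \<Longrightarrow> \<xi> j \<in> F (Suc j) \<rightarrow>\<^sub>M PiM {..<d} (\<lambda>_. borel)"
    and s_pos: "\<And>j. j < N \<Longrightarrow> 0 < s j"
    and \<xi>_indep: "\<And>j. j < N \<Longrightarrow> indep_set (sets (F j))
      (sets (vimage_algebra (space M) (\<xi> j) (PiM {..<d} (\<lambda>_. borel))))"
    and \<xi>_distr: "\<And>j. j < N \<Longrightarrow> distr M (PiM {..<d} (\<lambda>_. borel)) (\<xi> j) = PiM {..<d} (\<lambda>_. gauss (s j))"
    and v_adapted: "\<And>j i. j < N \<Longrightarrow> i < d \<Longrightarrow> (\<lambda>\<omega>. v j \<omega> i) \<in> borel_measurable (F j)"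
begin

text \<open>The ratio of the Gaussian densities at the shifted and at the unshifted noise; weighting
  by it gives the shifted noise the law of the unshifted one.\<close>

definition R :: "nat \<Rightarrow> 'a \<Rightarrow> real" where
  "R n \<omega> = exp (- (\<Sum>j<n. \<Sum>i<d. (2 * v j \<omega> i * \<xi> j \<omega> i + (v j \<omega> i)\<^sup>2) / (2 * (s j)\<^sup>2)))"

definition shifted :: "nat \<Rightarrow> 'a \<Rightarrow> nat \<Rightarrow> real" where
  "shifted j \<omega> = (\<lambda>i\<in>{..<d}. \<xi> j \<omega> i + v j \<omega> i)"

lemma measurable_F_mono: "j \<le> k \<Longrightarrow> k \<le> N \<Longrightarrow> f \<in> F j \<rightarrow>\<^sub>M P \<Longrightarrow> f \<in> F k \<rightarrow>\<^sub>M P"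
  using measurable_mono[of P P "F j" "F k"] F_mono[of j k] space_F[of j] space_F[of k] by auto

lemma measurable_F_M: "j \<le> N \<Longrightarrow> f \<in> F j \<rightarrow>\<^sub>M P \<Longrightarrow> f \<in> M \<rightarrow>\<^sub>M P"
  using measurable_mono[of P P "F j" M] sets_F[of j] space_F[of j] by auto

lemmas nn_integral_\<xi> = nn_integral_indep_set[OF space_F sets_F measurable_F_M[OF _ \<xi>_adapted] \<xi>_indep]

lemma \<xi>_component: "j < N \<Longrightarrow> i < d \<Longrightarrow> (\<lambda>\<omega>. \<xi> j \<omega> i) \<in> borel_measurable (F (Suc j))"
  using measurable_compose[OF \<xi>_adapted measurable_component_singleton] by simp

lemma R_measurable: "n \<le> N \<Longrightarrow> R n \<in> borel_measurable (F n)"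
  unfolding R_def[abs_def]
  by (intro borel_measurable_exp borel_measurable_uminus borel_measurable_sum borel_measurable_divide
      borel_measurable_add borel_measurable_times borel_measurable_power borel_measurable_const measurable_compose[OF _ borel_measurable_exp])
     (auto intro: measurable_F_mono[OF _ _ v_adapted] measurable_F_mono[OF _ _ \<xi>_component])

lemma shifted_measurable: "j < N \<Longrightarrow> shifted j \<in> F (Suc j) \<rightarrow>\<^sub>M PiM {..<d} (\<lambda>_. borel)"
  unfolding shifted_def
  by (intro measurable_restrict borel_measurable_add \<xi>_component measurable_F_mono[OF _ _ v_adapted]) auto

lemma R_Suc: "R (Suc n) \<omega> = R n \<omega> * exp (- (\<Sum>i<d. (2 * v n \<omega> i * \<xi> n \<omega> i + (v n \<omega> i)\<^sup>2) / (2 * (s n)\<^sup>2)))"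
  by (simp add: R_def flip: exp_add)

text \<open>Each step integrates out the last Gaussian increment, which is independent of the past,
  and translates it by the predictable shift.\<close>

theorem nn_integral_shifted_noise:
  assumes "n \<le> N" and "f \<in> borel_measurable (F 0 \<Otimes>\<^sub>M PiM {..<n} (\<lambda>_. PiM {..<d} (\<lambda>_. borel)))"
  shows "(\<integral>\<^sup>+\<omega>. f (\<omega>, \<lambda>j\<in>{..<n}. \<xi> j \<omega>) \<partial>M) = (\<integral>\<^sup>+\<omega>. f (\<omega>, \<lambda>j\<in>{..<n}. shifted j \<omega>) * ennreal (R n \<omega>) \<partial>M)"
  using assms
proof (induction n arbitrary: f)
  case 0
  then show ?case by (simp add: R_def)
next
  case (Suc n)
  then have n: "n < N" "n \<le> N" by auto
  let ?D = "PiM {..<d} (\<lambda>_. borel :: real measure)"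
  let ?P = "PiM {..<n} (\<lambda>_. ?D)"
  let ?g = "PiM {..<d} (\<lambda>_. gauss (s n))"
  have sets_g [measurable_cong]: "sets ?g = sets ?D" by (intro sets_PiM_cong) auto
  interpret g: prob_space ?g
    by (intro prob_space_PiM prob_space_normal_density s_pos n)
  have upd: "(\<lambda>p. (fst (fst p), (snd (fst p))(n := snd p))) \<in> (F 0 \<Otimes>\<^sub>M ?P) \<Otimes>\<^sub>M ?D \<rightarrow>\<^sub>M F 0 \<Otimes>\<^sub>M PiM {..<Suc n} (\<lambda>_. ?D)"
    by (intro measurable_Pair measurable_fun_upd[where J="{..<n}"] measurable_compose[OF measurable_fst]
        measurable_fst measurable_snd) auto
  \<comment> \<open>The functional with its last increment averaged out given everything before; the
    induction hypothesis is applied to it.\<close>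
  define h where "h p = (\<integral>\<^sup>+z. f (fst p, (snd p)(n := z)) \<partial>?g)" for p
  have f_upd: "(\<lambda>p. f (fst (fst p), (snd (fst p))(n := snd p))) \<in> borel_measurable ((F 0 \<Otimes>\<^sub>M ?P) \<Otimes>\<^sub>M ?D)"
    by (rule measurable_compose[OF upd Suc.prems(2)])
  have h: "h \<in> borel_measurable (F 0 \<Otimes>\<^sub>M ?P)"
    unfolding h_def[abs_def]
    by (intro g.borel_measurable_nn_integral) (use f_upd in \<open>simp add: case_prod_beta' cong: measurable_cong_sets\<close>)
  have past: "(\<lambda>\<omega>. (\<omega>, \<lambda>j\<in>{..<n}. X j \<omega>)) \<in> F n \<rightarrow>\<^sub>M F 0 \<Otimes>\<^sub>M ?P"
    if "\<And>j. j < n \<Longrightarrow> X j \<in> F (Suc j) \<rightarrow>\<^sub>M ?D" for X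
    by (intro measurable_Pair measurable_restrict measurable_F_mono[of 0 n] measurable_F_mono[OF _ _ that])
       (use n in auto)
  have fX: "(\<lambda>p. f (fst p, (\<lambda>j\<in>{..<n}. X j (fst p))(n := snd p))) \<in> borel_measurable (F n \<Otimes>\<^sub>M ?D)"
    if "\<And>j. j < n \<Longrightarrow> X j \<in> F (Suc j) \<rightarrow>\<^sub>M ?D" for X
    using measurable_compose[OF measurable_Pair[OF measurable_compose[OF measurable_fst past[OF that]] measurable_snd] f_upd]
    by simp
  have \<xi>: "\<And>j. j < n \<Longrightarrow> \<xi> j \<in> F (Suc j) \<rightarrow>\<^sub>M ?D" and sh: "\<And>j. j < n \<Longrightarrow> shifted j \<in> F (Suc j) \<rightarrow>\<^sub>M ?D"
    using \<xi>_adapted shifted_measurable n by auto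
  let ?e = "\<lambda>\<omega> z. exp (- (\<Sum>i<d. (2 * v n \<omega> i * z i + (v n \<omega> i)\<^sup>2) / (2 * (s n)\<^sup>2)))"
  let ?w = "\<lambda>\<omega> z. (\<lambda>j\<in>{..<n}. shifted j \<omega>)(n := \<lambda>i\<in>{..<d}. z i + v n \<omega> i)"
  have r: "(\<lambda>j\<in>{..<Suc n}. X j) = (\<lambda>j\<in>{..<n}. X j)(n := X n)" for X :: "nat \<Rightarrow> nat \<Rightarrow> real"
    by (auto simp: restrict_def)
  have "(\<integral>\<^sup>+\<omega>. f (\<omega>, \<lambda>j\<in>{..<Suc n}. \<xi> j \<omega>) \<partial>M)
      = (\<integral>\<^sup>+\<omega>. f (\<omega>, (\<lambda>j\<in>{..<n}. \<xi> j \<omega>)(n := \<xi> n \<omega>)) \<partial>M)"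
    unfolding r ..
  also have "\<dots> = (\<integral>\<^sup>+\<omega>. h (\<omega>, \<lambda>j\<in>{..<n}. \<xi> j \<omega>) \<partial>M)"
    using nn_integral_\<xi>[OF n(2,2) _ n(1,1) fX[OF \<xi>]] n by (simp add: h_def \<xi>_distr)
  also have "\<dots> = (\<integral>\<^sup>+\<omega>. h (\<omega>, \<lambda>j\<in>{..<n}. shifted j \<omega>) * ennreal (R n \<omega>) \<partial>M)"
    by (rule Suc.IH[OF n(2) h])
  \<comment> \<open>With \<open>\<omega>\<close> fixed, \<open>v n\<close> is a constant vector and
    Gaussian translation applies.\<close>
  also have "\<dots> = (\<integral>\<^sup>+\<omega>. (\<integral>\<^sup>+z. f (\<omega>, ?w \<omega> z) * ennreal (?e \<omega> z) * ennreal (R n \<omega>) \<partial>?g) \<partial>M)"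
  proof (rule nn_integral_cong)
    fix \<omega> assume "\<omega> \<in> space M"
    then have \<omega>: "\<omega> \<in> space (F n)" using space_F n by simp
    have m [measurable]: "(\<lambda>z. f (\<omega>, (\<lambda>j\<in>{..<n}. shifted j \<omega>)(n := z))) \<in> borel_measurable ?D"
      using measurable_compose[OF measurable_Pair1'[OF \<omega>] fX[OF sh]] by simp
    have [measurable]: "(\<lambda>z. f (\<omega>, ?w \<omega> z)) \<in> borel_measurable ?D"
      by (rule measurable_compose[OF _ m]) (intro measurable_restrict, measurable)
    have mm: "(\<lambda>z. f (\<omega>, ?w \<omega> z) * ennreal (?e \<omega> z)) \<in> borel_measurable ?g" by measurable
    show "h (\<omega>, \<lambda>j\<in>{..<n}. shifted j \<omega>) * ennreal (R n \<omega>)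
        = (\<integral>\<^sup>+z. f (\<omega>, ?w \<omega> z) * ennreal (?e \<omega> z) * ennreal (R n \<omega>) \<partial>?g)"
      unfolding h_def fst_conv snd_conv
      by (subst nn_integral_PiM_gauss_shift[OF s_pos[OF n(1)] finite_lessThan m, where v="v n \<omega>"],
          subst nn_integral_multc[OF mm]) (rule refl)
  qed
  \<comment> \<open>Freezing read backwards: the averaged variable becomes the actual increment
    \<open>\<xi> n\<close> again, now accompanied by the last factor of \<open>R\<close>.\<close>
  also have "\<dots> = (\<integral>\<^sup>+\<omega>. f (\<omega>, ?w \<omega> (\<xi> n \<omega>)) * ennreal (?e \<omega> (\<xi> n \<omega>)) * ennreal (R n \<omega>) \<partial>M)"
  proof -
    have vm [measurable]: "(\<lambda>p. v n (fst p) i) \<in> borel_measurable (F n \<Otimes>\<^sub>M ?D)" if "i < d" for i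
      by (rule measurable_compose[OF measurable_fst v_adapted[OF n(1) that]])
    have zm [measurable]: "i < d \<Longrightarrow> (\<lambda>p. snd p i) \<in> borel_measurable (F n \<Otimes>\<^sub>M ?D)" for i
      by simp
    have "(\<lambda>p. (fst p, \<lambda>i\<in>{..<d}. snd p i + v n (fst p) i)) \<in> F n \<Otimes>\<^sub>M ?D \<rightarrow>\<^sub>M F n \<Otimes>\<^sub>M ?D"
      by (intro measurable_Pair measurable_restrict borel_measurable_add vm zm) auto
    from measurable_compose[OF this fX[OF sh]]
    have "(\<lambda>p. f (fst p, ?w (fst p) (snd p))) \<in> borel_measurable (F n \<Otimes>\<^sub>M ?D)" by simp
    moreover have "(\<lambda>p. ?e (fst p) (snd p)) \<in> borel_measurable (F n \<Otimes>\<^sub>M ?D)"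
      by (intro measurable_compose[OF _ borel_measurable_exp] borel_measurable_uminus borel_measurable_sum borel_measurable_divide
          borel_measurable_add borel_measurable_times borel_measurable_power borel_measurable_const vm zm) auto
    moreover have "(\<lambda>p. R n (fst p)) \<in> borel_measurable (F n \<Otimes>\<^sub>M ?D)"
      by (rule measurable_compose[OF measurable_fst R_measurable[OF n(2)]])
    ultimately have "(\<lambda>p. f (fst p, ?w (fst p) (snd p)) * ennreal (?e (fst p) (snd p)) * ennreal (R n (fst p)))
        \<in> borel_measurable (F n \<Otimes>\<^sub>M ?D)" by measurable
    from nn_integral_\<xi>[OF n(2,2) _ n(1,1) this] show ?thesis
      using n by (simp add: \<xi>_distr)
  qed
  also have "\<dots> = (\<integral>\<^sup>+\<omega>. f (\<omega>, \<lambda>j\<in>{..<Suc n}. shifted j \<omega>) * ennreal (R (Suc n) \<omega>) \<partial>M)"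
    unfolding r[of "\<lambda>j. shifted j _"] R_Suc by (intro nn_integral_cong) (simp add: shifted_def[of n] ennreal_mult' R_def mult_ac)
  finally show ?case .
qed

lemma \<xi>_integrable: "j < N \<Longrightarrow> i < d \<Longrightarrow> integrable M (\<lambda>\<omega>. \<xi> j \<omega> i)"
  and \<xi>_expectation: "j < N \<Longrightarrow> i < d \<Longrightarrow> expectation (\<lambda>\<omega>. \<xi> j \<omega> i) = 0"
  using gauss_component_moments(1,2)[OF measurable_F_M[OF Suc_leI \<xi>_adapted] \<xi>_distr s_pos] by auto

text \<open>Only the means of \<open>R\<close> and of its logarithm enter. Second moments of the
  shift make the logarithm integrable, and its terms linear in the noise have mean zero because the
  shift precedes the increment.\<close>

theorem shifted_noise_distance:
  assumes v2: "\<And>j i. j < N \<Longrightarrow> i < d \<Longrightarrow> integrable M (\<lambda>\<omega>. (v j \<omega> i)\<^sup>2)"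
    and f: "f \<in> borel_measurable (F 0 \<Otimes>\<^sub>M PiM {..<N} (\<lambda>_. PiM {..<d} (\<lambda>_. borel)))"
    and f01: "\<And>p. 0 \<le> f p" "\<And>p. f p \<le> (1::real)"
  shows "\<bar>expectation (\<lambda>\<omega>. f (\<omega>, \<lambda>j\<in>{..<N}. \<xi> j \<omega>)) - expectation (\<lambda>\<omega>. f (\<omega>, \<lambda>j\<in>{..<N}. shifted j \<omega>))\<bar>
    \<le> 2 * sqrt (\<Sum>j<N. (\<Sum>i<d. expectation (\<lambda>\<omega>. (v j \<omega> i)\<^sup>2)) / (2 * (s j)\<^sup>2))"
proof -
  let ?fx = "\<lambda>\<omega>. f (\<omega>, \<lambda>j\<in>{..<N}. \<xi> j \<omega>)"
  let ?fs = "\<lambda>\<omega>. f (\<omega>, \<lambda>j\<in>{..<N}. shifted j \<omega>)"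
  \<comment> \<open>Minus the logarithm of \<open>R N\<close>; its mean \<open>KL\<close> is the
    relative entropy of the original measure with respect to the one with density
    \<open>R N\<close>.\<close>
  define l where "l \<omega> = (\<Sum>j<N. \<Sum>i<d. (2 * (v j \<omega> i * \<xi> j \<omega> i) + (v j \<omega> i)\<^sup>2) / (2 * (s j)\<^sup>2))" for \<omega>
  define KL where "KL = (\<Sum>j<N. (\<Sum>i<d. expectation (\<lambda>\<omega>. (v j \<omega> i)\<^sup>2)) / (2 * (s j)\<^sup>2))"
  have Rl: "R N \<omega> = exp (- l \<omega>)" for \<omega> by (simp add: R_def l_def mult.assoc)
  have vm: "(\<lambda>\<omega>. v j \<omega> i) \<in> borel_measurable M" if "j < N" "i < d" for j i
    using measurable_F_M[OF _ v_adapted[OF that]] that by simp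
  have v\<xi>: "integrable M (\<lambda>\<omega>. v j \<omega> i * \<xi> j \<omega> i)" "expectation (\<lambda>\<omega>. v j \<omega> i * \<xi> j \<omega> i) = 0"
    if j: "j < N" and i: "i < d" for j i
  proof -
    have "integrable M (\<lambda>\<omega>. v j \<omega> i)"
      by (rule square_integrable_imp_integrable[OF vm[OF that] v2[OF that]])
    note * = space_F[of j] sets_F[of j] measurable_F_M[OF _ \<xi>_adapted[OF j]] \<xi>_indep[OF j] v_adapted[OF that] this
      measurable_component_singleton[of i "{..<d}" "\<lambda>_. borel"]
    show "integrable M (\<lambda>\<omega>. v j \<omega> i * \<xi> j \<omega> i)"
      using integrable_mult_indep_set[of "F j" "\<xi> j" _ "\<lambda>\<omega>. v j \<omega> i" "\<lambda>z. z i"] * \<xi>_integrable[OF that] i j by simp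
    show "expectation (\<lambda>\<omega>. v j \<omega> i * \<xi> j \<omega> i) = 0"
      using expectation_mult_indep_set[of "F j" "\<xi> j" _ "\<lambda>\<omega>. v j \<omega> i" "\<lambda>z. z i"] * \<xi>_integrable[OF that]
        \<xi>_expectation[OF that] i j by simp
  qed
  have int: "integrable M (\<lambda>\<omega>. (2 * (v j \<omega> i * \<xi> j \<omega> i) + (v j \<omega> i)\<^sup>2) / (2 * (s j)\<^sup>2))"
    if "j < N" "i < d" for j i
    using v\<xi>[OF that] v2[OF that]
    by (intro Bochner_Integration.integrable_divide Bochner_Integration.integrable_add integrable_mult_right)
  have l1: "integrable M l"
    unfolding l_def[abs_def] by (intro Bochner_Integration.integrable_sum int) auto
  have "expectation l = (\<Sum>j<N. \<Sum>i<d. expectation (\<lambda>\<omega>. (2 * (v j \<omega> i * \<xi> j \<omega> i) + (v j \<omega> i)\<^sup>2) / (2 * (s j)\<^sup>2)))"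
    unfolding l_def[abs_def]
    by (rule trans[OF Bochner_Integration.integral_sum])
       (intro Bochner_Integration.integrable_sum int sum.cong[OF refl] Bochner_Integration.integral_sum; simp)+
  also have "\<dots> = KL"
    unfolding KL_def sum_divide_distrib
  proof (intro sum.cong refl)
    fix j i assume "j \<in> {..<N}" "i \<in> {..<d}"
    then have ji: "j < N" "i < d" by auto
    show "expectation (\<lambda>\<omega>. (2 * (v j \<omega> i * \<xi> j \<omega> i) + (v j \<omega> i)\<^sup>2) / (2 * (s j)\<^sup>2))
        = expectation (\<lambda>\<omega>. (v j \<omega> i)\<^sup>2) / (2 * (s j)\<^sup>2)"
      using v\<xi>[OF ji] v2[OF ji] by simp
  qed
  finally have l: "integrable M l" "expectation l = KL" using l1 by auto
  have KL0: "0 \<le> KL" unfolding KL_def by (intro sum_nonneg divide_nonneg_nonneg Bochner_Integration.integral_nonneg) auto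
  have Rm [measurable]: "R N \<in> borel_measurable M" by (rule measurable_F_M[OF _ R_measurable]) auto
  \<comment> \<open>The change of variables applied to the constant 1 shows that the density has
    mean one, whatever the size of the shift.\<close>
  have nnR: "(\<integral>\<^sup>+\<omega>. ennreal (R N \<omega>) \<partial>M) = 1"
    using nn_integral_shifted_noise[of N "\<lambda>_. 1"] by (simp add: emeasure_space_1)
  have R0: "0 \<le> R N \<omega>" for \<omega> by (simp add: R_def)
  have Rint: "integrable M (R N)" "expectation (R N) = 1"
    using nnR R0 by (auto intro!: integrableI_nonneg simp: integral_eq_nn_integral)
  have m1 [measurable]: "(\<lambda>\<omega>. f (\<omega>, \<lambda>j\<in>{..<N}. X j \<omega>)) \<in> borel_measurable M"
    if X: "\<And>j. j < N \<Longrightarrow> X j \<in> F (Suc j) \<rightarrow>\<^sub>M PiM {..<d} (\<lambda>_. borel)" for X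
    by (rule measurable_compose[OF _ f])
       (intro measurable_Pair measurable_restrict measurable_F_M[OF _ X] measurable_F_M[of 0], auto)
  note mX = m1[OF \<xi>_adapted] and mS = m1[OF shifted_measurable]
  have "expectation (\<lambda>\<omega>. ?fx \<omega>) = enn2real (\<integral>\<^sup>+\<omega>. ennreal (?fx \<omega>) \<partial>M)"
    by (rule integral_eq_nn_integral[OF mX]) (use f01 in auto)
  also have "\<dots> = enn2real (\<integral>\<^sup>+\<omega>. ennreal (?fs \<omega> * R N \<omega>) \<partial>M)"
    using nn_integral_shifted_noise[of N "\<lambda>p. ennreal (f p)"] f f01 by (simp add: ennreal_mult')
  also have "\<dots> = expectation (\<lambda>\<omega>. ?fs \<omega> * R N \<omega>)"
    by (rule integral_eq_nn_integral[symmetric]) (use f01 R0 mS in auto)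
  finally have e: "expectation (\<lambda>\<omega>. ?fx \<omega>) = expectation (\<lambda>\<omega>. ?fs \<omega> * R N \<omega>)" .
  have i1: "integrable M (\<lambda>\<omega>. ?fs \<omega>)"
    by (rule integrable_const_bound[where B=1, OF _ mS]) (use f01 in auto)
  have i2: "integrable M (\<lambda>\<omega>. ?fs \<omega> * R N \<omega>)"
    by (rule Bochner_Integration.integrable_bound[OF Rint(1)]) (use f01 R0 mS in \<open>auto simp: abs_mult intro!: AE_I2 mult_left_le_one_le\<close>)
  have "\<bar>expectation (\<lambda>\<omega>. ?fx \<omega>) - expectation (\<lambda>\<omega>. ?fs \<omega>)\<bar>
      \<le> expectation (\<lambda>\<omega>. \<bar>R N \<omega> - 1\<bar>)"
  proof -
    have "\<bar>expectation (\<lambda>\<omega>. ?fs \<omega> * R N \<omega> - ?fs \<omega>)\<bar>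
        \<le> expectation (\<lambda>\<omega>. \<bar>?fs \<omega> * R N \<omega> - ?fs \<omega>\<bar>)"
      by (rule integral_abs_bound)
    also have "\<dots> \<le> expectation (\<lambda>\<omega>. \<bar>R N \<omega> - 1\<bar>)"
    proof (rule integral_mono)
      fix \<omega>
      have "?fs \<omega> * R N \<omega> - ?fs \<omega>
          = ?fs \<omega> * (R N \<omega> - 1)" by (simp add: algebra_simps)
      then show "\<bar>?fs \<omega> * R N \<omega> - ?fs \<omega>\<bar> \<le> \<bar>R N \<omega> - 1\<bar>"
        using f01 by (simp add: abs_mult mult_left_le_one_le)
    qed (use i1 i2 Rint in auto)
    finally show ?thesis using e i1 i2 by simp
  qed
  also have "\<dots> \<le> 2 * sqrt KL"
  proof -
    have b: "expectation (\<lambda>\<omega>. \<bar>R N \<omega> - 1\<bar>) \<le> KL / (2 * a) + 2 * a" if a: "0 < a" for a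
    proof -
      have "expectation (\<lambda>\<omega>. \<bar>R N \<omega> - 1\<bar>) \<le> expectation (\<lambda>\<omega>. (R N \<omega> - 1 + l \<omega>) / (2 * a) + a * (R N \<omega> + 1))"
      proof (rule integral_mono)
        show "\<bar>R N \<omega> - 1\<bar> \<le> (R N \<omega> - 1 + l \<omega>) / (2 * a) + a * (R N \<omega> + 1)" for \<omega>
          using abs_minus_one_le_exp[OF a, of "- l \<omega>"] by (simp add: Rl)
      qed (use Rint l in auto)
      also have "\<dots> = KL / (2 * a) + 2 * a" using Rint l by (simp add: prob_space)
      finally show ?thesis .
    qed
    \<comment> \<open>KL / (2 a) + 2 a is least at a = sqrt KL / 2, where it equals 2 sqrt KL. For
      \<open>KL = 0\<close> this choice is not positive, so a tends to 0 instead.\<close>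
    show ?thesis
    proof (cases "KL = 0")
      case True
      have "expectation (\<lambda>\<omega>. \<bar>R N \<omega> - 1\<bar>) \<le> 0 + e" if "0 < e" for e
        using b[of "e / 2"] that True by simp
      then have "expectation (\<lambda>\<omega>. \<bar>R N \<omega> - 1\<bar>) \<le> 0" by (rule field_le_epsilon)
      then show ?thesis using True by simp
    next
      case False
      then have "0 < sqrt KL" using KL0 by simp
      with b[of "sqrt KL / 2"] show ?thesis using KL0 by (simp add: real_div_sqrt)
    qed
  qed
  finally show ?thesis unfolding KL_def .
qed

end

section \<open>Borel measures on path space\<close>

lemma space_borel_of [simp]: "space (borel_of T) = topspace T"
  and sets_borel_of: "sets (borel_of T) = sigma_sets (topspace T) {S. openin T S}"
  unfolding borel_of_def by (auto intro!: space_measure_of sets_measure_of dest: openin_subset)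

lemma openin_in_sets_borel_of: "openin T S \<Longrightarrow> S \<in> sets (borel_of T)"
  by (simp add: sets_borel_of sigma_sets.Basic)

lemma closedin_in_sets_borel_of:
  assumes "closedin T S" shows "S \<in> sets (borel_of T)"
proof -
  have "space (borel_of T) - (topspace T - S) \<in> sets (borel_of T)"
    using assms by (intro sets.compl_sets openin_in_sets_borel_of) auto
  moreover have "topspace T - (topspace T - S) = S" using closedin_subset[OF assms] by auto
  ultimately show ?thesis by simp
qed

lemma borel_measurable_continuous_map:
  fixes f :: "'a \<Rightarrow> 'b::topological_space"
  assumes "continuous_map T euclidean f"
  shows "f \<in> borel_measurable (borel_of T)"
proof (rule borel_measurableI)
  fix S :: "'b set" assume "open S"
  then have "openin T {x \<in> topspace T. f x \<in> S}"
    using assms by (intro openin_continuous_map_preimage) auto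
  moreover have "{x \<in> topspace T. f x \<in> S} = f -` S \<inter> space (borel_of T)" by auto
  ultimately show "f -` S \<inter> space (borel_of T) \<in> sets (borel_of T)"
    using openin_in_sets_borel_of by metis
qed

section \<open>Regularity of finite Borel measures on metric spaces\<close>

context Metric_space
begin

lemma Lipschitz_continuous_map:
  fixes f :: "'a \<Rightarrow> real"
  assumes "\<And>x y. x \<in> M \<Longrightarrow> y \<in> M \<Longrightarrow> \<bar>f x - f y\<bar> \<le> c * d x y"
  shows "continuous_map mtopology euclideanreal f"
  unfolding mtopology_is_euclidean[symmetric] metric_continuous_map[OF Met_TC.Metric_space_axioms]
proof (intro conjI ballI allI impI)
  fix a \<epsilon> assume a: "a \<in> M" and \<epsilon>: "(0::real) < \<epsilon>"
  show "\<exists>\<delta>>0. \<forall>x. x \<in> M \<and> d a x < \<delta> \<longrightarrow> dist (f a) (f x) < \<epsilon>"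
  proof (intro exI[of _ "\<epsilon> / (\<bar>c\<bar> + 1)"] conjI allI impI)
    fix x assume x: "x \<in> M \<and> d a x < \<epsilon> / (\<bar>c\<bar> + 1)"
    have "dist (f a) (f x) \<le> c * d a x" using assms[OF a] x by (simp add: dist_real_def)
    also have "\<dots> \<le> (\<bar>c\<bar> + 1) * d a x" by (intro mult_right_mono) auto
    also have "\<dots> < \<epsilon>" using x by (simp add: field_simps)
    finally show "dist (f a) (f x) < \<epsilon>" .
  qed (use \<epsilon> in auto)
qed auto

definition set_dist :: "'a set \<Rightarrow> 'a \<Rightarrow> real" where
  "set_dist F x = (INF y\<in>F. d x y)"

lemma
  assumes F: "F \<subseteq> M" "F \<noteq> {}"
  shows set_dist_nonneg: "0 \<le> set_dist F x"
    and set_dist_Lipschitz: "x \<in> M \<Longrightarrow> z \<in> M \<Longrightarrow> \<bar>set_dist F x - set_dist F z\<bar> \<le> d x z"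
    and set_dist_eq_0: "x \<in> F \<Longrightarrow> set_dist F x = 0"
    and set_dist_pos: "closedin mtopology F \<Longrightarrow> x \<in> M \<Longrightarrow> x \<notin> F \<Longrightarrow> 0 < set_dist F x"
proof -
  have bdd: "bdd_below (d x ` F)" for x by (rule bdd_belowI2[where m=0]) simp
  show nn: "0 \<le> set_dist F x" for x unfolding set_dist_def by (rule cINF_greatest) (use F in auto)
  have le: "set_dist F x \<le> d x y" if "y \<in> F" for x y unfolding set_dist_def by (rule cINF_lower[OF bdd that])
  have *: "set_dist F x \<le> set_dist F z + d x z" if "x \<in> M" "z \<in> M" for x z
  proof -
    have "set_dist F x - d x z \<le> set_dist F z"
      unfolding set_dist_def[of F z]
    proof (rule cINF_greatest)
      fix y assume y: "y \<in> F"
      then show "set_dist F x - d x z \<le> d z y" using le[OF y, of x] triangle[of x z y] F that by auto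
    qed (use F in auto)
    then show ?thesis by simp
  qed
  show "\<bar>set_dist F x - set_dist F z\<bar> \<le> d x z" if "x \<in> M" "z \<in> M"
    using *[OF that] *[OF that(2,1)] commute[of x z] by auto
  show "set_dist F x = 0" if "x \<in> F" using le[OF that, of x] nn[of x] F that by auto
  assume cl: "closedin mtopology F" and x: "x \<in> M" "x \<notin> F"
  then have "openin mtopology (M - F)" by (metis openin_diff openin_topspace topspace_mtopology)
  then obtain r where r: "0 < r" "mball x r \<subseteq> M - F" using x unfolding openin_mtopology by blast
  have "r \<le> set_dist F x" unfolding set_dist_def
  proof (rule cINF_greatest)
    fix y assume "y \<in> F"
    then have "y \<notin> mball x r" "y \<in> M" using r(2) F by auto
    then show "r \<le> d x y" using x by (simp add: in_mball)
  qed (use F in auto)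
  then show "0 < set_dist F x" using r(1) by simp
qed

lemma closedin_set_dist_ge:
  assumes "F \<subseteq> M" "F \<noteq> {}"
  shows "closedin mtopology {x \<in> M. c \<le> set_dist F x}"
proof -
  have "continuous_map mtopology euclideanreal (set_dist F)"
    by (rule Lipschitz_continuous_map[where c=1]) (use set_dist_Lipschitz[OF assms] in auto)
  from closedin_continuous_map_preimage[OF this, of "{c..}"] show ?thesis by simp
qed

text \<open>The sets that can be enclosed in this way form a sigma-algebra containing the open sets,
  so induction over the generation of the Borel sets applies.\<close>

lemma borel_regular:
  assumes fin: "finite_measure \<mu>" and sets: "sets \<mu> = sets (borel_of mtopology)"
    and A: "A \<in> sets \<mu>" and e: "0 < e"
  shows "\<exists>C G. closedin mtopology C \<and> openin mtopology G \<and> C \<subseteq> A \<and> A \<subseteq> G \<and> measure \<mu> (G - C) < e"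
proof -
  interpret finite_measure \<mu> by fact
  have op: "openin mtopology G \<Longrightarrow> G \<in> sets \<mu>" and cl: "closedin mtopology G \<Longrightarrow> G \<in> sets \<mu>" for G
    by (auto simp: sets openin_in_sets_borel_of closedin_in_sets_borel_of)
  have "A \<in> sigma_sets M {S. openin mtopology S}" using A by (simp add: sets sets_borel_of)
  then show ?thesis using e
  proof (induction A arbitrary: e rule: sigma_sets.induct)
    case (Basic A)
    then have oA: "openin mtopology A" by simp
    then have AM: "A \<subseteq> M" using openin_subset by fastforce
    \<comment> \<open>The whole space is itself closed; treating it apart keeps the complement
      nonempty, so that the distance to it makes sense.\<close>
    show ?case
    proof (cases "A = M")
      case True
      then show ?thesis using Basic oA by (intro exI[of _ M]) auto
    next
      case False
      define F where "F = M - A"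
      have F: "F \<subseteq> M" "F \<noteq> {}" "closedin mtopology F"
        using False AM oA by (auto simp: F_def openin_closedin_eq)
      \<comment> \<open>Points at distance at least 1/(n+1) from the complement: closed sets
        increasing to the open set \<open>A\<close>.\<close>
      define C where "C n = {x \<in> M. inverse (real (Suc n)) \<le> set_dist F x}" for n
      have cC: "closedin mtopology (C n)" for n unfolding C_def by (rule closedin_set_dist_ge[OF F(1,2)])
      have sC: "C n \<subseteq> A" for n
      proof
        fix x assume x: "x \<in> C n"
        have "0 < inverse (real (Suc n))" by simp
        moreover have "inverse (real (Suc n)) \<le> set_dist F x" "x \<in> M" using x unfolding C_def by blast+
        ultimately have "x \<in> M" "0 < set_dist F x" by (simp, linarith)
        then show "x \<in> A" using set_dist_eq_0[OF F(1,2), of x] by (cases "x \<in> A") (auto simp: F_def)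
      qed
      have inc: "decseq (\<lambda>n. A - C n)"
      proof (rule decseq_SucI)
        fix n
        have le: "inverse (real (Suc (Suc n))) \<le> inverse (real (Suc n))" by (rule le_imp_inverse_le) auto
        have "x \<in> C (Suc n)" if "x \<in> C n" for x
          using that order_trans[OF le, of "set_dist F x"] unfolding C_def mem_Collect_eq by blast
        then show "A - C (Suc n) \<subseteq> A - C n" by blast
      qed
      have E: "(\<Inter>n. A - C n) = {}"
      proof -
        have "\<exists>n. x \<in> C n" if "x \<in> A" for x
        proof -
          have "0 < set_dist F x" using set_dist_pos[OF F(1,2,3)] that AM by (auto simp: F_def)
          then obtain n where "inverse (real (Suc n)) < set_dist F x" using reals_Archimedean by blast
          then show ?thesis using that AM by (auto simp: C_def intro!: exI[of _ n])
        qed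
        then show ?thesis by blast
      qed
      have "(\<lambda>n. measure \<mu> (A - C n)) \<longlonglongrightarrow> measure \<mu> (\<Inter>n. A - C n)"
        using op[OF oA] cl[OF cC] by (intro finite_Lim_measure_decseq inc) auto
      then have "(\<lambda>n. measure \<mu> (A - C n)) \<longlonglongrightarrow> 0" unfolding E by simp
      then have "\<forall>\<^sub>F n in sequentially. measure \<mu> (A - C n) < e" by (rule order_tendstoD) fact
      then obtain n where "measure \<mu> (A - C n) < e" by (auto simp: eventually_sequentially)
      then show ?thesis using cC sC oA by (intro exI[of _ "C n"] exI[of _ A]) auto
    qed
  next
    case Empty
    then show ?case by (intro exI[of _ "{}"] conjI) simp_all
  next
    case (Compl A)
    then obtain C G where CG: "closedin mtopology C" "openin mtopology G" "C \<subseteq> A" "A \<subseteq> G" "measure \<mu> (G - C) < e"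
      using Compl.IH[OF Compl.prems] by metis
    have sub: "C \<subseteq> M" "G \<subseteq> M" using closedin_subset[OF CG(1)] openin_subset[OF CG(2)] by auto
    have "(M - C) - (M - G) = G - C" using sub by auto
    moreover have "closedin mtopology (M - G)" "openin mtopology (M - C)"
      using CG(1,2) by (metis closedin_diff closedin_topspace topspace_mtopology, metis openin_diff openin_topspace topspace_mtopology)
    ultimately show ?case using CG sub by (intro exI[of _ "M - G"] exI[of _ "M - C"] conjI) auto
  next
    case (Union A)
    \<comment> \<open>Half of the error is spread over the sets as a geometric series; the other
      half pays for cutting the union of the \<open>C n\<close>, which need not be closed, down to a
      finite one.\<close>
    have "\<exists>C G. closedin mtopology C \<and> openin mtopology G \<and> C \<subseteq> A n \<and> A n \<subseteq> G \<and> measure \<mu> (G - C) < e / 2 * (1 / 2) ^ Suc n" for n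
      by (rule Union.IH) (use Union.prems in auto)
    then obtain C G where CG: "\<And>n. closedin mtopology (C n)" "\<And>n. openin mtopology (G n)" "\<And>n. C n \<subseteq> A n" "\<And>n. A n \<subseteq> G n"
      "\<And>n. measure \<mu> (G n - C n) < e / 2 * (1 / 2) ^ Suc n" by metis
    have mC: "C n \<in> sets \<mu>" and mG: "G n \<in> sets \<mu>" for n using CG op cl by auto
    have su: "summable (\<lambda>n. e / 2 * (1 / 2) ^ Suc n)" "(\<Sum>n. e / 2 * (1 / 2) ^ Suc n) = e / 2"
      using sums_mult[OF power_half_series, of "e / 2"] by (auto simp: sums_iff)
    have s1: "summable (\<lambda>n. measure \<mu> (G n - C n))"
      by (rule summable_comparison_test'[OF su(1)]) (use CG(5) less_imp_le in auto)
    have "measure \<mu> (\<Union>n. G n - C n) \<le> (\<Sum>n. measure \<mu> (G n - C n))"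
    proof (rule finite_measure_subadditive_countably[OF _ s1])
      show "range (\<lambda>n. G n - C n) \<subseteq> sets \<mu>" using mC mG by blast
    qed
    also have "\<dots> \<le> (\<Sum>n. e / 2 * (1 / 2) ^ Suc n)" by (intro suminf_le s1 su less_imp_le CG)
    also have "\<dots> = e / 2" by (rule su)
    finally have 1: "measure \<mu> (\<Union>n. G n - C n) \<le> e / 2" .
    define D where "D k = (\<Union>n<k. C n)" for k
    have cD: "closedin mtopology (D k)" for k unfolding D_def by (intro closedin_Union) (use CG in auto)
    have "(\<lambda>k. measure \<mu> ((\<Union>n. C n) - D k)) \<longlonglongrightarrow> measure \<mu> (\<Inter>k. (\<Union>n. C n) - D k)"
      by (intro finite_Lim_measure_decseq decseq_SucI) (use mC in \<open>auto simp: D_def\<close>)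
    also have E: "(\<Inter>k. (\<Union>n. C n) - D k) = {}" by (auto simp: D_def)
    finally have "(\<lambda>k. measure \<mu> ((\<Union>n. C n) - D k)) \<longlonglongrightarrow> 0" by simp
    then have "\<forall>\<^sub>F k in sequentially. measure \<mu> ((\<Union>n. C n) - D k) < e / 2"
      by (rule order_tendstoD) (use Union.prems in auto)
    then obtain k where k: "measure \<mu> ((\<Union>n. C n) - D k) < e / 2" by (auto simp: eventually_sequentially)
    have "measure \<mu> ((\<Union>n. G n) - D k) \<le> measure \<mu> ((\<Union>n. G n - C n) \<union> ((\<Union>n. C n) - D k))"
      by (rule finite_measure_mono) (use mC mG cl[OF cD] in auto)
    also have "\<dots> \<le> measure \<mu> (\<Union>n. G n - C n) + measure \<mu> ((\<Union>n. C n) - D k)"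
      by (rule measure_Un_le) (use mC mG cl[OF cD] in auto)
    also have "\<dots> < e" using 1 k by simp
    finally have "measure \<mu> ((\<Union>n. G n) - D k) < e" .
    moreover have "openin mtopology (\<Union>n. G n)" using CG(2) by (intro openin_Union) auto
    moreover have "D k \<subseteq> (\<Union>n. A n)" "(\<Union>n. A n) \<subseteq> (\<Union>n. G n)" using CG(3,4) unfolding D_def by blast+
    ultimately show ?case using cD by (intro exI[of _ "D k"] exI[of _ "\<Union>n. G n"]) auto
  qed
qed

text \<open>The bound passes to closed sets through the Lipschitz functions max 0 (1 - n dist),
  which decrease to the indicator, and to Borel sets by inner regularity of \<mu> alone: a closed C
  inside A loses little \<mu>-mass, and monotonicity bounds the \<nu>-mass of C by that of
  A.\<close>

theorem measure_diff_le_of_Lipschitz: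
  assumes \<mu>: "prob_space \<mu>" "sets \<mu> = sets (borel_of mtopology)"
    and \<nu>: "prob_space \<nu>" "sets \<nu> = sets (borel_of mtopology)"
    and *: "\<And>f K. (\<And>x. 0 \<le> f x \<and> f x \<le> 1) \<Longrightarrow> 0 \<le> K \<Longrightarrow> (\<And>x y. x \<in> M \<Longrightarrow> y \<in> M \<Longrightarrow> \<bar>f x - f y\<bar> \<le> K * d x y) \<Longrightarrow>
        (\<integral>x. f x \<partial>\<mu>) - (\<integral>x. f x \<partial>\<nu>) \<le> c"
    and c: "0 \<le> c" and A: "A \<in> sets \<mu>"
  shows "measure \<mu> A - measure \<nu> A \<le> c"
proof -
  interpret \<mu>: prob_space \<mu> by fact
  interpret \<nu>: prob_space \<nu> by fact
  have clm: "F \<in> sets \<mu>" "F \<in> sets \<nu>" if "closedin mtopology F" for F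
    using that by (simp_all add: \<mu> \<nu> closedin_in_sets_borel_of)
  have closed: "measure \<mu> F - measure \<nu> F \<le> c" if F: "closedin mtopology F" for F
  proof (cases "F = {}")
    case True then show ?thesis using c by simp
  next
    case False
    have FM: "F \<subseteq> M" using closedin_subset[OF F] by simp
    note sd = set_dist_nonneg[OF FM False] set_dist_Lipschitz[OF FM False] set_dist_eq_0[OF FM False] set_dist_pos[OF FM False F]
    define f where "f n x = max 0 (1 - real n * set_dist F x)" for n x
    have lip: "\<bar>f n x - f n y\<bar> \<le> real n * d x y" if "x \<in> M" "y \<in> M" for n x y
    proof -
      have "\<bar>f n x - f n y\<bar> \<le> \<bar>real n * set_dist F x - real n * set_dist F y\<bar>" by (auto simp: f_def)
      also have "\<dots> = real n * \<bar>set_dist F x - set_dist F y\<bar>" by (simp add: abs_mult flip: right_diff_distrib)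
      also have "\<dots> \<le> real n * d x y" using sd(2)[OF that] by (rule mult_left_mono) simp
      finally show ?thesis .
    qed
    have bd: "0 \<le> f n x \<and> f n x \<le> 1" for n x using sd(1)[of x] by (auto simp: f_def)
    have fm: "f n \<in> borel_measurable (borel_of mtopology)" for n
      by (rule borel_measurable_continuous_map[OF Lipschitz_continuous_map[OF lip]])
    have lim: "(\<lambda>n. f n x) \<longlonglongrightarrow> indicator F x" if x: "x \<in> M" for x
    proof (cases "x \<in> F")
      case True then show ?thesis by (simp add: f_def sd)
    next
      case False
      with sd(4)[OF x] have p: "0 < set_dist F x" by simp
      have "\<forall>\<^sub>F n in sequentially. f n x = 0"
      proof -
        obtain N where "1 / set_dist F x < real N" using reals_Archimedean2 by blast
        then have "1 \<le> real N * set_dist F x" using p by (simp add: field_simps)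
        then have "1 \<le> real n * set_dist F x" if "N \<le> n" for n
        proof -
          have "real N * set_dist F x \<le> real n * set_dist F x" using that p by (intro mult_right_mono) auto
          with \<open>1 \<le> real N * set_dist F x\<close> show ?thesis by linarith
        qed
        then show ?thesis by (auto simp: f_def eventually_sequentially intro!: exI[of _ N])
      qed
      then show ?thesis using False by (simp add: tendsto_eventually)
    qed
    have int: "(\<lambda>n. \<integral>x. f n x \<partial>m) \<longlonglongrightarrow> measure m F" if m: "prob_space m" "sets m = sets (borel_of mtopology)" for m
    proof -
      interpret m: prob_space m by fact
      have sp: "space m = M" using sets_eq_imp_space_eq[OF m(2)] by simp
      have Fm: "F \<in> sets m" using F by (simp add: m closedin_in_sets_borel_of)
      have "(\<lambda>n. \<integral>x. f n x \<partial>m) \<longlonglongrightarrow> (\<integral>x. indicator F x \<partial>m)"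
        by (rule integral_dominated_convergence[where w="\<lambda>_. 1"])
           (use Fm bd lim fm[unfolded measurable_cong_sets[OF m(2)[symmetric] refl]] in \<open>auto simp: sp\<close>)
      then show ?thesis using Fm by simp
    qed
    have "(\<lambda>n. (\<integral>x. f n x \<partial>\<mu>) - (\<integral>x. f n x \<partial>\<nu>)) \<longlonglongrightarrow> measure \<mu> F - measure \<nu> F"
      by (intro tendsto_diff int \<mu> \<nu>)
    moreover have "(\<integral>x. f n x \<partial>\<mu>) - (\<integral>x. f n x \<partial>\<nu>) \<le> c" for n
      by (rule *[of _ "real n"]) (use bd lip in auto)
    ultimately show ?thesis by (intro LIMSEQ_le_const2) auto
  qed
  show ?thesis
  proof (rule field_le_epsilon)
    fix e :: real assume e: "0 < e"
    from borel_regular[OF \<mu>.finite_measure_axioms \<mu>(2) A e] obtain C G where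
      C: "closedin mtopology C" "C \<subseteq> A" and G: "openin mtopology G" "A \<subseteq> G" "measure \<mu> (G - C) < e" by blast
    have AN: "A \<in> sets \<nu>" using A \<mu> \<nu> by simp
    have "measure \<mu> A = measure \<mu> C + measure \<mu> (A - C)"
      using \<mu>.finite_measure_Diff[OF A clm(1)[OF C(1)] C(2)] by simp
    moreover have "measure \<mu> (A - C) \<le> measure \<mu> (G - C)"
      using G A C clm by (intro \<mu>.finite_measure_mono) (auto simp: \<mu> openin_in_sets_borel_of)
    moreover have "measure \<nu> C \<le> measure \<nu> A" using AN C by (intro \<nu>.finite_measure_mono) auto
    ultimately show "measure \<mu> A - measure \<nu> A \<le> c + e" using closed[OF C(1)] G(3) by linarith
  qed
qed

end

section \<open>Path space and Bernstein polynomials\<close>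

abbreviation path_metric :: "nat \<Rightarrow> (real \<Rightarrow> nat \<Rightarrow> real) metric" where
  "path_metric d \<equiv> cfunspace (top_of_set {0..1}) (Rd_metric d)"

text \<open>Boundedness is automatic on the compact unit interval, and continuity is coordinatewise
  because the coordinates from \<open>d\<close> on are constantly zero.\<close>

lemma mem_path_metric:
  "x \<in> mspace (path_metric d) \<longleftrightarrow>
    (\<forall>t\<in>{0..1}. x t \<in> Rd d) \<and> x \<in> extensional {0..1} \<and> (\<forall>i<d. continuous_on {0..1} (\<lambda>t. x t i))"
proof -
  have 1: "compactin (top_of_set {0..1}) (topspace (top_of_set {0..1::real}))"
    by (simp add: compactin_subtopology)
  have 2: "continuous_map (top_of_set {0..1}) (Euclidean_space d) x
      \<longleftrightarrow> continuous_on {0..1} x \<and> (\<forall>t\<in>{0..1}. x t \<in> Rd d)"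
    by (subst Euclidean_space_top_of_set) (auto simp: continuous_map_in_subtopology)
  have 3: "continuous_on {0..1} x \<longleftrightarrow> (\<forall>i<d. continuous_on {0..1} (\<lambda>t. x t i))"
    if "\<forall>t\<in>{0..1}. x t \<in> Rd d"
  proof
    assume c: "\<forall>i<d. continuous_on {0..1} (\<lambda>t. x t i)"
    show "continuous_on {0..1} x"
    proof (rule continuous_on_coordinatewise_then_product)
      fix i
      show "continuous_on {0..1} (\<lambda>t. x t i)"
      proof (cases "i < d")
        case False
        then have "continuous_on {0..1} (\<lambda>t. x t i) = continuous_on {0..1::real} (\<lambda>t. 0::real)"
          using that by (intro continuous_on_cong) (auto simp: Rd_iff)
        then show ?thesis by simp
      qed (use c in auto)
    qed
  qed (auto intro: continuous_on_product_then_coordinatewise)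
  show ?thesis
    unfolding compactin_mspace_cfunspace[OF 1] mtopology_of_Rd_metric mem_Collect_eq 2 topspace_euclidean_subtopology
      mspace_Rd_metric using 3 by blast
qed

lemma space_path_borel [simp]: "space (path_borel d) = mspace (path_metric d)"
  unfolding path_borel_def by simp

text \<open>Truncation at \<open>d\<close> and restriction to the unit interval make this a path for
  arbitrary values \<open>w\<close>, so that a functional of it becomes an ordinary function of
  finitely many reals.\<close>

definition bernstein_path :: "nat \<Rightarrow> nat \<Rightarrow> (nat \<Rightarrow> nat \<Rightarrow> real) \<Rightarrow> real \<Rightarrow> nat \<Rightarrow> real" where
  "bernstein_path d n w = (\<lambda>t\<in>{0..1}. \<lambda>i. if i < d then \<Sum>k\<le>n. w k i * Bernstein n k t else 0)"

lemma bernstein_path_cong: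
  "(\<And>k. k \<le> n \<Longrightarrow> w k = w' k) \<Longrightarrow> bernstein_path d n w = bernstein_path d n w'"
  unfolding bernstein_path_def by (intro restrict_ext ext) (auto intro!: sum.cong)

lemma bernstein_path_mem: "bernstein_path d n w \<in> mspace (path_metric d)"
  unfolding mem_path_metric
proof (intro conjI allI impI ballI)
  fix i assume i: "i < d"
  have "continuous_on {0..1} (\<lambda>t. \<Sum>k\<le>n. w k i * Bernstein n k t)"
    unfolding Bernstein_def by (intro continuous_intros)
  moreover have "continuous_on {0..1} (\<lambda>t. bernstein_path d n w t i)
      = continuous_on {0..1} (\<lambda>t. \<Sum>k\<le>n. w k i * Bernstein n k t)"
    using i by (intro continuous_on_cong) (auto simp: bernstein_path_def)
  ultimately show "continuous_on {0..1} (\<lambda>t. bernstein_path d n w t i)" by simp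
qed (auto simp: bernstein_path_def Rd_iff)

lemma mdist_path_le:
  assumes "\<And>t. t \<in> {0..1} \<Longrightarrow> (\<Sum>i<d. \<bar>x t i - y t i\<bar>) \<le> B"
  shows "mdist (path_metric d) x y \<le> B"
proof (rule mdist_cfunspace_le)
  show "0 \<le> B" using order_trans[OF sum_nonneg assms[of 0]] by simp
  fix t :: real assume "t \<in> topspace (top_of_set {0..1})"
  then have "t \<in> {0..1}" by simp
  from order_trans[OF enorm_le_sum assms[OF this]]
  show "mdist (Rd_metric d) (x t) (y t) \<le> B" by (simp add: edist_def)
qed

text \<open>Each Bernstein weight lies between 0 and 1 on the unit interval. This Lipschitz
  dependence on the values yields both measurability and convergence of functionals.\<close>

lemma mdist_bernstein_path_le:
  "mdist (path_metric d) (bernstein_path d n w) (bernstein_path d n w')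
    \<le> (\<Sum>i<d. \<Sum>k\<le>n. \<bar>w k i - w' k i\<bar>)"
proof (rule mdist_path_le)
  fix t :: real assume t: "t \<in> {0..1}"
  have B: "0 \<le> Bernstein n k t" "Bernstein n k t \<le> 1" if "k \<le> n" for k
  proof -
    show B: "0 \<le> Bernstein n k t" for k using t by (simp add: Bernstein_nonneg)
    have "Bernstein n k t \<le> (\<Sum>k\<le>n. Bernstein n k t)" using that B by (intro member_le_sum) auto
    then show "Bernstein n k t \<le> 1" by simp
  qed
  show "(\<Sum>i<d. \<bar>bernstein_path d n w t i - bernstein_path d n w' t i\<bar>) \<le> (\<Sum>i<d. \<Sum>k\<le>n. \<bar>w k i - w' k i\<bar>)"
  proof (rule sum_mono)
    fix i assume "i \<in> {..<d}"
    then have "bernstein_path d n w t i - bernstein_path d n w' t i = (\<Sum>k\<le>n. (w k i - w' k i) * Bernstein n k t)"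
      using t by (simp add: bernstein_path_def sum_subtractf[symmetric] left_diff_distrib)
    also have "\<bar>\<dots>\<bar> \<le> (\<Sum>k\<le>n. \<bar>(w k i - w' k i) * Bernstein n k t\<bar>)" by (rule sum_abs)
    also have "\<dots> \<le> (\<Sum>k\<le>n. \<bar>w k i - w' k i\<bar>)"
    proof (rule sum_mono)
      fix k assume "k \<in> {..n}"
      then show "\<bar>(w k i - w' k i) * Bernstein n k t\<bar> \<le> \<bar>w k i - w' k i\<bar>"
        using B[of k] by (simp add: abs_mult mult_left_le)
    qed
    finally show "\<bar>bernstein_path d n w t i - bernstein_path d n w' t i\<bar> \<le> (\<Sum>k\<le>n. \<bar>w k i - w' k i\<bar>)" .
  qed
qed

lemma bernstein_path_tendsto:
  assumes x: "x \<in> mspace (path_metric d)"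
  shows "(\<lambda>n. mdist (path_metric d) (bernstein_path d n (\<lambda>k. x (real k / real n))) x) \<longlonglongrightarrow> 0"
proof (rule LIMSEQ_I)
  fix r :: real assume r: "0 < r"
  \<comment> \<open>The \<open>d\<close> coordinate errors together must stay strictly below
    \<open>r\<close>; adding 1 to \<open>d\<close> keeps the denominator positive.\<close>
  define e where "e = r / (2 * (real d + 1))"
  have e: "0 < e" "real d * e < r"
    using r by (auto simp: e_def field_simps intro!: add_nonneg_pos mult_nonneg_nonneg)
  have "\<exists>N. \<forall>n t. N \<le> n \<and> t \<in> {0..1} \<longrightarrow> \<bar>x t i - (\<Sum>k\<le>n. x (real k / real n) i * Bernstein n k t)\<bar> < e" if "i < d" for i
    using Bernstein_Weierstrass[of "\<lambda>t. x t i", OF _ e(1)] x that unfolding mem_path_metric by blast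
  then obtain N where N: "\<And>i n t. i < d \<Longrightarrow> N i \<le> n \<Longrightarrow> t \<in> {0..1} \<Longrightarrow>
      \<bar>x t i - (\<Sum>k\<le>n. x (real k / real n) i * Bernstein n k t)\<bar> < e" by metis
  show "\<exists>n0. \<forall>n\<ge>n0. norm (mdist (path_metric d) (bernstein_path d n (\<lambda>k. x (real k / real n))) x - 0) < r"
  \<comment> \<open>The sum of the coordinate thresholds dominates each of them.\<close>
  proof (intro exI[of _ "\<Sum>i<d. N i"] allI impI)
    fix n assume n: "(\<Sum>i<d. N i) \<le> n"
    have "N i \<le> n" if "i < d" for i
      using member_le_sum[of i "{..<d}" N] that n by auto
    then have *: "\<bar>x t i - (\<Sum>k\<le>n. x (real k / real n) i * Bernstein n k t)\<bar> \<le> e" if "i < d" "t \<in> {0..1}" for i t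
      using N[of i n t] that by fastforce
    have "mdist (path_metric d) (bernstein_path d n (\<lambda>k. x (real k / real n))) x \<le> real d * e"
    proof (rule mdist_path_le)
      fix t :: real assume t: "t \<in> {0..1}"
      have "(\<Sum>i<d. \<bar>bernstein_path d n (\<lambda>k. x (real k / real n)) t i - x t i\<bar>) \<le> (\<Sum>i<d. e)"
        using *[OF _ t] t by (intro sum_mono) (simp add: bernstein_path_def abs_minus_commute)
      then show "(\<Sum>i<d. \<bar>bernstein_path d n (\<lambda>k. x (real k / real n)) t i - x t i\<bar>) \<le> real d * e" by simp
    qed
    then show "norm (mdist (path_metric d) (bernstein_path d n (\<lambda>k. x (real k / real n))) x - 0) < r"
      using e(2) by simp
  qed
qed

locale path_functional =
  fixes d :: nat and f :: "(real \<Rightarrow> nat \<Rightarrow> real) \<Rightarrow> real" and K :: real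
  assumes range: "\<And>x. 0 \<le> f x \<and> f x \<le> 1" and K: "0 \<le> K"
    and Lipschitz: "\<And>x y. x \<in> mspace (path_metric d) \<Longrightarrow> y \<in> mspace (path_metric d) \<Longrightarrow>
      \<bar>f x - f y\<bar> \<le> K * mdist (path_metric d) x y"
begin

lemma bernstein_Lipschitz:
  "\<bar>f (bernstein_path d n w) - f (bernstein_path d n w')\<bar> \<le> K * (\<Sum>i<d. \<Sum>k\<le>n. \<bar>w k i - w' k i\<bar>)"
  by (rule order_trans[OF Lipschitz[OF bernstein_path_mem bernstein_path_mem]
      mult_left_mono[OF mdist_bernstein_path_le K]])

lemma bernstein_tendsto_arg:
  assumes "\<And>k i. k \<le> n \<Longrightarrow> i < d \<Longrightarrow> ((\<lambda>a. w a k i) \<longlongrightarrow> w' k i) F"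
  shows "((\<lambda>a. f (bernstein_path d n (w a))) \<longlongrightarrow> f (bernstein_path d n w')) F"
proof (rule LIM_zero_cancel)
  have "((\<lambda>a. K * (\<Sum>i<d. \<Sum>k\<le>n. \<bar>w a k i - w' k i\<bar>)) \<longlongrightarrow> 0) F"
    by (intro tendsto_mult_right_zero tendsto_null_sum tendsto_rabs_zero LIM_zero assms) auto
  then show "((\<lambda>a. f (bernstein_path d n (w a)) - f (bernstein_path d n w')) \<longlongrightarrow> 0) F"
    by (rule Lim_null_comparison[rotated]) (simp add: bernstein_Lipschitz)
qed

text \<open>Zeroing the entries that the path ignores gives a measurable map into the full product,
  to which continuity of the functional in its values applies.\<close>

lemma borel_measurable_bernstein:
  assumes "\<And>k i. k \<le> n \<Longrightarrow> i < d \<Longrightarrow> (\<lambda>\<omega>. W \<omega> k i) \<in> borel_measurable N"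
  shows "(\<lambda>\<omega>. f (bernstein_path d n (W \<omega>))) \<in> borel_measurable N"
proof -
  define W' where "W' \<omega> = (\<lambda>k i. if k \<le> n \<and> i < d then W \<omega> k i else 0)" for \<omega>
  have 1: "continuous_on UNIV (\<lambda>w. f (bernstein_path d n w))"
    unfolding continuous_on_def
  proof
    fix w :: "nat \<Rightarrow> nat \<Rightarrow> real"
    have "continuous_on UNIV (\<lambda>w :: nat \<Rightarrow> nat \<Rightarrow> real. w k i)" for k i
      by (intro continuous_on_product_coordinates continuous_on_compose2[OF continuous_on_product_coordinates continuous_on_product_coordinates]) auto
    then show "((\<lambda>w. f (bernstein_path d n w)) \<longlongrightarrow> f (bernstein_path d n w)) (at w within UNIV)"
      by (intro bernstein_tendsto_arg) (auto simp: continuous_on_def)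
  qed
  have "W' \<in> borel_measurable N"
  proof (intro measurable_coordinatewise_then_product)
    fix k i show "(\<lambda>\<omega>. W' \<omega> k i) \<in> borel_measurable N"
      using assms[of k i] by (cases "k \<le> n \<and> i < d") (auto simp: W'_def)
  qed
  from borel_measurable_continuous_on[OF 1 this]
  have "(\<lambda>\<omega>. f (bernstein_path d n (W' \<omega>))) \<in> borel_measurable N" .
  moreover have "bernstein_path d n (W' \<omega>) = bernstein_path d n (W \<omega>)" for \<omega>
    unfolding bernstein_path_def W'_def by (intro restrict_ext ext) auto
  ultimately show ?thesis by simp
qed

lemma continuous_map_path: "continuous_map (mtopology_of (path_metric d)) euclideanreal f"
  unfolding mtopology_of_def by (rule Metric_space.Lipschitz_continuous_map[OF Metric_space_mspace_mdist Lipschitz])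

lemma borel_measurable_path: "f \<in> borel_measurable (path_borel d)"
  unfolding path_borel_def by (rule borel_measurable_continuous_map[OF continuous_map_path])

lemma bernstein_tendsto_path:
  assumes x: "x \<in> mspace (path_metric d)"
  shows "(\<lambda>n. f (bernstein_path d n (\<lambda>k. x (real k / real n)))) \<longlonglongrightarrow> f x"
proof (rule LIM_zero_cancel)
  have "(\<lambda>n. K * mdist (path_metric d) (bernstein_path d n (\<lambda>k. x (real k / real n))) x) \<longlonglongrightarrow> 0"
    by (intro tendsto_mult_right_zero bernstein_path_tendsto x)
  then show "(\<lambda>n. f (bernstein_path d n (\<lambda>k. x (real k / real n))) - f x) \<longlonglongrightarrow> 0"
    by (rule Lim_null_comparison[rotated])
       (unfold real_norm_def, intro always_eventually allI Lipschitz bernstein_path_mem x)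
qed

end

lemma tv_dist_path_le:
  assumes \<mu>: "prob_space \<mu>" "sets \<mu> = sets (path_borel d)"
    and \<nu>: "prob_space \<nu>" "sets \<nu> = sets (path_borel d)"
    and *: "\<And>f K. path_functional d f K \<Longrightarrow> \<bar>(\<integral>x. f x \<partial>\<mu>) - (\<integral>x. f x \<partial>\<nu>)\<bar> \<le> c"
  shows "tv_dist \<mu> \<nu> \<le> c"
proof -
  interpret Metric_space "mspace (path_metric d)" "mdist (path_metric d)" by (rule Metric_space_mspace_mdist)
  have top: "sets (path_borel d) = sets (borel_of mtopology)"
    by (simp add: path_borel_def mtopology_of_def)
  have "path_functional d (\<lambda>_. 0) 0" by standard auto
  from *[OF this] have c: "0 \<le> c" by simp
  have pf: "path_functional d f K" if "\<And>x. 0 \<le> f x \<and> f x \<le> 1" "0 \<le> K"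
    "\<And>x y. x \<in> mspace (path_metric d) \<Longrightarrow> y \<in> mspace (path_metric d) \<Longrightarrow> \<bar>f x - f y\<bar> \<le> K * mdist (path_metric d) x y" for f K
    using that by (simp add: path_functional_def)
  show ?thesis unfolding tv_dist_def
  proof (rule cSUP_least)
    show "sets \<mu> \<noteq> {}" using sets.empty_sets by blast
    fix A assume A: "A \<in> sets \<mu>"
    \<comment> \<open>The transfer from test functionals to sets is one-sided, so it is carried out
      for both orders of the two measures.\<close>
    have "measure \<mu> A - measure \<nu> A \<le> c"
      by (rule measure_diff_le_of_Lipschitz[of \<mu> \<nu>]) (use \<mu> \<nu> top c A *[OF pf] in \<open>auto simp: abs_le_iff\<close>)
    moreover have "measure \<nu> A - measure \<mu> A \<le> c"
      by (rule measure_diff_le_of_Lipschitz[of \<nu> \<mu>]) (use \<mu> \<nu> top c A *[OF pf] in \<open>auto simp: abs_le_iff\<close>)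
    ultimately show "\<bar>measure \<mu> A - measure \<nu> A\<bar> \<le> c" by simp
  qed
qed

section \<open>The Euler scheme\<close>

text \<open>Young's inequality with a free weight: a small \<eta> keeps the first factor close to 1,
  so a contraction survives the addition of a perturbation.\<close>

lemma enorm_add_power2_le_weighted:
  assumes \<eta>: "0 < \<eta>"
  shows "(enorm d (\<lambda>i. x i + y i))\<^sup>2 \<le> (1 + \<eta>) * (enorm d x)\<^sup>2 + (1 + 1 / \<eta>) * (enorm d y)\<^sup>2"
proof -
  have "(x i + y i)\<^sup>2 \<le> (1 + \<eta>) * (x i)\<^sup>2 + (1 + 1 / \<eta>) * (y i)\<^sup>2" for i
  proof -
    have "0 \<le> (\<eta> * x i - y i)\<^sup>2 / \<eta>" using \<eta> by simp
    then show ?thesis using \<eta> by (simp add: field_simps power2_eq_square)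
  qed
  then show ?thesis
    unfolding enorm_power2 sum_distrib_left sum.distrib[symmetric] by (rule sum_mono)
qed

text \<open>Continuity is available on \<open>Rd d\<close>; composing with the projection
  \<open>p\<close> extends it to all of \<open>nat \<Rightarrow> real\<close>, where Borel
  measurability follows.\<close>

lemma (in potential_data) borel_measurable_grad:
  assumes t: "t \<in> {0..1}" and i: "i < d"
    and x: "\<And>k. k < d \<Longrightarrow> (\<lambda>\<omega>. x \<omega> k) \<in> borel_measurable N" "\<And>\<omega>. \<omega> \<in> space N \<Longrightarrow> x \<omega> \<in> Rd d"
  shows "(\<lambda>\<omega>. grad t (x \<omega>) i) \<in> borel_measurable N"
proof -
  define p where "p x = (\<lambda>k. if k < d then x k else (0::real))" for x
  have "continuous_on UNIV p"
  proof (rule continuous_on_coordinatewise_then_product)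
    fix k show "continuous_on UNIV (\<lambda>x. p x k)"
      by (cases "k < d") (auto simp: p_def intro: continuous_on_product_coordinates)
  qed
  then have c: "continuous_on UNIV (\<lambda>x. grad t (p x) i)"
    by (rule continuous_on_compose2[OF grad_continuous_on[OF t i]]) (auto simp: p_def Rd_iff)
  have "(\<lambda>\<omega>. p (x \<omega>)) \<in> borel_measurable N"
  proof (rule measurable_coordinatewise_then_product)
    fix k show "(\<lambda>\<omega>. p (x \<omega>) k) \<in> borel_measurable N"
      using x(1)[of k] by (cases "k < d") (auto simp: p_def)
  qed
  moreover have "p (p x) = p x" for x by (simp add: p_def fun_eq_iff)
  ultimately have "(\<lambda>\<omega>. grad t (p (x \<omega>)) i) \<in> borel_measurable N"
    using borel_measurable_continuous_on[OF c, of "\<lambda>\<omega>. p (x \<omega>)"] by simp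
  moreover have "p (x \<omega>) = x \<omega>" if "\<omega> \<in> space N" for \<omega>
    using x(2)[OF that] by (auto simp: p_def Rd_iff)
  ultimately show ?thesis by (subst measurable_cong[of N _ "\<lambda>\<omega>. grad t (p (x \<omega>)) i"]) auto
qed

lemma borel_measurable_Euclidean_coordinate:
  "f \<in> N \<rightarrow>\<^sub>M borel_of (Euclidean_space d) \<Longrightarrow> (\<lambda>\<omega>. f \<omega> i) \<in> borel_measurable N"
  by (erule measurable_compose, rule borel_measurable_continuous_map)
     (simp add: continuous_map_Euclidean_space_iff continuous_on_product_coordinates continuous_on_subset[of UNIV])

locale langevin_euler = potential_data d U L K M
  for d :: nat and U :: "real \<Rightarrow> (nat \<Rightarrow> real) \<Rightarrow> real" and L K M :: real +
  fixes \<epsilon> h :: real and \<Omega> :: "'w measure" and F :: "real \<Rightarrow> 'w measure"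
    and X\<^sub>0 :: "'w \<Rightarrow> nat \<Rightarrow> real" and B X Y :: "'w \<Rightarrow> real \<Rightarrow> nat \<Rightarrow> real"
  assumes \<epsilon>_pos: "0 < \<epsilon>" and h_pos: "0 < h" and h_le_1: "h \<le> 1"
    and brownian: "brownian_motion \<Omega> F d B"
    and X\<^sub>0_meas: "X\<^sub>0 \<in> F 0 \<rightarrow>\<^sub>M borel_of (Euclidean_space d)"
    and X_meas: "X \<in> \<Omega> \<rightarrow>\<^sub>M path_borel d"
    and X_eq: "AE \<omega> in \<Omega>. path_eq d \<epsilon> (langevin_drift U (X \<omega>)) (X\<^sub>0 \<omega>) (B \<omega>) (X \<omega>)"
    and Y_meas: "Y \<in> \<Omega> \<rightarrow>\<^sub>M path_borel d"
    and Y_eq: "AE \<omega> in \<Omega>. path_eq d \<epsilon> (euler_drift U h (Y \<omega>)) (X\<^sub>0 \<omega>) (B \<omega>) (Y \<omega>)"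
    and X\<^sub>0_integrable: "integrable \<Omega> (\<lambda>\<omega>. (enorm d (X\<^sub>0 \<omega>))\<^sup>2)"
begin

sublocale prob_space \<Omega>
  using brownian by (simp add: brownian_motion_def)

lemma space_F: "space (F t) = space \<Omega>"
  and F_mono: "s \<le> t \<Longrightarrow> sets (F s) \<subseteq> sets (F t)"
  and sets_F: "sets (F t) \<subseteq> sets \<Omega>"
  and B_meas: "B \<in> \<Omega> \<rightarrow>\<^sub>M path_borel d"
  using brownian filtration.space_F[of "space \<Omega>" F] filtration.sets_F_mono[of "space \<Omega>" F s t]
  by (auto simp: brownian_motion_def)

lemma measurable_F_mono: "s \<le> t \<Longrightarrow> f \<in> F s \<rightarrow>\<^sub>M P \<Longrightarrow> f \<in> F t \<rightarrow>\<^sub>M P"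
  using measurable_mono[of P P "F s" "F t"] F_mono[of s t] space_F[of s] space_F[of t] by auto

lemma measurable_F_\<Omega>: "f \<in> F t \<rightarrow>\<^sub>M P \<Longrightarrow> f \<in> \<Omega> \<rightarrow>\<^sub>M P"
  using measurable_mono[of P P "F t" \<Omega>] sets_F[of t] space_F[of t] by auto

lemma B_adapted: "t \<in> {0..1} \<Longrightarrow> (\<lambda>\<omega>. B \<omega> t i) \<in> borel_measurable (F t)"
  using brownian by (intro borel_measurable_Euclidean_coordinate) (auto simp: brownian_motion_def)

lemma X_mem: "\<omega> \<in> space \<Omega> \<Longrightarrow> X \<omega> \<in> mspace (path_metric d)"
  using measurable_space[OF X_meas] by (simp only: space_path_borel)

lemma Y_mem: "\<omega> \<in> space \<Omega> \<Longrightarrow> Y \<omega> \<in> mspace (path_metric d)"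
  using measurable_space[OF Y_meas] by (simp only: space_path_borel)

lemma X\<^sub>0_adapted: "(\<lambda>\<omega>. X\<^sub>0 \<omega> i) \<in> borel_measurable (F 0)"
  by (rule borel_measurable_Euclidean_coordinate[OF X\<^sub>0_meas])

lemma X\<^sub>0_mem: "\<omega> \<in> space \<Omega> \<Longrightarrow> X\<^sub>0 \<omega> \<in> Rd d"
  using measurable_space[OF X\<^sub>0_meas] by (simp add: space_F)

definition \<Delta>B :: "real \<Rightarrow> real \<Rightarrow> 'w \<Rightarrow> nat \<Rightarrow> real" where
  "\<Delta>B s t \<omega> = (\<lambda>i\<in>{..<d}. B \<omega> t i - B \<omega> s i)"

lemma \<Delta>B_adapted: "0 \<le> s \<Longrightarrow> s \<le> t \<Longrightarrow> t \<le> 1 \<Longrightarrow> \<Delta>B s t \<in> F t \<rightarrow>\<^sub>M PiM {..<d} (\<lambda>_. borel)"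
  unfolding \<Delta>B_def
  by (intro measurable_restrict borel_measurable_diff B_adapted measurable_F_mono[OF _ B_adapted]) auto

lemma \<Delta>B_indep: "0 \<le> s \<Longrightarrow> s < t \<Longrightarrow> t \<le> 1 \<Longrightarrow>
    indep_set (sets (F s)) (sets (vimage_algebra (space \<Omega>) (\<Delta>B s t) (PiM {..<d} (\<lambda>_. borel))))"
  and \<Delta>B_distr: "0 \<le> s \<Longrightarrow> s < t \<Longrightarrow> t \<le> 1 \<Longrightarrow>
    distr \<Omega> (PiM {..<d} (\<lambda>_. borel)) (\<Delta>B s t) = PiM {..<d} (\<lambda>_. gauss (sqrt (t - s)))"
  using brownian unfolding brownian_motion_def \<Delta>B_def[abs_def] by blast+

lemma \<Delta>B_moments:
  assumes "0 \<le> s" "s < t" "t \<le> 1" "i < d"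
  shows "integrable \<Omega> (\<lambda>\<omega>. \<Delta>B s t \<omega> i)" "expectation (\<lambda>\<omega>. \<Delta>B s t \<omega> i) = 0"
    "integrable \<Omega> (\<lambda>\<omega>. (\<Delta>B s t \<omega> i)\<^sup>2)" "expectation (\<lambda>\<omega>. (\<Delta>B s t \<omega> i)\<^sup>2) = t - s"
proof -
  have m: "\<Delta>B s t \<in> \<Omega> \<rightarrow>\<^sub>M PiM {..<d} (\<lambda>_. borel)"
    by (rule measurable_F_\<Omega>[OF \<Delta>B_adapted]) (use assms in auto)
  have p: "0 < sqrt (t - s)" using assms by simp
  note * = gauss_component_moments[OF m \<Delta>B_distr[OF assms(1-3)] p assms(4)]
  show "integrable \<Omega> (\<lambda>\<omega>. \<Delta>B s t \<omega> i)" "expectation (\<lambda>\<omega>. \<Delta>B s t \<omega> i) = 0"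
    "integrable \<Omega> (\<lambda>\<omega>. (\<Delta>B s t \<omega> i)\<^sup>2)" by (rule *)+
  show "expectation (\<lambda>\<omega>. (\<Delta>B s t \<omega> i)\<^sup>2) = t - s" using *(4) assms by simp
qed

definition \<sigma> :: real where "\<sigma> = sqrt (2 / \<epsilon>)"

lemma \<sigma>_pos: "0 < \<sigma>" and \<sigma>_power2: "\<sigma>\<^sup>2 = 2 / \<epsilon>"
  using \<epsilon>_pos by (auto simp: \<sigma>_def)

text \<open>The number of complete Euler steps. Unless 1/h is an integer they end before time 1, and
  \<open>euler_drift\<close> is zero afterwards.\<close>

definition n :: nat where "n = nat \<lfloor>1 / h\<rfloor>"

lemma n_h_le: "real n * h \<le> 1" and n_h_gt: "1 < (real n + 1) * h"
proof -
  have "real n = of_int \<lfloor>1 / h\<rfloor>" using h_pos by (simp add: n_def)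
  then have "real n \<le> 1 / h" "1 / h < real n + 1" by linarith+
  then show "real n * h \<le> 1" "1 < (real n + 1) * h" using h_pos by (simp_all add: field_simps)
qed

lemma kh_mem: "k \<le> n \<Longrightarrow> real k * h \<in> {0..1}"
proof -
  assume "k \<le> n"
  then have "real k * h \<le> real n * h" using h_pos by (intro mult_right_mono) auto
  then have "real k * h \<le> 1" using n_h_le by linarith
  then show "real k * h \<in> {0..1}" using h_pos by simp
qed

text \<open>The scheme at the Euler times as an explicit function of the initial value and the
  increments, valid at every sample point and hence adapted; \<open>Y\<close> obeys its equation
  only almost surely.\<close>

primrec y :: "nat \<Rightarrow> 'w \<Rightarrow> nat \<Rightarrow> real" where
  "y 0 \<omega> = X\<^sub>0 \<omega>"
| "y (Suc k) \<omega> = (\<lambda>i. if i < d then y k \<omega> i - h / \<epsilon> * grad (real k * h) (y k \<omega>) i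
      + \<sigma> * \<Delta>B (real k * h) (real (Suc k) * h) \<omega> i else 0)"

lemma y_mem: "\<omega> \<in> space \<Omega> \<Longrightarrow> y k \<omega> \<in> Rd d"
  by (cases k) (auto simp: X\<^sub>0_mem Rd_iff[of "\<lambda>i. if i < d then _ i else _"])

lemma \<Delta>B_component: "0 \<le> s \<Longrightarrow> s \<le> t \<Longrightarrow> t \<le> 1 \<Longrightarrow> i < d \<Longrightarrow> (\<lambda>\<omega>. \<Delta>B s t \<omega> i) \<in> borel_measurable (F t)"
  using measurable_compose[OF \<Delta>B_adapted measurable_component_singleton] by simp

lemma y_adapted: "k \<le> n \<Longrightarrow> i < d \<Longrightarrow> (\<lambda>\<omega>. y k \<omega> i) \<in> borel_measurable (F (real k * h))"
proof (induction k arbitrary: i)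
  case 0
  then show ?case using X\<^sub>0_adapted by simp
next
  case (Suc k)
  have kt: "real k * h \<in> {0..1}" "real (Suc k) * h \<in> {0..1}" "real k * h \<le> real (Suc k) * h"
    using kh_mem[of k] kh_mem[of "Suc k"] Suc.prems h_pos by auto
  have yk: "(\<lambda>\<omega>. y k \<omega> j) \<in> borel_measurable (F (real (Suc k) * h))" if "j < d" for j
    by (rule measurable_F_mono[OF kt(3) Suc.IH]) (use Suc.prems that in auto)
  have "(\<lambda>\<omega>. grad (real k * h) (y k \<omega>) i) \<in> borel_measurable (F (real (Suc k) * h))"
    by (rule borel_measurable_grad[OF kt(1) Suc.prems(2) yk]) (auto simp: space_F y_mem)
  moreover have "(\<lambda>\<omega>. \<Delta>B (real k * h) (real (Suc k) * h) \<omega> i) \<in> borel_measurable (F (real (Suc k) * h))"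
    by (rule \<Delta>B_component) (use kt Suc.prems in auto)
  ultimately show ?case using yk[OF Suc.prems(2)] Suc.prems by simp
qed

lemma grad_y_adapted: "k \<le> n \<Longrightarrow> i < d \<Longrightarrow> (\<lambda>\<omega>. grad (real k * h) (y k \<omega>) i) \<in> borel_measurable (F (real k * h))"
  by (intro borel_measurable_grad kh_mem y_adapted) (auto simp: space_F y_mem)

text \<open>The Lebesgue measure of the part of the \<open>k\<close>-th step lying before time \<open>t\<close>.\<close>

definition len :: "nat \<Rightarrow> real \<Rightarrow> real" where
  "len k t = max 0 (min t ((real k + 1) * h) - real k * h)"

text \<open>A version of \<open>Y\<close> with exact adaptedness. The value
  \<open>B \<omega> 0\<close> is subtracted because it vanishes only almost surely, which would
  otherwise spoil the initial value of \<open>Y'\<close>.\<close>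

definition Y' :: "real \<Rightarrow> 'w \<Rightarrow> nat \<Rightarrow> real" where
  "Y' t \<omega> = (\<lambda>i. if i < d then X\<^sub>0 \<omega> i - 1 / \<epsilon> * (\<Sum>k<n. grad (real k * h) (y k \<omega>) i * len k t)
      + \<sigma> * (B \<omega> t i - B \<omega> 0 i) else 0)"

lemma Y'_mem: "Y' t \<omega> \<in> Rd d"
  by (simp add: Y'_def Rd_iff)

lemma Y'_adapted:
  assumes t: "t \<in> {0..1}" and i: "i < d"
  shows "(\<lambda>\<omega>. Y' t \<omega> i) \<in> borel_measurable (F t)"
proof -
  have "(\<lambda>\<omega>. grad (real k * h) (y k \<omega>) i * len k t) \<in> borel_measurable (F t)" if k: "k < n" for k
  \<comment> \<open>A step that begins after t has length zero, so its gradient, not yet measurable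
    at t, drops out.\<close>
  proof (cases "t \<le> real k * h")
    case True
    then show ?thesis by (simp add: len_def)
  next
    case False
    then show ?thesis using k i
      by (intro borel_measurable_times measurable_F_mono[OF _ grad_y_adapted]) auto
  qed
  then have "(\<lambda>\<omega>. \<Sum>k<n. grad (real k * h) (y k \<omega>) i * len k t) \<in> borel_measurable (F t)"
    by (intro borel_measurable_sum) auto
  moreover have "(\<lambda>\<omega>. B \<omega> 0 i) \<in> borel_measurable (F t)" "(\<lambda>\<omega>. X\<^sub>0 \<omega> i) \<in> borel_measurable (F t)"
    using t by (auto intro!: measurable_F_mono[OF _ B_adapted] measurable_F_mono[OF _ X\<^sub>0_adapted])
  ultimately show ?thesis using B_adapted[OF t, of i] i by (simp add: Y'_def)
qed

text \<open>Completed steps count with length \<open>h\<close>, the current one with the time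
  elapsed. At \<open>k = n\<close> there is no current step, which produces the case
  distinction.\<close>

lemma sum_len:
  assumes k: "k \<le> n" and t: "real k * h \<le> t" "t \<le> (real k + 1) * h"
  shows "(\<Sum>l<n. g l * len l t) = h * (\<Sum>l<k. g l) + (if k < n then (t - real k * h) * g k else 0)"
proof -
  have le: "real a * h \<le> real b * h" if "a \<le> b" for a b using that h_pos by (intro mult_right_mono) auto
  have 1: "len l t = h" if "l < k" for l
    using le[of "Suc l" k] that t h_pos by (simp add: len_def min_def max_def algebra_simps)
  have 2: "len l t = 0" if "k < l" for l
    using le[of "Suc k" l] that t h_pos by (simp add: len_def min_def max_def algebra_simps)
  have 3: "len k t = t - real k * h" using t by (simp add: len_def min_def max_def)
  have "(\<Sum>l<n. g l * len l t) = (\<Sum>l<n. if l < k then h * g l else if l = k then (t - real k * h) * g k else 0)"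
    using 1 2 3 by (intro sum.cong refl) (auto simp: neq_iff)
  also have "\<dots> = (\<Sum>l<n. (if l < k then h * g l else 0) + (if l = k then (t - real k * h) * g k else 0))"
    by (intro sum.cong refl) auto
  also have "\<dots> = (\<Sum>l<n. if l < k then h * g l else 0) + (if k < n then (t - real k * h) * g k else 0)"
    by (simp add: sum.distrib)
  also have "(\<Sum>l<n. if l < k then h * g l else 0) = (\<Sum>l<k. h * g l)"
    using k by (intro sum.mono_neutral_cong_right) auto
  finally show ?thesis by (simp add: sum_distrib_left)
qed

lemma y_eq_sum:
  "i < d \<Longrightarrow> y k \<omega> i = X\<^sub>0 \<omega> i - 1 / \<epsilon> * (h * (\<Sum>l<k. grad (real l * h) (y l \<omega>) i)) + \<sigma> * (B \<omega> (real k * h) i - B \<omega> 0 i)"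
  by (induction k) (simp_all add: \<Delta>B_def algebra_simps add_divide_distrib)

lemma Y'_step:
  assumes k: "k \<le> n" and t: "real k * h \<le> t" "t \<le> (real k + 1) * h" and i: "i < d"
  shows "Y' t \<omega> i = y k \<omega> i - (if k < n then (t - real k * h) / \<epsilon> * grad (real k * h) (y k \<omega>) i else 0)
      + \<sigma> * \<Delta>B (real k * h) t \<omega> i"
  using i sum_len[OF k t, of "\<lambda>l. grad (real l * h) (y l \<omega>) i"]
  by (simp add: Y'_def y_eq_sum \<Delta>B_def algebra_simps add_divide_distrib)

lemma Y'_grid: "k \<le> n \<Longrightarrow> \<omega> \<in> space \<Omega> \<Longrightarrow> Y' (real k * h) \<omega> = y k \<omega>"
proof
  fix i assume k: "k \<le> n" and \<omega>: "\<omega> \<in> space \<Omega>"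
  show "Y' (real k * h) \<omega> i = y k \<omega> i"
  proof (cases "i < d")
    case True
    have "real k * h \<le> (real k + 1) * h" using h_pos by (simp add: algebra_simps)
    from Y'_step[OF k order_refl this True] True show ?thesis by (simp add: \<Delta>B_def)
  next
    case False
    then show ?thesis using y_mem[OF \<omega>, of k] Y'_mem[of "real k * h" \<omega>] by (simp add: Rd_iff)
  qed
qed

lemma LBINT_euler_drift:
  "(LBINT s:{0..t}. euler_drift U h x s i) = (\<Sum>k<n. grad (real k * h) (x (real k * h)) i * len k t)"
proof -
  have m: "measure lborel ({real k * h..<(real k + 1) * h} \<inter> {0..t}) = len k t"
    and f: "emeasure lborel ({real k * h..<(real k + 1) * h} \<inter> {0..t}) < \<infinity>" for k
  proof -
    have "{real k * h..<(real k + 1) * h} \<inter> {0..t} = (if t < (real k + 1) * h then {real k * h..t} else {real k * h..<(real k + 1) * h})"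
    proof -
      have "0 \<le> real k * h" using h_pos by simp
      then show ?thesis by auto
    qed
    moreover have "real k * h \<le> (real k + 1) * h" using h_pos by (simp add: algebra_simps)
    ultimately show "measure lborel ({real k * h..<(real k + 1) * h} \<inter> {0..t}) = len k t"
      "emeasure lborel ({real k * h..<(real k + 1) * h} \<inter> {0..t}) < \<infinity>"
      by (auto simp: len_def emeasure_lborel_Icc_eq)
  qed
  have "(LBINT s:{0..t}. euler_drift U h x s i)
      = (LBINT s. (\<Sum>k<n. grad (real k * h) (x (real k * h)) i * indicator ({real k * h..<(real k + 1) * h} \<inter> {0..t}) s))"
    unfolding set_lebesgue_integral_def euler_drift_def n_def
    by (intro Bochner_Integration.integral_cong refl) (auto simp: indicator_def sum_distrib_left intro!: sum.cong)
  also have "\<dots> = (\<Sum>k<n. grad (real k * h) (x (real k * h)) i * len k t)"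
    using f m by (subst Bochner_Integration.integral_sum) (auto intro!: integrable_mult_right integrable_real_indicator)
  finally show ?thesis .
qed

lemma AE_B_0: "AE \<omega> in \<Omega>. B \<omega> 0 = (\<lambda>_. 0)"
  using brownian by (simp add: brownian_motion_def)

text \<open>At the Euler times the integrated equation is an explicit recursion, so strong induction
  identifies the values there; these determine the drift, and with it the path, at all
  times.\<close>

lemma AE_Y_eq_Y': "AE \<omega> in \<Omega>. \<forall>t\<in>{0..1}. Y \<omega> t = Y' t \<omega>"
  using Y_eq AE_B_0 AE_space
proof eventually_elim
  case (elim \<omega>)
  have Yt: "Y \<omega> t i = X\<^sub>0 \<omega> i - 1 / \<epsilon> * (\<Sum>k<n. grad (real k * h) (Y \<omega> (real k * h)) i * len k t) + \<sigma> * B \<omega> t i"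
    if "t \<in> {0..1}" "i < d" for t i
    using elim(1) that by (simp add: path_eq_def LBINT_euler_drift \<sigma>_def)
  have YRd: "Y \<omega> t \<in> Rd d" if "t \<in> {0..1}" for t using Y_mem[OF elim(3)] that by (simp only: mem_path_metric)
  have Yk: "Y \<omega> (real k * h) = y k \<omega>" if "k \<le> n" for k
    using that
  proof (induction k rule: less_induct)
    case (less k)
    show ?case
    proof
      fix i
      show "Y \<omega> (real k * h) i = y k \<omega> i"
      proof (cases "i < d")
        case True
        have "(\<Sum>l<n. grad (real l * h) (Y \<omega> (real l * h)) i * len l (real k * h)) = h * (\<Sum>l<k. grad (real l * h) (y l \<omega>) i)"
          using sum_len[OF less.prems, of "real k * h" "\<lambda>l. grad (real l * h) (Y \<omega> (real l * h)) i"] h_pos less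
          by (simp add: algebra_simps)
        then show ?thesis using Yt[OF kh_mem[OF less.prems] True] y_eq_sum[OF True, of k \<omega>] elim(2) by simp
      next
        case False
        then show ?thesis using YRd[OF kh_mem[OF less.prems]] y_mem[OF elim(3), of k] by (simp add: Rd_iff)
      qed
    qed
  qed
  show ?case
  proof (intro ballI ext)
    fix t :: real and i assume t: "t \<in> {0..1}"
    show "Y \<omega> t i = Y' t \<omega> i"
      using Yt[OF t, of i] YRd[OF t] elim(2) by (cases "i < d") (simp_all add: Y'_def Yk Rd_iff)
  qed
qed

end

section \<open>Mean square bounds for the scheme and its drift discrepancy\<close>

lemma borel_measurable_enorm_power2:
  "(\<And>i. i < d \<Longrightarrow> (\<lambda>\<omega>. x \<omega> i) \<in> borel_measurable N) \<Longrightarrow> (\<lambda>\<omega>. (enorm d (x \<omega>))\<^sup>2) \<in> borel_measurable N"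
  unfolding enorm_power2 by (intro borel_measurable_sum borel_measurable_power) auto

lemma power2_le_enorm: "i < d \<Longrightarrow> (x i)\<^sup>2 \<le> (enorm d x)\<^sup>2"
  using abs_le_enorm[of i d x] by (metis abs_le_square_iff abs_of_nonneg enorm_nonneg)

locale langevin_euler_small_step = langevin_euler +
  assumes small_step: "h / \<epsilon> * (L\<^sup>2 / K) \<le> 1"
begin

definition a\<^sub>0 :: real where "a\<^sub>0 = expectation (\<lambda>\<omega>. (enorm d (X\<^sub>0 \<omega>))\<^sup>2)"

text \<open>The bracket is the fixed point of the moment recursion that sends a to (1 - \<eta>) a +
  4 h \<epsilon> \<open>S2\<close> / K + 2 h d / \<epsilon>; adding the initial moment gives a level
  that every step preserves.\<close>

definition A :: real where "A = a\<^sub>0 + (8 * \<epsilon>\<^sup>2 * S2 / K\<^sup>2 + 4 * real d / K)"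

text \<open>A gradient step contracts squares by 1 - 2 (h/\<epsilon>) K + (h/\<epsilon>)^2 L^2,
  which is at most 1 - 2 \<eta>. Half of this gain, one \<eta>, is spent on the motion of the
  minimiser.\<close>

definition \<eta> :: real where "\<eta> = h * K / (2 * \<epsilon>)"

lemma \<eta>: "0 < \<eta>" "\<eta> \<le> 1 / 2" "h / \<epsilon> * K = 2 * \<eta>" "(h / \<epsilon>)\<^sup>2 * L\<^sup>2 \<le> 2 * \<eta>"
proof -
  show "0 < \<eta>" using h_pos K_pos \<epsilon>_pos by (simp add: \<eta>_def)
  show *: "h / \<epsilon> * K = 2 * \<eta>" using \<epsilon>_pos by (simp add: \<eta>_def)
  have 1: "h / \<epsilon> * L\<^sup>2 \<le> K"
    using mult_right_mono[OF small_step, of K] K_pos by simp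
  have "h / \<epsilon> * (K * K) \<le> h / \<epsilon> * L\<^sup>2"
    using K_le_L K_pos h_pos \<epsilon>_pos by (intro mult_left_mono) (auto simp: power2_eq_square intro: mult_mono)
  with 1 have "(h / \<epsilon> * K) * K \<le> 1 * K" by (simp add: mult_ac)
  then have "h / \<epsilon> * K \<le> 1" using K_pos by (simp only: mult_le_cancel_right)
  then show "\<eta> \<le> 1 / 2" using * by simp
  have "(h / \<epsilon>) * (h / \<epsilon> * L\<^sup>2) \<le> (h / \<epsilon>) * K" using 1 h_pos \<epsilon>_pos by (intro mult_left_mono) auto
  then show "(h / \<epsilon>)\<^sup>2 * L\<^sup>2 \<le> 2 * \<eta>" unfolding * by (simp add: power2_eq_square mult_ac)
qed

lemma \<Delta>B_square:
  assumes "0 \<le> s" "s \<le> t" "t \<le> 1"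
  shows \<Delta>B_square_integrable: "integrable \<Omega> (\<lambda>\<omega>. (enorm d (\<Delta>B s t \<omega>))\<^sup>2)"
    and \<Delta>B_square_expectation: "expectation (\<lambda>\<omega>. (enorm d (\<Delta>B s t \<omega>))\<^sup>2) = real d * (t - s)"
proof -
  have *: "integrable \<Omega> (\<lambda>\<omega>. (\<Delta>B s t \<omega> i)\<^sup>2) \<and> expectation (\<lambda>\<omega>. (\<Delta>B s t \<omega> i)\<^sup>2) = t - s" if i: "i < d" for i
  proof (cases "s = t")
    case True
    then show ?thesis using i by (simp add: \<Delta>B_def)
  next
    case False
    then show ?thesis using \<Delta>B_moments[of s t i] assms i by auto
  qed
  show "integrable \<Omega> (\<lambda>\<omega>. (enorm d (\<Delta>B s t \<omega>))\<^sup>2)"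
    unfolding enorm_power2 by (intro Bochner_Integration.integrable_sum) (use * in auto)
  show "expectation (\<lambda>\<omega>. (enorm d (\<Delta>B s t \<omega>))\<^sup>2) = real d * (t - s)"
    unfolding enorm_power2 using * by (subst Bochner_Integration.integral_sum) auto
qed

text \<open>The mean square distance to the current minimiser obeys an affine recursion: contraction
  of the gradient step, displacement of the minimiser, and Gaussian variance, the last added without
  cross term by independence.\<close>

lemma y_moment:
  "k \<le> n \<Longrightarrow> integrable \<Omega> (\<lambda>\<omega>. (edist d (y k \<omega>) (m (real k * h)))\<^sup>2)
    \<and> expectation (\<lambda>\<omega>. (edist d (y k \<omega>) (m (real k * h)))\<^sup>2) \<le> A"
proof (induction k)
  case 0
  have "edist d (X\<^sub>0 \<omega>) (\<lambda>_. 0) = enorm d (X\<^sub>0 \<omega>)" for \<omega> by (simp add: edist_def)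
  moreover have "0 \<le> 8 * \<epsilon>\<^sup>2 * S2 / K\<^sup>2 + 4 * real d / K" using S2_nonneg K_pos by simp
  ultimately show ?case using X\<^sub>0_integrable by (simp add: minimizer_0 A_def a\<^sub>0_def)
next
  case (Suc k)
  let ?t = "real k * h" and ?t' = "real (Suc k) * h"
  have k: "k \<le> n" using Suc.prems by simp
  have t: "?t \<in> {0..1}" "?t' \<in> {0..1}" "?t < ?t'" "?t' - ?t = h"
    using kh_mem[OF k] kh_mem[OF Suc.prems] h_pos by (auto simp: algebra_simps)
  define ak where "ak \<omega> = (edist d (y k \<omega>) (m ?t))\<^sup>2" for \<omega>
  have IH: "integrable \<Omega> ak" "expectation ak \<le> A" using Suc.IH[OF k] by (auto simp: ak_def[abs_def])
  \<comment> \<open>The part of the new distance vector that is known at the old time: the gradient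
    step, recentred at the new minimiser.\<close>
  define Q where "Q \<omega> = (\<lambda>i. (y k \<omega> i - m ?t i - h / \<epsilon> * grad ?t (y k \<omega>) i) + (m ?t i - m ?t' i))" for \<omega>
  let ?C = "(1 + 1 / \<eta>) * (S2 * h\<^sup>2)"
  have Q_le: "(enorm d (Q \<omega>))\<^sup>2 \<le> (1 - \<eta>) * ak \<omega> + ?C" if \<omega>: "\<omega> \<in> space \<Omega>" for \<omega>
  proof -
    have "(enorm d (Q \<omega>))\<^sup>2 \<le> (1 + \<eta>) * (enorm d (\<lambda>i. y k \<omega> i - m ?t i - h / \<epsilon> * grad ?t (y k \<omega>) i))\<^sup>2
        + (1 + 1 / \<eta>) * (enorm d (\<lambda>i. m ?t i - m ?t' i))\<^sup>2"
      unfolding Q_def by (rule enorm_add_power2_le_weighted[OF \<eta>(1)])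
    also have "\<dots> \<le> (1 + \<eta>) * ((1 - 2 * \<eta>) * ak \<omega>) + ?C"
    proof (intro add_mono mult_left_mono)
      have "(enorm d (\<lambda>i. y k \<omega> i - m ?t i - h / \<epsilon> * grad ?t (y k \<omega>) i))\<^sup>2
          \<le> (1 - 2 * (h / \<epsilon>) * K + (h / \<epsilon>)\<^sup>2 * L\<^sup>2) * ak \<omega>"
        unfolding ak_def by (rule gradient_step_contraction[OF t(1) y_mem[OF \<omega>]]) (use h_pos \<epsilon>_pos in simp)
      also have "\<dots> \<le> (1 - 2 * \<eta>) * ak \<omega>"
        using \<eta>(3,4) by (intro mult_right_mono) (auto simp: ak_def)
      finally show "(enorm d (\<lambda>i. y k \<omega> i - m ?t i - h / \<epsilon> * grad ?t (y k \<omega>) i))\<^sup>2 \<le> (1 - 2 * \<eta>) * ak \<omega>" .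
      have "(enorm d (\<lambda>i. m ?t i - m ?t' i))\<^sup>2 = (edist d (m ?t') (m ?t))\<^sup>2"
        unfolding edist_def by (subst enorm_minus) simp
      also have "\<dots> \<le> S2 * h\<^sup>2"
        using minimizer_edist_power2_le[OF t(1,2,3)] t(4) by simp
      finally show "(enorm d (\<lambda>i. m ?t i - m ?t' i))\<^sup>2 \<le> S2 * h\<^sup>2" .
    qed (use \<eta>(1) in auto)
    also have "(1 + \<eta>) * ((1 - 2 * \<eta>) * ak \<omega>) \<le> (1 - \<eta>) * ak \<omega>"
    proof -
      have "(1 + \<eta>) * (1 - 2 * \<eta>) \<le> 1 - \<eta>" by (simp add: algebra_simps)
      then have "((1 + \<eta>) * (1 - 2 * \<eta>)) * ak \<omega> \<le> (1 - \<eta>) * ak \<omega>" by (rule mult_right_mono) (simp add: ak_def)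
      then show ?thesis by (simp add: mult.assoc)
    qed
    finally show ?thesis by simp
  qed
  have Qm: "(\<lambda>\<omega>. Q \<omega> i) \<in> borel_measurable (F ?t)" if "i < d" for i
    unfolding Q_def using y_adapted[OF k that] grad_y_adapted[OF k that] by simp
  have Q\<Omega>: "(\<lambda>\<omega>. Q \<omega> i) \<in> borel_measurable \<Omega>" if "i < d" for i by (rule measurable_F_\<Omega>[OF Qm[OF that]])
  have bint: "integrable \<Omega> (\<lambda>\<omega>. (1 - \<eta>) * ak \<omega> + ?C)" using IH(1) by simp
  have Qint: "integrable \<Omega> (\<lambda>\<omega>. (enorm d (Q \<omega>))\<^sup>2)"
    by (rule Bochner_Integration.integrable_bound[OF bint borel_measurable_enorm_power2[OF Q\<Omega>] AE_I2])
       (use Q_le in \<open>auto intro: order_trans[OF _ abs_ge_self]\<close>)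
  have Q2: "integrable \<Omega> (\<lambda>\<omega>. (Q \<omega> i)\<^sup>2)" if "i < d" for i
    by (rule Bochner_Integration.integrable_bound[OF Qint _ AE_I2]) (use Q\<Omega>[OF that] power2_le_enorm[OF that] in auto)
  have \<Delta>: "integrable \<Omega> (\<lambda>\<omega>. \<Delta>B ?t ?t' \<omega> i)" "expectation (\<lambda>\<omega>. \<Delta>B ?t ?t' \<omega> i) = 0"
    "integrable \<Omega> (\<lambda>\<omega>. (\<Delta>B ?t ?t' \<omega> i)\<^sup>2)" if "i < d" for i
    using \<Delta>B_moments[of ?t ?t' i] t that by auto
  have cross: "integrable \<Omega> (\<lambda>\<omega>. Q \<omega> i * \<Delta>B ?t ?t' \<omega> i)" "expectation (\<lambda>\<omega>. Q \<omega> i * \<Delta>B ?t ?t' \<omega> i) = 0"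
    if i: "i < d" for i
  proof -
    have B: "\<Delta>B ?t ?t' \<in> \<Omega> \<rightarrow>\<^sub>M PiM {..<d} (\<lambda>_. borel)"
      by (rule measurable_F_\<Omega>[OF \<Delta>B_adapted]) (use t in auto)
    have I: "indep_set (sets (F ?t)) (sets (vimage_algebra (space \<Omega>) (\<Delta>B ?t ?t') (PiM {..<d} (\<lambda>_. borel))))"
      by (rule \<Delta>B_indep) (use t in auto)
    have c: "(\<lambda>z. z i) \<in> PiM {..<d} (\<lambda>_. borel) \<rightarrow>\<^sub>M (borel :: real measure)"
      using i by simp
    note int = square_integrable_imp_integrable[OF Q\<Omega>[OF i] Q2[OF i]]
    show "integrable \<Omega> (\<lambda>\<omega>. Q \<omega> i * \<Delta>B ?t ?t' \<omega> i)"
      by (rule integrable_mult_indep_set[where g="\<lambda>z. z i", OF space_F sets_F B I Qm[OF i] int c \<Delta>(1)[OF i]])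
    show "expectation (\<lambda>\<omega>. Q \<omega> i * \<Delta>B ?t ?t' \<omega> i) = 0"
      using expectation_mult_indep_set[where g="\<lambda>z. z i", OF space_F sets_F B I Qm[OF i] int c \<Delta>(1)[OF i]] \<Delta>(2)[OF i] by simp
  qed
  have eq: "(edist d (y (Suc k) \<omega>) (m ?t'))\<^sup>2
      = (enorm d (Q \<omega>))\<^sup>2 + 2 * \<sigma> * (\<Sum>i<d. Q \<omega> i * \<Delta>B ?t ?t' \<omega> i) + \<sigma>\<^sup>2 * (enorm d (\<Delta>B ?t ?t' \<omega>))\<^sup>2" for \<omega>
  proof -
    have "(edist d (y (Suc k) \<omega>) (m ?t'))\<^sup>2 = (\<Sum>i<d. (Q \<omega> i)\<^sup>2 + 2 * \<sigma> * (Q \<omega> i * \<Delta>B ?t ?t' \<omega> i) + \<sigma>\<^sup>2 * (\<Delta>B ?t ?t' \<omega> i)\<^sup>2)"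
      unfolding edist_power2 Q_def by (intro sum.cong refl) (simp add: power2_eq_square algebra_simps)
    then show ?thesis by (simp add: sum.distrib sum_distrib_left enorm_power2)
  qed
  have t0: "0 \<le> ?t" "?t \<le> ?t'" "?t' \<le> 1" using t by auto
  have ci: "integrable \<Omega> (\<lambda>\<omega>. \<Sum>i<d. Q \<omega> i * \<Delta>B ?t ?t' \<omega> i)"
    "expectation (\<lambda>\<omega>. \<Sum>i<d. Q \<omega> i * \<Delta>B ?t ?t' \<omega> i) = 0"
    using cross by (auto intro!: Bochner_Integration.integrable_sum simp del: of_nat_Suc)
  note \<Delta>2 = \<Delta>B_square_integrable[OF t0] \<Delta>B_square_expectation[OF t0]
  have "expectation (\<lambda>\<omega>. (edist d (y (Suc k) \<omega>) (m ?t'))\<^sup>2)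
      = expectation (\<lambda>\<omega>. (enorm d (Q \<omega>))\<^sup>2) + 2 / \<epsilon> * (real d * h)"
    unfolding eq using Qint ci \<Delta>2[unfolded t(4)] by (simp add: \<sigma>_power2 del: of_nat_Suc)
  also have "expectation (\<lambda>\<omega>. (enorm d (Q \<omega>))\<^sup>2) \<le> expectation (\<lambda>\<omega>. (1 - \<eta>) * ak \<omega> + ?C)"
    by (rule integral_mono[OF Qint bint Q_le])
  also have "\<dots> = (1 - \<eta>) * expectation ak + ?C" using IH by (simp add: prob_space)
  also have "\<dots> \<le> (1 - \<eta>) * A + ?C" using IH \<eta>(1,2) by (intro add_right_mono mult_left_mono) auto
  \<comment> \<open>Since \<eta> \<le> 1/2, the factor 1 + 1/\<eta> is at most 2/\<eta>. It costs
    one power of h, so the input per step is proportional to h, as is the Gaussian variance.\<close>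
  also have "?C \<le> 4 * h * \<epsilon> * S2 / K"
  proof -
    have "1 + 1 / \<eta> \<le> 2 / \<eta>" using \<eta>(1,2) by (simp add: field_simps)
    then have "?C \<le> 2 / \<eta> * (S2 * h\<^sup>2)" using S2_nonneg by (intro mult_right_mono) auto
    also have "\<dots> = 4 * h * \<epsilon> * S2 / K" using h_pos K_pos \<epsilon>_pos by (simp add: \<eta>_def field_simps power2_eq_square)
    finally show ?thesis .
  qed
  finally have "expectation (\<lambda>\<omega>. (edist d (y (Suc k) \<omega>) (m ?t'))\<^sup>2)
      \<le> (1 - \<eta>) * A + 4 * h * \<epsilon> * S2 / K + 2 / \<epsilon> * (real d * h)" by simp
  \<comment> \<open>The input equals \<eta> times the bracket in \<open>A\<close>, so the level
    \<open>A\<close> reproduces itself.\<close>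
  also have "4 * h * \<epsilon> * S2 / K + 2 / \<epsilon> * (real d * h) = \<eta> * (8 * \<epsilon>\<^sup>2 * S2 / K\<^sup>2 + 4 * real d / K)"
    using h_pos K_pos \<epsilon>_pos by (simp add: \<eta>_def field_simps power2_eq_square)
  then have "(1 - \<eta>) * A + 4 * h * \<epsilon> * S2 / K + 2 / \<epsilon> * (real d * h) \<le> (1 - \<eta>) * A + \<eta> * A"
  proof -
    assume e: "4 * h * \<epsilon> * S2 / K + 2 / \<epsilon> * (real d * h) = \<eta> * (8 * \<epsilon>\<^sup>2 * S2 / K\<^sup>2 + 4 * real d / K)"
    have "0 \<le> a\<^sub>0" unfolding a\<^sub>0_def by (rule Bochner_Integration.integral_nonneg) simp
    then have "\<eta> * (8 * \<epsilon>\<^sup>2 * S2 / K\<^sup>2 + 4 * real d / K) \<le> \<eta> * A"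
      unfolding A_def using \<eta>(1) by (intro mult_left_mono) auto
    with e show ?thesis by linarith
  qed
  finally have "expectation (\<lambda>\<omega>. (edist d (y (Suc k) \<omega>) (m ?t'))\<^sup>2) \<le> A" by (simp add: algebra_simps)
  moreover have "integrable \<Omega> (\<lambda>\<omega>. (edist d (y (Suc k) \<omega>) (m ?t'))\<^sup>2)"
    unfolding eq by (intro Bochner_Integration.integrable_add integrable_mult_right Qint ci \<Delta>2)
  ultimately show ?case by blast
qed

lemma A_nonneg: "0 \<le> A"
  using y_moment[of 0] Bochner_Integration.integral_nonneg[of \<Omega> "\<lambda>\<omega>. (edist d (y 0 \<omega>) (m (real 0 * h)))\<^sup>2"]
  by (meson le0 order_trans zero_le_power2)

text \<open>The three sources of discrepancy within one step: displacement of the scheme by its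
  gradient, its Brownian displacement, and the change of the potential in time.\<close>

definition G :: real where
  "G = 4 * L ^ 4 * (h / \<epsilon>)\<^sup>2 * A + 8 * L\<^sup>2 * h * real d / \<epsilon> + 2 * M\<^sup>2 * h\<^sup>2 * (1 + A)"

lemma G_nonneg: "0 \<le> G"
  using A_nonneg h_pos \<epsilon>_pos by (simp add: G_def)

text \<open>For \<open>k = n\<close>, after the last complete step, the Euler drift is zero and the
  whole gradient counts as error.\<close>

definition err :: "nat \<Rightarrow> real \<Rightarrow> 'a \<Rightarrow> nat \<Rightarrow> real" where
  "err k t \<omega> = (\<lambda>i. grad t (Y' t \<omega>) i - (if k < n then grad (real k * h) (y k \<omega>) i else 0))"

lemma err_adapted:
  assumes k: "k \<le> n" and t: "real k * h \<le> t" "t \<le> 1" and i: "i < d"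
  shows "(\<lambda>\<omega>. err k t \<omega> i) \<in> borel_measurable (F t)"
proof -
  have t01: "t \<in> {0..1}" using kh_mem[OF k] t by auto
  have "(\<lambda>\<omega>. grad t (Y' t \<omega>) i) \<in> borel_measurable (F t)"
    by (intro borel_measurable_grad t01 i Y'_adapted Y'_mem)
  moreover have "(\<lambda>\<omega>. grad (real k * h) (y k \<omega>) i) \<in> borel_measurable (F t)"
    by (rule measurable_F_mono[OF t(1) grad_y_adapted[OF k i]])
  ultimately show ?thesis by (simp add: err_def)
qed

text \<open>Everything since the last Euler time is expressed through the distance of
  \<open>y k\<close> to the minimiser and the Brownian increment, whose second moments are known.
  After the last complete step the gradient at the Euler time comes in addition, and splitting it
  off doubles \<open>G\<close>.\<close>

lemma err_moment:
  assumes k: "k \<le> n" and t: "real k * h \<le> t" "t \<le> (real k + 1) * h" "t \<le> 1"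
  shows "integrable \<Omega> (\<lambda>\<omega>. (enorm d (err k t \<omega>))\<^sup>2)"
    and "expectation (\<lambda>\<omega>. (enorm d (err k t \<omega>))\<^sup>2) \<le> G + (if k < n then 0 else G + 2 * L\<^sup>2 * A)"
proof -
  let ?s = "real k * h"
  have s01: "?s \<in> {0..1}" and t01: "t \<in> {0..1}" using kh_mem[OF k] t by auto
  have ts: "0 \<le> t - ?s" "t - ?s \<le> h" using t by (auto simp: algebra_simps)
  have s0: "0 \<le> ?s" using s01 by simp
  define ak where "ak \<omega> = (edist d (y k \<omega>) (m ?s))\<^sup>2" for \<omega>
  have ak: "integrable \<Omega> ak" "expectation ak \<le> A" using y_moment[OF k] by (auto simp: ak_def[abs_def])
  define b where "b \<omega> = (enorm d (\<Delta>B ?s t \<omega>))\<^sup>2" for \<omega>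
  have b: "integrable \<Omega> b" "expectation b = real d * (t - ?s)"
    using \<Delta>B_square[OF s0 t(1,3)] by (auto simp: b_def[abs_def])
  define D where "D \<omega> = 2 * L\<^sup>2 * (2 * ((h / \<epsilon>)\<^sup>2 * (L\<^sup>2 * ak \<omega>)) + 2 * (\<sigma>\<^sup>2 * b \<omega>)) + 2 * M\<^sup>2 * h\<^sup>2 * (1 + ak \<omega>)" for \<omega>
  have Dint: "integrable \<Omega> D" unfolding D_def using ak b by simp
  have ED: "expectation D \<le> G"
  proof -
    have "expectation D = 2 * L\<^sup>2 * (2 * ((h / \<epsilon>)\<^sup>2 * (L\<^sup>2 * expectation ak)) + 2 * (\<sigma>\<^sup>2 * (real d * (t - ?s)))) + 2 * M\<^sup>2 * h\<^sup>2 * (1 + expectation ak)"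
      unfolding D_def using ak b by (simp add: prob_space)
    also have "\<dots> \<le> 2 * L\<^sup>2 * (2 * ((h / \<epsilon>)\<^sup>2 * (L\<^sup>2 * A)) + 2 * (\<sigma>\<^sup>2 * (real d * h))) + 2 * M\<^sup>2 * h\<^sup>2 * (1 + A)"
      using ak(2) ts by (intro add_mono mult_left_mono order_refl) auto
    also have "\<dots> = G" unfolding \<sigma>_power2 G_def by (simp add: field_simps power4_eq_xxxx power2_eq_square)
    finally show ?thesis .
  qed
  have g2: "(enorm d (grad ?s (y k \<omega>)))\<^sup>2 \<le> L\<^sup>2 * ak \<omega>" if \<omega>: "\<omega> \<in> space \<Omega>" for \<omega>
    using power_mono[OF grad_growth[OF s01 y_mem[OF \<omega>]] enorm_nonneg, of k 2] by (simp add: ak_def power_mult_distrib)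
  have diff: "(enorm d (\<lambda>i. grad t (Y' t \<omega>) i - grad ?s (y k \<omega>) i))\<^sup>2 \<le> D \<omega>" if \<omega>: "\<omega> \<in> space \<Omega>" for \<omega>
  proof -
    let ?u = "\<lambda>i. - (if k < n then (t - ?s) / \<epsilon> * grad ?s (y k \<omega>) i else 0)"
    have "(edist d (Y' t \<omega>) (y k \<omega>))\<^sup>2 = (enorm d (\<lambda>i. ?u i + \<sigma> * \<Delta>B ?s t \<omega> i))\<^sup>2"
      unfolding edist_def using Y'_step[OF k t(1,2)] by (intro arg_cong[where f="\<lambda>x. x\<^sup>2"] enorm_cong) simp
    also have "\<dots> \<le> 2 * (enorm d ?u)\<^sup>2 + 2 * (enorm d (\<lambda>i. \<sigma> * \<Delta>B ?s t \<omega> i))\<^sup>2"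
      by (rule enorm_add_power2_le)
    also have "(enorm d ?u)\<^sup>2 \<le> (h / \<epsilon>)\<^sup>2 * (enorm d (grad ?s (y k \<omega>)))\<^sup>2"
    proof -
      have "(?u i)\<^sup>2 \<le> (h / \<epsilon>)\<^sup>2 * (grad ?s (y k \<omega>) i)\<^sup>2" for i
      proof -
        have "((t - ?s) / \<epsilon>)\<^sup>2 \<le> (h / \<epsilon>)\<^sup>2" using ts \<epsilon>_pos by (intro power_mono divide_right_mono) auto
        then have "((t - ?s) / \<epsilon>)\<^sup>2 * (grad ?s (y k \<omega>) i)\<^sup>2 \<le> (h / \<epsilon>)\<^sup>2 * (grad ?s (y k \<omega>) i)\<^sup>2"
          by (rule mult_right_mono) simp
        then show ?thesis by (simp only: power2_minus power_mult_distrib if_distrib[of "\<lambda>x. x\<^sup>2"] power_zero_numeral split: if_split) simp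
      qed
      then show ?thesis unfolding enorm_power2 sum_distrib_left by (intro sum_mono)
    qed
    also have "\<dots> \<le> (h / \<epsilon>)\<^sup>2 * (L\<^sup>2 * ak \<omega>)" by (intro mult_left_mono g2 \<omega>) simp
    also have "(enorm d (\<lambda>i. \<sigma> * \<Delta>B ?s t \<omega> i))\<^sup>2 = \<sigma>\<^sup>2 * b \<omega>"
      unfolding b_def enorm_power2 by (simp add: power_mult_distrib sum_distrib_left)
    finally have e: "(edist d (Y' t \<omega>) (y k \<omega>))\<^sup>2 \<le> 2 * ((h / \<epsilon>)\<^sup>2 * (L\<^sup>2 * ak \<omega>)) + 2 * (\<sigma>\<^sup>2 * b \<omega>)" by simp
    have "(enorm d (\<lambda>i. grad t (Y' t \<omega>) i - grad ?s (y k \<omega>) i))\<^sup>2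
        \<le> 2 * L\<^sup>2 * (edist d (Y' t \<omega>) (y k \<omega>))\<^sup>2 + 2 * M\<^sup>2 * (t - ?s)\<^sup>2 * (1 + (edist d (y k \<omega>) (m ?s))\<^sup>2)"
      by (rule grad_diff_power2_le[OF t01 s01 t(1) Y'_mem y_mem[OF \<omega>]])
    also have "\<dots> \<le> D \<omega>"
      unfolding D_def ak_def[symmetric] using e ts
      by (intro add_mono mult_left_mono mult_right_mono power_mono) (auto simp: ak_def)
    finally show ?thesis .
  qed
  have bound: "(enorm d (err k t \<omega>))\<^sup>2 \<le> (if k < n then D \<omega> else 2 * D \<omega> + 2 * (L\<^sup>2 * ak \<omega>))" if \<omega>: "\<omega> \<in> space \<Omega>" for \<omega>
  proof (cases "k < n")
    case True
    then show ?thesis using diff[OF \<omega>] by (simp add: err_def)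
  next
    case False
    have "(enorm d (err k t \<omega>))\<^sup>2 = (enorm d (\<lambda>i. (grad t (Y' t \<omega>) i - grad ?s (y k \<omega>) i) + grad ?s (y k \<omega>) i))\<^sup>2"
      using False by (simp add: err_def)
    also have "\<dots> \<le> 2 * (enorm d (\<lambda>i. grad t (Y' t \<omega>) i - grad ?s (y k \<omega>) i))\<^sup>2 + 2 * (enorm d (grad ?s (y k \<omega>)))\<^sup>2"
      by (rule enorm_add_power2_le)
    also have "\<dots> \<le> 2 * D \<omega> + 2 * (L\<^sup>2 * ak \<omega>)" by (intro add_mono mult_left_mono diff g2 \<omega>) auto
    finally show ?thesis using False by simp
  qed
  have bint: "integrable \<Omega> (\<lambda>\<omega>. if k < n then D \<omega> else 2 * D \<omega> + 2 * (L\<^sup>2 * ak \<omega>))"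
    using Dint ak by (cases "k < n") simp_all
  show int: "integrable \<Omega> (\<lambda>\<omega>. (enorm d (err k t \<omega>))\<^sup>2)"
    by (rule Bochner_Integration.integrable_bound[OF bint
          borel_measurable_enorm_power2[OF measurable_F_\<Omega>[OF err_adapted[OF k t(1,3)]]] AE_I2])
       (use order_trans[OF bound abs_ge_self] in simp_all)
  have "expectation (\<lambda>\<omega>. (enorm d (err k t \<omega>))\<^sup>2) \<le> expectation (\<lambda>\<omega>. if k < n then D \<omega> else 2 * D \<omega> + 2 * (L\<^sup>2 * ak \<omega>))"
    by (rule integral_mono[OF int bint bound])
  also have "\<dots> \<le> G + (if k < n then 0 else G + 2 * L\<^sup>2 * A)"
  proof (cases "k < n")
    case True
    then show ?thesis using ED by simp
  next
    case False
    have "L\<^sup>2 * expectation ak \<le> L\<^sup>2 * A" using ak(2) by (rule mult_left_mono) simp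
    then show ?thesis using False ED ak Dint by simp
  qed
  finally show "expectation (\<lambda>\<omega>. (enorm d (err k t \<omega>))\<^sup>2) \<le> G + (if k < n then 0 else G + 2 * L\<^sup>2 * A)" .
qed

end

section \<open>Change of measure on fine grids\<close>

text \<open>A uniform mesh of width at most \<delta> is merged with \<open>P\<close>, and the union
  is sorted.\<close>

lemma ex_partition:
  fixes P :: "real set"
  assumes P: "finite P" "P \<subseteq> {0..1}" and \<delta>: "0 < \<delta>"
  shows "\<exists>t N. t 0 = 0 \<and> t N = 1 \<and> (\<forall>j<N. t j < t (Suc j) \<and> t (Suc j) - t j \<le> \<delta>) \<and> P \<subseteq> t ` {..N}"
proof -
  obtain q where q: "1 / \<delta> < real q" using reals_Archimedean2 by blast
  have "0 < 1 / \<delta>" using \<delta> by simp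
  with q have q0: "0 < q" by (metis less_trans of_nat_0_less_iff)
  have q\<delta>: "1 / real q \<le> \<delta>" using q q0 \<delta> by (simp add: field_simps)
  define Q where "Q = P \<union> (\<lambda>i. real i / real q) ` {..q}"
  have Q: "finite Q" "Q \<subseteq> {0..1}" using P q0 by (auto simp: Q_def divide_le_eq)
  have "real 0 / real q \<in> Q" "real q / real q \<in> Q" unfolding Q_def by blast+
  then have Q01: "0 \<in> Q" "1 \<in> Q" using q0 by auto
  define xs where "xs = sorted_list_of_set Q"
  have xs: "set xs = Q" "sorted_wrt (<) xs" using Q by (auto simp: xs_def)
  define N where "N = length xs - 1"
  have len: "length xs = Suc N" using xs(1) Q01 by (cases xs) (auto simp: N_def)
  have less: "xs ! i < xs ! j" if "i < j" "j \<le> N" for i j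
    using sorted_wrt_nth_less[OF xs(2)] that len by auto
  have le: "xs ! i \<le> xs ! j" if "i \<le> j" "j \<le> N" for i j
    using less[of i j] that by (cases "i = j") auto
  have mem: "\<exists>j\<le>N. xs ! j = x" if "x \<in> Q" for x
    using that len unfolding xs(1)[symmetric] in_set_conv_nth by (auto simp: less_Suc_eq_le)
  have inQ: "xs ! j \<in> Q" if "j \<le> N" for j using that len unfolding xs(1)[symmetric] by simp
  have "xs ! 0 = 0"
  proof -
    obtain j where "j \<le> N" "xs ! j = 0" using mem[OF Q01(1)] by blast
    then show ?thesis using le[of 0 j] inQ[of 0] Q(2) by force
  qed
  moreover have "xs ! N = 1"
  proof -
    obtain j where "j \<le> N" "xs ! j = 1" using mem[OF Q01(2)] by blast
    then show ?thesis using le[of j N] inQ[of N] Q(2) by force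
  qed
  moreover have "xs ! Suc j - xs ! j \<le> \<delta>" if j: "j < N" for j
  proof -
    have x: "0 \<le> xs ! j" "xs ! j < 1" using inQ[of j] Q(2) less[of j N] j \<open>xs ! N = 1\<close> by auto
    \<comment> \<open>The uniform mesh cell containing the current point; its right end point
      belongs to \<open>Q\<close> and lies strictly beyond, so the next sorted point cannot be
      farther.\<close>
    define i where "i = nat \<lfloor>xs ! j * real q\<rfloor>"
    have i: "real i \<le> xs ! j * real q" "xs ! j * real q < real i + 1"
      using x by (auto simp: i_def)
    have "xs ! j * real q < 1 * real q" using x q0 by (intro mult_strict_right_mono) auto
    with i have "real i < real q" by linarith
    then have "Suc i \<le> q" by simp
    then have "real (Suc i) / real q \<in> Q" unfolding Q_def by blast
    then obtain l where l: "l \<le> N" "xs ! l = real (Suc i) / real q" using mem by blast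
    have "xs ! j < real (Suc i) / real q" using i q0 by (simp add: field_simps)
    then have "j < l" using l le[of l j] j by (metis less_imp_le_nat not_le)
    then have "xs ! Suc j \<le> real (Suc i) / real q" using le[of "Suc j" l] l by simp
    also have "\<dots> \<le> xs ! j + 1 / real q" using i q0 by (simp add: field_simps)
    finally show ?thesis using q\<delta> by linarith
  qed
  moreover have "P \<subseteq> (\<lambda>j. xs ! j) ` {..N}"
  proof
    fix x assume "x \<in> P"
    then have "x \<in> Q" by (simp add: Q_def)
    then show "x \<in> (\<lambda>j. xs ! j) ` {..N}" using mem by blast
  qed
  ultimately show ?thesis using less by (intro exI[of _ "\<lambda>j. xs ! j"] exI[of _ N]) auto
qed

section \<open>Pathwise convergence of the fine discretisation\<close>

context langevin_euler
begin

text \<open>Kept deterministic in the initial value and the noise, so that the unshifted and the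
  shifted increments can be inserted into one and the same map.\<close>

primrec eul :: "(nat \<Rightarrow> real) \<Rightarrow> nat \<Rightarrow> (nat \<Rightarrow> real) \<Rightarrow> (nat \<Rightarrow> nat \<Rightarrow> real) \<Rightarrow> nat \<Rightarrow> real" where
  "eul t 0 x w = x"
| "eul t (Suc j) x w = (\<lambda>i. if i < d then eul t j x w i - (t (Suc j) - t j) / \<epsilon> * grad (t j) (eul t j x w) i + \<sigma> * w j i else 0)"

lemma eul_mem: "x \<in> Rd d \<Longrightarrow> eul t j x w \<in> Rd d"
  by (cases j) (auto simp: Rd_iff[of "\<lambda>i. if i < d then _ i else _"])

text \<open>The Lebesgue integral in the equation is exchanged for the gauge integral, whose
  additivity over adjacent intervals gives the increment; continuity of the gradient along the path
  makes the two agree.\<close>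

lemma path_increment:
  assumes \<omega>: "\<omega> \<in> space \<Omega>" and eq: "path_eq d \<epsilon> (langevin_drift U (X \<omega>)) (X\<^sub>0 \<omega>) (B \<omega>) (X \<omega>)"
    and s: "0 \<le> s" "s \<le> t" "t \<le> 1" and i: "i < d"
  shows "X \<omega> t i = X \<omega> s i - 1 / \<epsilon> * integral {s..t} (\<lambda>r. grad r (X \<omega> r) i) + \<sigma> * \<Delta>B s t \<omega> i"
proof -
  have c: "continuous_on {0..1} (\<lambda>r. grad r (X \<omega> r) i)"
    using X_mem[OF \<omega>] unfolding mem_path_metric by (intro continuous_on_grad_path i) auto
  have I: "(LBINT r:{0..u}. langevin_drift U (X \<omega>) r i) = integral {0..u} (\<lambda>r. grad r (X \<omega> r) i)"
    if "u \<le> 1" for u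
  proof -
    have "continuous_on {0..u} (\<lambda>r. grad r (X \<omega> r) i)" using c that by (rule_tac continuous_on_subset) auto
    then have "set_integrable lborel {0..u} (\<lambda>r. grad r (X \<omega> r) i)" by (rule borel_integrable_atLeastAtMost')
    from set_borel_integral_eq_integral(2)[OF this] show ?thesis by (simp add: langevin_drift_def)
  qed
  have "(\<lambda>r. grad r (X \<omega> r) i) integrable_on {0..t}"
    by (rule integrable_continuous_real[OF continuous_on_subset[OF c]]) (use s in auto)
  from Henstock_Kurzweil_Integration.integral_combine[OF s(1,2) this]
  have I2: "integral {0..t} (\<lambda>r. grad r (X \<omega> r) i) = integral {0..s} (\<lambda>r. grad r (X \<omega> r) i) + integral {s..t} (\<lambda>r. grad r (X \<omega> r) i)"
    by simp
  have XE: "X \<omega> u i = X\<^sub>0 \<omega> i - 1 / \<epsilon> * integral {0..u} (\<lambda>r. grad r (X \<omega> r) i) + \<sigma> * B \<omega> u i"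
    if "0 \<le> u" "u \<le> 1" for u
    using eq i that by (simp add: path_eq_def I \<sigma>_def)
  have "X \<omega> s i = X\<^sub>0 \<omega> i - 1 / \<epsilon> * integral {0..s} (\<lambda>r. grad r (X \<omega> r) i) + \<sigma> * B \<omega> s i"
    using s by (intro XE) auto
  moreover have "X \<omega> t i = X\<^sub>0 \<omega> i - 1 / \<epsilon> * integral {0..t} (\<lambda>r. grad r (X \<omega> r) i) + \<sigma> * B \<omega> t i"
    using s by (intro XE) auto
  ultimately show ?thesis
    using I2 i by (simp add: \<Delta>B_def algebra_simps add_divide_distrib)
qed

text \<open>The same noise increments enter on both sides and cancel. What remains is a discrete
  Gronwall argument driven by the uniform continuity of the gradient along the path; the mesh width
  may depend on the path, but not on the grid.\<close>

lemma eul_converges: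
  assumes \<omega>: "\<omega> \<in> space \<Omega>" and eq: "path_eq d \<epsilon> (langevin_drift U (X \<omega>)) (X\<^sub>0 \<omega>) (B \<omega>) (X \<omega>)"
    and B0: "B \<omega> 0 = (\<lambda>_. 0)" and e: "0 < e"
  shows "\<exists>\<delta>>0. \<forall>t N. t 0 = 0 \<and> t N = 1 \<and> (\<forall>j<N. t j < t (Suc j) \<and> t (Suc j) - t j \<le> \<delta>) \<longrightarrow>
    (\<forall>j\<le>N. \<forall>i<d. \<bar>eul t j (X\<^sub>0 \<omega>) (\<lambda>j. \<Delta>B (t j) (t (Suc j)) \<omega>) i - X \<omega> (t j) i\<bar> \<le> e)"
proof -
  \<comment> \<open>Errors are measured in the sum norm, and each of the \<open>d\<close>
    coordinates inherits at most L times the error: this gives the rate \<open>C\<close>. The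
    tolerance \<open>e'\<close> is chosen so that the final bound \<open>D * exp C\<close> is
    exactly \<open>e\<close>.\<close>
  define C where "C = real d * L / \<epsilon>"
  define e' where "e' = e * \<epsilon> / (real d * exp C)"
  define D where "D = real d * e' / \<epsilon>"
  have d0: "0 < real d" using d_pos by simp
  have C0: "0 \<le> C" using L_pos \<epsilon>_pos by (simp add: C_def)
  have e': "0 < e'" using e \<epsilon>_pos d0 by (simp add: e'_def)
  have "0 \<le> D" unfolding D_def using e' \<epsilon>_pos by simp
  moreover have "D * exp C = e" using \<epsilon>_pos d0 by (simp add: D_def e'_def)
  ultimately have D: "0 \<le> D" "D * exp C = e" by auto
  have XRd: "X \<omega> r \<in> Rd d" if "r \<in> {0..1}" for r
    using X_mem[OF \<omega>] that unfolding mem_path_metric by auto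
  have c: "continuous_on {0..1} (\<lambda>r. grad r (X \<omega> r) i)" if "i < d" for i
    using X_mem[OF \<omega>] that unfolding mem_path_metric by (intro continuous_on_grad_path) auto
  have "\<exists>\<delta>>0. \<forall>r\<in>{0..1}. \<forall>s\<in>{0..1}. dist r s < \<delta> \<longrightarrow> dist (grad r (X \<omega> r) i) (grad s (X \<omega> s) i) < e'" if "i < d" for i
    using compact_uniformly_continuous[OF c[OF that] compact_Icc] e' unfolding uniformly_continuous_on_def by blast
  then obtain \<Delta> where \<Delta>: "\<And>i. i < d \<Longrightarrow> 0 < \<Delta> i"
    "\<And>i r s. i < d \<Longrightarrow> r \<in> {0..1} \<Longrightarrow> s \<in> {0..1} \<Longrightarrow> dist r s < \<Delta> i \<Longrightarrow> dist (grad r (X \<omega> r) i) (grad s (X \<omega> s) i) < e'"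
    by metis
  \<comment> \<open>Halving makes the mesh strictly smaller than each modulus of continuity.\<close>
  define \<delta> where "\<delta> = Min (insert 1 (\<Delta> ` {..<d})) / 2"
  have \<delta>: "0 < \<delta>" using \<Delta>(1) by (simp add: \<delta>_def)
  have \<delta>\<Delta>: "\<delta> < \<Delta> i" if "i < d" for i
  proof -
    have "Min (insert 1 (\<Delta> ` {..<d})) \<le> \<Delta> i" using that by (intro Min_le) auto
    then show ?thesis using \<delta> unfolding \<delta>_def by linarith
  qed
  show ?thesis
  proof (intro exI[of _ \<delta>] conjI allI impI \<delta>)
    fix t :: "nat \<Rightarrow> real" and N j i
    assume tN: "t 0 = 0 \<and> t N = 1 \<and> (\<forall>j<N. t j < t (Suc j) \<and> t (Suc j) - t j \<le> \<delta>)" and j: "j \<le> N" and i: "i < d"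
    have mono: "t a \<le> t b" if "a \<le> b" "b \<le> N" for a b
      using that
    proof (induction b rule: dec_induct)
      case (step b)
      have "t b < t (Suc b)" using tN step by auto
      with step show ?case by simp
    qed simp
    have t01: "t a \<in> {0..1}" if "a \<le> N" for a using mono[of 0 a] mono[of a N] that tN by auto
    let ?w = "\<lambda>j. \<Delta>B (t j) (t (Suc j)) \<omega>"
    define x where "x j = eul t j (X\<^sub>0 \<omega>) ?w" for j
    have xRd: "x j \<in> Rd d" for j unfolding x_def by (rule eul_mem[OF X\<^sub>0_mem[OF \<omega>]])
    define E where "E j = (\<Sum>i<d. \<bar>x j i - X \<omega> (t j) i\<bar>)" for j
    \<comment> \<open>Stated with the time \<open>t j\<close> in place of the number of steps, the
      bound is uniform over all grids.\<close>
    have "E j \<le> D * t j * exp (C * t j)" using j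
    proof (induction j)
      case 0
      have z: "(LBINT s:{0..0}. g s) = 0" for g :: "real \<Rightarrow> real"
        unfolding set_lebesgue_integral_def
        by (rule integral_eq_zero_AE, use AE_lborel_singleton[of 0] in eventually_elim) simp
      have "X \<omega> 0 i = X\<^sub>0 \<omega> i - 1 / \<epsilon> * (LBINT s:{0..0}. langevin_drift U (X \<omega>) s i) + sqrt (2 / \<epsilon>) * B \<omega> 0 i"
        if "i < d" for i
        using eq that unfolding path_eq_def by auto
      then have "X \<omega> 0 i = X\<^sub>0 \<omega> i" if "i < d" for i
        unfolding z B0 using that by simp
      then show ?case using tN by (simp add: E_def x_def)
    next
      case (Suc j)
      let ?\<delta> = "t (Suc j) - t j"
      have j: "t j \<in> {0..1}" "t (Suc j) \<in> {0..1}" "0 \<le> ?\<delta>" "?\<delta> \<le> \<delta>" "t j \<le> t (Suc j)"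
        using t01[of j] t01[of "Suc j"] tN Suc.prems by (auto simp: less_imp_le)
      have step: "\<bar>x (Suc j) i - X \<omega> (t (Suc j)) i\<bar> \<le> \<bar>x j i - X \<omega> (t j) i\<bar> + ?\<delta> / \<epsilon> * (L * E j) + ?\<delta> / \<epsilon> * e'"
        if i: "i < d" for i
      proof -
        let ?g = "\<lambda>r. grad r (X \<omega> r) i"
        let ?I = "integral {t j..t (Suc j)} (\<lambda>r. ?g r - ?g (t j))"
        have cj: "continuous_on {t j..t (Suc j)} ?g" by (rule continuous_on_subset[OF c[OF i]]) (use j in auto)
        have I: "integral {t j..t (Suc j)} ?g = ?I + ?\<delta> * ?g (t j)"
        proof -
          have "?I = integral {t j..t (Suc j)} ?g - integral {t j..t (Suc j)} (\<lambda>_. ?g (t j))"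
            by (rule Henstock_Kurzweil_Integration.integral_diff)
               (intro integrable_continuous_real cj continuous_on_const)+
          then show ?thesis using j by simp
        qed
        have "norm ?I \<le> e' * ?\<delta>"
        proof (rule integral_bound[OF j(5)])
          show "continuous_on {t j..t (Suc j)} (\<lambda>r. ?g r - ?g (t j))" by (intro continuous_intros cj)
          fix r assume r: "r \<in> {t j..t (Suc j)}"
          then have "dist r (t j) < \<Delta> i" using j(4) \<delta>\<Delta>[OF i] by (auto simp: dist_real_def)
          from \<Delta>(2)[OF i _ j(1) this] show "norm (?g r - ?g (t j)) \<le> e'" using r j by (auto simp: dist_norm)
        qed
        then have Ie: "\<bar>1 / \<epsilon> * ?I\<bar> \<le> ?\<delta> / \<epsilon> * e'" using \<epsilon>_pos by (simp add: abs_mult field_simps)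
        have "\<bar>grad (t j) (x j) i - ?g (t j)\<bar> \<le> L * edist d (x j) (X \<omega> (t j))"
          by (rule order_trans[OF abs_le_enorm[OF i, of "\<lambda>i. grad (t j) (x j) i - grad (t j) (X \<omega> (t j)) i"]
                grad_Lipschitz[OF j(1) xRd XRd[OF j(1)]]])
        also have "\<dots> \<le> L * E j" unfolding E_def edist_def using L_pos by (intro mult_left_mono enorm_le_sum) auto
        finally have g: "\<bar>?\<delta> / \<epsilon> * (grad (t j) (x j) i - ?g (t j))\<bar> \<le> ?\<delta> / \<epsilon> * (L * E j)"
          using j(3) \<epsilon>_pos by (simp add: abs_mult mult_left_mono divide_right_mono)
        have "x (Suc j) i - X \<omega> (t (Suc j)) i
            = (x j i - X \<omega> (t j) i) - ?\<delta> / \<epsilon> * (grad (t j) (x j) i - ?g (t j)) + 1 / \<epsilon> * ?I"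
          using path_increment[OF \<omega> eq _ j(5) _ i] j i \<epsilon>_pos
          by (simp add: x_def I add_divide_distrib diff_divide_distrib algebra_simps)
        with Ie g show ?thesis by linarith
      qed
      have "E (Suc j) \<le> (\<Sum>i<d. \<bar>x j i - X \<omega> (t j) i\<bar> + ?\<delta> / \<epsilon> * (L * E j) + ?\<delta> / \<epsilon> * e')"
        unfolding E_def[of "Suc j"] by (intro sum_mono step) auto
      also have "\<dots> = (1 + C * ?\<delta>) * E j + D * ?\<delta>"
        unfolding sum.distrib E_def[of j, symmetric] using \<epsilon>_pos by (simp add: C_def D_def field_simps)
      also have "\<dots> \<le> exp (C * ?\<delta>) * (D * t j * exp (C * t j)) + D * ?\<delta>"
        using Suc j C0 D by (intro add_right_mono mult_mono exp_ge_add_one_self)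
           (auto simp: E_def sum_nonneg)
      also have "\<dots> = D * t j * exp (C * t (Suc j)) + D * ?\<delta>"
        by (simp add: algebra_simps flip: exp_add)
      also have "D * ?\<delta> \<le> D * ?\<delta> * exp (C * t (Suc j))"
      proof -
        have "1 \<le> exp (C * t (Suc j))" using C0 j(2) by simp
        then have "D * ?\<delta> * 1 \<le> D * ?\<delta> * exp (C * t (Suc j))" using D(1) j(3) by (intro mult_left_mono) auto
        then show ?thesis by simp
      qed
      finally show ?case by (simp add: algebra_simps)
    qed
    also have "\<dots> \<le> D * 1 * exp (C * 1)"
      using t01[OF j] D C0 by (intro mult_mono mult_left_mono) (auto intro: mult_left_le)
    finally have "E j \<le> e" using D by simp
    moreover have "\<bar>x j i - X \<omega> (t j) i\<bar> \<le> E j"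
      unfolding E_def using i by (intro member_le_sum) auto
    ultimately show "\<bar>eul t j (X\<^sub>0 \<omega>) ?w i - X \<omega> (t j) i\<bar> \<le> e" by (simp add: x_def)
  qed
qed

end

lemma path_evaluation_measurable:
  assumes Z: "Z \<in> N \<rightarrow>\<^sub>M path_borel d" and s: "s \<in> {0..1}"
  shows "(\<lambda>\<omega>. Z \<omega> s i) \<in> borel_measurable N"
proof (rule measurable_compose[OF Z])
  interpret PM: Metric_space "mspace (path_metric d)" "mdist (path_metric d)" by (rule Metric_space_mspace_mdist)
  have "continuous_map (mtopology_of (path_metric d)) euclideanreal (\<lambda>x. x s i)"
    unfolding mtopology_of_def
  proof (rule PM.Lipschitz_continuous_map[where c=1])
    fix x y assume xy: "x \<in> mspace (path_metric d)" "y \<in> mspace (path_metric d)"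
    have "edist d (x s) (y s) \<le> mdist (path_metric d) x y"
      using mdist_cfunspace_imp_mdist_le[OF xy order_refl, of s] s by simp
    moreover have "\<bar>x s i - y s i\<bar> \<le> edist d (x s) (y s)"
    proof (cases "i < d")
      case True
      then show ?thesis using abs_le_enorm[OF True, of "\<lambda>i. x s i - y s i"] by (simp add: edist_def)
    next
      case False
      then show ?thesis using xy s unfolding mem_path_metric by (simp add: Rd_iff)
    qed
    ultimately show "\<bar>x s i - y s i\<bar> \<le> 1 * mdist (path_metric d) x y" by simp
  qed
  then show "(\<lambda>x. x s i) \<in> borel_measurable (path_borel d)"
    unfolding path_borel_def by (rule borel_measurable_continuous_map)
qed

text \<open>A discrepancy e over a time span \<delta> requires a Gaussian shift that costs \<delta>
  e^2 / (4 \<epsilon>). Every grid step contributes \<open>G\<close> per unit time; the stretch of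
  length at most h after the last Euler step adds h (G + 2 L^2 A), and h \<le> 1 merges the two
  copies of \<open>G\<close>.\<close>

definition (in langevin_euler_small_step) KL_bound :: real where
  "KL_bound = (2 * G + 2 * h * L\<^sup>2 * A) / (4 * \<epsilon>)"

section \<open>Girsanov comparison on a fixed grid\<close>

locale langevin_euler_grid = langevin_euler_small_step +
  fixes t :: "nat \<Rightarrow> real" and N :: nat
  assumes t_0: "t 0 = 0" and t_N: "t N = 1" and t_less: "\<And>j. j < N \<Longrightarrow> t j < t (Suc j)"
    and coarse: "\<And>k. k \<le> n \<Longrightarrow> real k * h \<in> t ` {..N}"
begin

lemma t_mono: "a \<le> b \<Longrightarrow> b \<le> N \<Longrightarrow> t a \<le> t b"
  by (induction b rule: dec_induct) (auto intro: order_trans[OF _ less_imp_le[OF t_less]])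

lemma t_mem: "j \<le> N \<Longrightarrow> t j \<in> {0..1}"
  using t_mono[of 0 j] t_mono[of j N] t_0 t_N by auto

definition cell :: "nat \<Rightarrow> nat" where
  "cell j = Max {k. k \<le> n \<and> real k * h \<le> t j}"

text \<open>No grid step straddles an Euler time: the next Euler time is itself a grid point, and
  after the last one the bound 1 < (n + 1) h takes over.\<close>

lemma cell:
  assumes j: "j < N"
  shows "cell j \<le> n" "real (cell j) * h \<le> t j" "t (Suc j) \<le> (real (cell j) + 1) * h"
proof -
  let ?S = "{k. k \<le> n \<and> real k * h \<le> t j}"
  have fin: "finite ?S" by (rule finite_subset[of _ "{..n}"]) auto
  have "0 \<in> ?S" using t_mem[of j] j by auto
  then have "cell j \<in> ?S" unfolding cell_def using Max_in[OF fin] by blast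
  then show c: "cell j \<le> n" "real (cell j) * h \<le> t j" by auto
  show "t (Suc j) \<le> (real (cell j) + 1) * h"
  proof (cases "cell j = n")
    case True
    then show ?thesis using n_h_gt t_mem[of "Suc j"] j by auto
  next
    case False
    then have sc: "Suc (cell j) \<le> n" using c by simp
    have "Suc (cell j) \<le> cell j" if "Suc (cell j) \<in> ?S"
      using Max_ge[OF fin that] by (simp only: cell_def)
    then have "Suc (cell j) \<notin> ?S" by (metis Suc_n_not_le_n)
    then have l: "t j < real (Suc (cell j)) * h" using sc by auto
    obtain l where "l \<le> N" "t l = real (Suc (cell j)) * h" using coarse[OF sc] by auto
    with l have "\<not> l \<le> j" using t_mono[of l j] j by auto
    then have "t (Suc j) \<le> t l" using t_mono[of "Suc j" l] \<open>l \<le> N\<close> by simp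
    then show ?thesis using \<open>t l = _\<close> by (simp add: add.commute)
  qed
qed

abbreviation \<delta> :: "nat \<Rightarrow> real" where "\<delta> j \<equiv> t (Suc j) - t j"

text \<open>Scaled so that \<sigma> times the shift is the drift discrepancy over the grid step,
  \<open>\<delta> j / \<epsilon>\<close> times \<open>err\<close>. The error is taken at the left
  end point, which makes the shift predictable.\<close>

definition v :: "nat \<Rightarrow> 'a \<Rightarrow> nat \<Rightarrow> real" where
  "v j \<omega> = (\<lambda>i. \<delta> j / (\<epsilon> * \<sigma>) * err (cell j) (t j) \<omega> i)"

lemma \<delta>_pos: "j < N \<Longrightarrow> 0 < \<delta> j"
  using t_less by simp

lemma grid_step: "j < N \<Longrightarrow> 0 \<le> t j \<and> t j < t (Suc j) \<and> t (Suc j) \<le> 1"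
  using t_mem[of j] t_mem[of "Suc j"] t_less[of j] by auto

lemma discrete_girsanov:
  "discrete_girsanov \<Omega> N d (\<lambda>j. F (t j)) (\<lambda>j. \<Delta>B (t j) (t (Suc j))) v (\<lambda>j. sqrt (\<delta> j))"
proof unfold_locales
  fix j assume j: "j < N"
  note s = grid_step[OF j]
  show "\<Delta>B (t j) (t (Suc j)) \<in> F (t (Suc j)) \<rightarrow>\<^sub>M PiM {..<d} (\<lambda>_. borel)"
    by (rule \<Delta>B_adapted) (use s in auto)
  show "indep_set (sets (F (t j))) (sets (vimage_algebra (space \<Omega>) (\<Delta>B (t j) (t (Suc j))) (PiM {..<d} (\<lambda>_. borel))))"
    by (rule \<Delta>B_indep) (use s in auto)
  show "distr \<Omega> (PiM {..<d} (\<lambda>_. borel)) (\<Delta>B (t j) (t (Suc j))) = PiM {..<d} (\<lambda>_. gauss (sqrt (\<delta> j)))"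
    by (rule \<Delta>B_distr) (use s in auto)
  show "(\<lambda>\<omega>. v j \<omega> i) \<in> borel_measurable (F (t j))" if "i < d" for i
    unfolding v_def using err_adapted[OF cell(1,2)[OF j] _ that] s by simp
qed (use \<delta>_pos sets_F F_mono t_mono in \<open>auto simp: space_F\<close>)

sublocale girsanov: discrete_girsanov \<Omega> N d "\<lambda>j. F (t j)" "\<lambda>j. \<Delta>B (t j) (t (Suc j))" v "\<lambda>j. sqrt (\<delta> j)"
  by (rule discrete_girsanov)

lemma Y'_increment:
  assumes j: "j < N" and i: "i < d"
  shows "Y' (t (Suc j)) \<omega> i = Y' (t j) \<omega> i - \<delta> j / \<epsilon> * grad (t j) (Y' (t j) \<omega>) i
    + \<sigma> * (\<Delta>B (t j) (t (Suc j)) \<omega> i + v j \<omega> i)"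
proof -
  let ?k = "cell j"
  have le: "real ?k * h \<le> t j" "t j \<le> (real ?k + 1) * h" "real ?k * h \<le> t (Suc j)" "t (Suc j) \<le> (real ?k + 1) * h"
    using cell[OF j] t_less[OF j] by auto
  have "\<sigma> * v j \<omega> i = \<delta> j / \<epsilon> * err ?k (t j) \<omega> i" using \<sigma>_pos by (simp add: v_def)
  then show ?thesis
    using Y'_step[OF cell(1)[OF j] le(1,2) i, of \<omega>] Y'_step[OF cell(1)[OF j] le(3,4) i, of \<omega>] i
    by (cases "?k < n") (simp_all add: err_def \<Delta>B_def algebra_simps diff_divide_distrib)
qed

lemma eul_shifted:
  "\<omega> \<in> space \<Omega> \<Longrightarrow> j \<le> N \<Longrightarrow> eul t j (X\<^sub>0 \<omega>) (\<lambda>j\<in>{..<N}. girsanov.shifted j \<omega>) = Y' (t j) \<omega>"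
proof (induction j)
  case 0
  then show ?case using Y'_grid[of 0 \<omega>] by (simp add: t_0)
next
  case (Suc j)
  then have j: "j < N" by simp
  have IH: "eul t j (X\<^sub>0 \<omega>) (\<lambda>j\<in>{..<N}. girsanov.shifted j \<omega>) = Y' (t j) \<omega>"
    by (rule Suc.IH) (use Suc.prems in auto)
  show ?case
  proof
    fix i
    show "eul t (Suc j) (X\<^sub>0 \<omega>) (\<lambda>j\<in>{..<N}. girsanov.shifted j \<omega>) i = Y' (t (Suc j)) \<omega> i"
    proof (cases "i < d")
      case True
      have "(\<lambda>j\<in>{..<N}. girsanov.shifted j \<omega>) j i = \<Delta>B (t j) (t (Suc j)) \<omega> i + v j \<omega> i"
        using j True by (simp add: girsanov.shifted_def)
      then show ?thesis using True by (simp only: eul.simps IH Y'_increment[OF j True] if_True)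
    next
      case False
      then show ?thesis by (simp add: Y'_def)
    qed
  qed
qed

lemma eul_restrict: "j \<le> N \<Longrightarrow> eul t j x (\<lambda>j\<in>{..<N}. w j) = eul t j x w"
proof (induction j)
  case (Suc j)
  have "eul t j x (\<lambda>j\<in>{..<N}. w j) = eul t j x w" by (rule Suc.IH) (use Suc.prems in auto)
  moreover have "(\<lambda>j\<in>{..<N}. w j) j = w j" using Suc.prems by simp
  ultimately show ?case by (simp only: eul.simps)
qed simp

lemma eul_measurable:
  assumes "j \<le> N" "i < d"
  shows "(\<lambda>p. eul t j (X\<^sub>0 (fst p)) (snd p) i) \<in> borel_measurable (F (t 0) \<Otimes>\<^sub>M PiM {..<N} (\<lambda>_. PiM {..<d} (\<lambda>_. borel)))"
  using assms
proof (induction j arbitrary: i)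
  case 0
  then show ?case using measurable_compose[OF measurable_fst X\<^sub>0_adapted[of i]] by (simp add: t_0)
next
  case (Suc j)
  let ?P = "F (t 0) \<Otimes>\<^sub>M PiM {..<N} (\<lambda>_. PiM {..<d} (\<lambda>_. borel :: real measure))"
  have "(\<lambda>p. grad (t j) (eul t j (X\<^sub>0 (fst p)) (snd p)) i) \<in> borel_measurable ?P"
    by (intro borel_measurable_grad Suc.IH t_mem eul_mem X\<^sub>0_mem)
       (use Suc.prems in \<open>auto simp: space_pair_measure space_F\<close>)
  moreover have "(\<lambda>p. snd p j i) \<in> borel_measurable ?P"
  proof -
    have "(\<lambda>w. w j) \<in> PiM {..<N} (\<lambda>_. PiM {..<d} (\<lambda>_. borel)) \<rightarrow>\<^sub>M PiM {..<d} (\<lambda>_. borel :: real measure)"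
      using Suc.prems by (intro measurable_component_singleton) auto
    moreover have "(\<lambda>z. z i) \<in> PiM {..<d} (\<lambda>_. borel) \<rightarrow>\<^sub>M (borel :: real measure)"
      using Suc.prems by (intro measurable_component_singleton) auto
    ultimately have "(\<lambda>w. w j i) \<in> PiM {..<N} (\<lambda>_. PiM {..<d} (\<lambda>_. borel)) \<rightarrow>\<^sub>M (borel :: real measure)"
      by (rule measurable_compose)
    then show ?thesis by (rule measurable_compose[OF measurable_snd])
  qed
  ultimately show ?case using Suc.IH[of i] Suc.prems by simp
qed

lemma sum_\<delta>: "(\<Sum>j<N. \<delta> j) = 1"
  using sum_lessThan_telescope[of t N] t_0 t_N by simp

text \<open>After time \<open>n * h\<close> the Euler drift is zero; the grid steps there cover an interval of length
  at most \<open>h\<close>.\<close>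

lemma sum_\<delta>_last: "(\<Sum>j<N. if cell j < n then 0 else \<delta> j) \<le> h"
proof -
  \<comment> \<open>Truncating the grid from below at n h makes the late steps telescope and leaves
    the early ones nonnegative.\<close>
  let ?f = "\<lambda>j. max (t j) (real n * h)"
  have "(\<Sum>j<N. if cell j < n then 0 else \<delta> j) \<le> (\<Sum>j<N. ?f (Suc j) - ?f j)"
  proof (rule sum_mono)
    fix j assume "j \<in> {..<N}"
    then have j: "j < N" by simp
    have "real n * h \<le> t j" if "\<not> cell j < n" using cell(1,2)[OF j] that by auto
    then show "(if cell j < n then 0 else \<delta> j) \<le> ?f (Suc j) - ?f j" using t_less[OF j] by auto
  qed
  also have "\<dots> = ?f N - ?f 0" by (rule sum_lessThan_telescope)
  also have "\<dots> \<le> h" using n_h_gt n_h_le t_N t_0 h_pos by (simp add: algebra_simps max_def)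
  finally show ?thesis .
qed

lemma v_square:
  assumes j: "j < N" and i: "i < d"
  shows "integrable \<Omega> (\<lambda>\<omega>. (v j \<omega> i)\<^sup>2)"
proof -
  have m: "real (cell j) * h \<le> t j" "t j \<le> (real (cell j) + 1) * h" "t j \<le> 1"
    using cell[OF j] grid_step[OF j] by auto
  have "integrable \<Omega> (\<lambda>\<omega>. (err (cell j) (t j) \<omega> i)\<^sup>2)"
    by (rule Bochner_Integration.integrable_bound[OF err_moment(1)[OF cell(1)[OF j] m]])
       (use measurable_F_\<Omega>[OF err_adapted[OF cell(1)[OF j] m(1,3) i]] power2_le_enorm[OF i] in auto)
  then show ?thesis unfolding v_def power_mult_distrib by simp
qed

lemma KL_le: "(\<Sum>j<N. (\<Sum>i<d. expectation (\<lambda>\<omega>. (v j \<omega> i)\<^sup>2)) / (2 * (sqrt (\<delta> j))\<^sup>2)) \<le> KL_bound"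
proof -
  have "(\<Sum>i<d. expectation (\<lambda>\<omega>. (v j \<omega> i)\<^sup>2)) / (2 * (sqrt (\<delta> j))\<^sup>2)
      \<le> 1 / (4 * \<epsilon>) * (\<delta> j * G + (if cell j < n then 0 else \<delta> j) * (G + 2 * L\<^sup>2 * A))" if j: "j < N" for j
  proof -
    have m: "real (cell j) * h \<le> t j" "t j \<le> (real (cell j) + 1) * h" "t j \<le> 1"
      using cell[OF j] grid_step[OF j] by auto
    let ?E = "expectation (\<lambda>\<omega>. (enorm d (err (cell j) (t j) \<omega>))\<^sup>2)"
    have "(\<Sum>i<d. expectation (\<lambda>\<omega>. (v j \<omega> i)\<^sup>2)) = expectation (\<lambda>\<omega>. \<Sum>i<d. (v j \<omega> i)\<^sup>2)"
      by (rule Bochner_Integration.integral_sum[symmetric]) (use v_square[OF j] in auto)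
    also have "\<dots> = expectation (\<lambda>\<omega>. (\<delta> j / (\<epsilon> * \<sigma>))\<^sup>2 * (enorm d (err (cell j) (t j) \<omega>))\<^sup>2)"
      unfolding v_def power_mult_distrib enorm_power2 sum_distrib_left ..
    also have "\<dots> = (\<delta> j / (\<epsilon> * \<sigma>))\<^sup>2 * ?E" by simp
    \<comment> \<open>Since \<sigma>^2 = 2/\<epsilon>, the squared factor is \<delta>^2/(2
      \<epsilon>); division by twice the variance \<delta> will leave \<delta>/(4
      \<epsilon>).\<close>
    also have "(\<delta> j / (\<epsilon> * \<sigma>))\<^sup>2 = (\<delta> j)\<^sup>2 / (2 * \<epsilon>)"
      unfolding power_divide power_mult_distrib \<sigma>_power2 using \<epsilon>_pos by (simp add: power2_eq_square)
    finally have "(\<Sum>i<d. expectation (\<lambda>\<omega>. (v j \<omega> i)\<^sup>2)) / (2 * (sqrt (\<delta> j))\<^sup>2) = \<delta> j / (4 * \<epsilon>) * ?E"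
      using \<delta>_pos[OF j] \<epsilon>_pos by (simp add: field_simps power2_eq_square)
    also have "\<dots> \<le> \<delta> j / (4 * \<epsilon>) * (G + (if cell j < n then 0 else G + 2 * L\<^sup>2 * A))"
      by (intro mult_left_mono err_moment(2)[OF cell(1)[OF j] m]) (use \<delta>_pos[OF j] \<epsilon>_pos in simp)
    also have "\<dots> = 1 / (4 * \<epsilon>) * (\<delta> j * G + (if cell j < n then 0 else \<delta> j) * (G + 2 * L\<^sup>2 * A))"
      using \<epsilon>_pos by (cases "cell j < n") (simp_all add: field_simps)
    finally show ?thesis .
  qed
  then have "(\<Sum>j<N. (\<Sum>i<d. expectation (\<lambda>\<omega>. (v j \<omega> i)\<^sup>2)) / (2 * (sqrt (\<delta> j))\<^sup>2))
      \<le> (\<Sum>j<N. 1 / (4 * \<epsilon>) * (\<delta> j * G + (if cell j < n then 0 else \<delta> j) * (G + 2 * L\<^sup>2 * A)))"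
    by (intro sum_mono) auto
  also have "\<dots> = 1 / (4 * \<epsilon>) * ((\<Sum>j<N. \<delta> j) * G + (\<Sum>j<N. if cell j < n then 0 else \<delta> j) * (G + 2 * L\<^sup>2 * A))"
    by (simp only: sum_distrib_left[symmetric] sum.distrib sum_distrib_right[symmetric])
  also have "\<dots> \<le> 1 / (4 * \<epsilon>) * (1 * G + h * (G + 2 * L\<^sup>2 * A))"
    using sum_\<delta> sum_\<delta>_last G_nonneg A_nonneg \<epsilon>_pos by (intro mult_left_mono add_mono mult_right_mono) auto
  also have "\<dots> \<le> 1 / (4 * \<epsilon>) * (2 * G + 2 * h * L\<^sup>2 * A)"
    using mult_right_mono[OF h_le_1 G_nonneg] \<epsilon>_pos by (intro mult_left_mono) (auto simp: algebra_simps)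
  finally show ?thesis by (simp add: KL_bound_def)
qed

text \<open>A functional of the Bernstein path sees only finitely many grid values, hence is a
  measurable function of the initial value and the noise, as the change of measure demands.\<close>

lemma eul_distance:
  assumes f: "path_functional d f c" and idx: "\<And>k. k \<le> r \<Longrightarrow> idx k \<le> N"
  shows "\<bar>expectation (\<lambda>\<omega>. f (bernstein_path d r (\<lambda>k. eul t (idx k) (X\<^sub>0 \<omega>) (\<lambda>j. \<Delta>B (t j) (t (Suc j)) \<omega>))))
      - expectation (\<lambda>\<omega>. f (bernstein_path d r (\<lambda>k. Y' (t (idx k)) \<omega>)))\<bar> \<le> 2 * sqrt KL_bound"
proof -
  interpret path_functional d f c by fact
  define g where "g p = f (bernstein_path d r (\<lambda>k. eul t (idx k) (X\<^sub>0 (fst p)) (snd p)))" for p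
  have g: "g \<in> borel_measurable (F (t 0) \<Otimes>\<^sub>M PiM {..<N} (\<lambda>_. PiM {..<d} (\<lambda>_. borel)))"
    unfolding g_def[abs_def] by (rule borel_measurable_bernstein) (use eul_measurable idx in auto)
  have "\<bar>expectation (\<lambda>\<omega>. g (\<omega>, \<lambda>j\<in>{..<N}. \<Delta>B (t j) (t (Suc j)) \<omega>)) - expectation (\<lambda>\<omega>. g (\<omega>, \<lambda>j\<in>{..<N}. girsanov.shifted j \<omega>))\<bar>
      \<le> 2 * sqrt (\<Sum>j<N. (\<Sum>i<d. expectation (\<lambda>\<omega>. (v j \<omega> i)\<^sup>2)) / (2 * (sqrt (\<delta> j))\<^sup>2))"
    by (rule girsanov.shifted_noise_distance[OF v_square g]) (use range in \<open>auto simp: g_def\<close>)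
  also have "\<dots> \<le> 2 * sqrt KL_bound" using KL_le by simp
  also have "expectation (\<lambda>\<omega>. g (\<omega>, \<lambda>j\<in>{..<N}. \<Delta>B (t j) (t (Suc j)) \<omega>))
      = expectation (\<lambda>\<omega>. f (bernstein_path d r (\<lambda>k. eul t (idx k) (X\<^sub>0 \<omega>) (\<lambda>j. \<Delta>B (t j) (t (Suc j)) \<omega>))))"
    unfolding g_def fst_conv snd_conv using idx
    by (intro Bochner_Integration.integral_cong refl arg_cong[where f=f] bernstein_path_cong) (simp add: eul_restrict)
  also have "expectation (\<lambda>\<omega>. g (\<omega>, \<lambda>j\<in>{..<N}. girsanov.shifted j \<omega>))
      = expectation (\<lambda>\<omega>. f (bernstein_path d r (\<lambda>k. Y' (t (idx k)) \<omega>)))"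
    unfolding g_def fst_conv snd_conv using idx
    by (intro Bochner_Integration.integral_cong refl arg_cong[where f=f] bernstein_path_cong) (simp add: eul_shifted)
  finally show ?thesis .
qed

end

section \<open>Passage to the continuous paths\<close>

context langevin_euler_small_step
begin

text \<open>Two limits are taken separately: here the grid is refined with the Bernstein degree
  fixed, and afterwards the degree grows. The scheme is reproduced exactly on every grid, so only
  the side of \<open>X\<close> moves.\<close>

lemma bernstein_distance:
  assumes f: "path_functional d f c" and r: "0 < r"
  shows "\<bar>expectation (\<lambda>\<omega>. f (bernstein_path d r (\<lambda>k. X \<omega> (real k / real r))))
      - expectation (\<lambda>\<omega>. f (bernstein_path d r (\<lambda>k. Y' (real k / real r) \<omega>)))\<bar> \<le> 2 * sqrt KL_bound"
proof -
  interpret path_functional d f c by fact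
  let ?EX = "expectation (\<lambda>\<omega>. f (bernstein_path d r (\<lambda>k. X \<omega> (real k / real r))))"
  let ?EY = "expectation (\<lambda>\<omega>. f (bernstein_path d r (\<lambda>k. Y' (real k / real r) \<omega>)))"
  \<comment> \<open>Both the Bernstein nodes and the Euler times must be grid points: the former so
    that the values there can be read off, the latter so that the Euler drift is constant on each
    grid step.\<close>
  define P where "P = (\<lambda>k. real k / real r) ` {..r} \<union> (\<lambda>k. real k * h) ` {..n}"
  have P: "finite P" "P \<subseteq> {0..1}" using r kh_mem by (auto simp: P_def divide_le_eq)
  have "\<exists>t N. t 0 = 0 \<and> t N = 1 \<and> (\<forall>j<N. t j < t (Suc j) \<and> t (Suc j) - t j \<le> inverse (real (Suc \<nu>))) \<and> P \<subseteq> t ` {..N}" for \<nu>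
    by (rule ex_partition[OF P]) simp
  then obtain t N where tN: "\<And>\<nu>. t \<nu> 0 = (0::real)" "\<And>\<nu>. t \<nu> (N \<nu>) = 1"
    "\<And>\<nu> j. j < N \<nu> \<Longrightarrow> t \<nu> j < t \<nu> (Suc j) \<and> t \<nu> (Suc j) - t \<nu> j \<le> inverse (real (Suc \<nu>))"
    "\<And>\<nu>. P \<subseteq> t \<nu> ` {..N \<nu>}" by metis
  have "\<exists>j\<le>N \<nu>. t \<nu> j = real k / real r" if "k \<le> r" for \<nu> k
  proof -
    have "real k / real r \<in> P" unfolding P_def using that by blast
    then have "real k / real r \<in> t \<nu> ` {..N \<nu>}" using tN(4)[of \<nu>] by blast
    then show ?thesis by (auto simp: image_iff eq_commute)
  qed
  then have "\<forall>\<nu> k. \<exists>j. k \<le> r \<longrightarrow> j \<le> N \<nu> \<and> t \<nu> j = real k / real r" by blast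
  then obtain idx where "\<forall>\<nu> k. k \<le> r \<longrightarrow> idx \<nu> k \<le> N \<nu> \<and> t \<nu> (idx \<nu> k) = real k / real r" by metis
  then have idx: "\<And>\<nu> k. k \<le> r \<Longrightarrow> idx \<nu> k \<le> N \<nu>" "\<And>\<nu> k. k \<le> r \<Longrightarrow> t \<nu> (idx \<nu> k) = real k / real r"
    by blast+
  have grid: "langevin_euler_grid d U L K M \<epsilon> h \<Omega> F X\<^sub>0 B X Y (t \<nu>) (N \<nu>)" for \<nu>
  proof (unfold_locales)
    fix k assume "k \<le> n"
    then have "real k * h \<in> P" unfolding P_def by blast
    then show "real k * h \<in> t \<nu> ` {..N \<nu>}" using tN(4)[of \<nu>] by blast
  qed (use tN in auto)
  define x where "x \<nu> \<omega> = bernstein_path d r (\<lambda>k. eul (t \<nu>) (idx \<nu> k) (X\<^sub>0 \<omega>) (\<lambda>j. \<Delta>B (t \<nu> j) (t \<nu> (Suc j)) \<omega>))" for \<nu> \<omega>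
  have dist: "\<bar>expectation (\<lambda>\<omega>. f (x \<nu> \<omega>)) - ?EY\<bar> \<le> 2 * sqrt KL_bound" for \<nu>
  proof -
    have "bernstein_path d r (\<lambda>k. Y' (t \<nu> (idx \<nu> k)) \<omega>) = bernstein_path d r (\<lambda>k. Y' (real k / real r) \<omega>)" for \<omega>
      by (rule bernstein_path_cong) (simp add: idx)
    then show ?thesis
      using langevin_euler_grid.eul_distance[OF grid f, of r "idx \<nu>" \<nu>] idx(1) by (simp add: x_def)
  qed
  have xm: "(\<lambda>\<omega>. f (x \<nu> \<omega>)) \<in> borel_measurable \<Omega>" for \<nu>
    unfolding x_def
  proof (rule borel_measurable_bernstein)
    fix k i assume k: "k \<le> r" "i < d"
    interpret g: langevin_euler_grid d U L K M \<epsilon> h \<Omega> F X\<^sub>0 B X Y "t \<nu>" "N \<nu>" by (rule grid)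
    have "(\<lambda>\<omega>. (\<omega>, \<lambda>j\<in>{..<N \<nu>}. \<Delta>B (t \<nu> j) (t \<nu> (Suc j)) \<omega>)) \<in> \<Omega> \<rightarrow>\<^sub>M F (t \<nu> 0) \<Otimes>\<^sub>M PiM {..<N \<nu>} (\<lambda>_. PiM {..<d} (\<lambda>_. borel))"
    proof (intro measurable_Pair measurable_restrict)
      show "(\<lambda>\<omega>. \<omega>) \<in> \<Omega> \<rightarrow>\<^sub>M F (t \<nu> 0)" by (rule measurable_F_\<Omega>[of _ "t \<nu> 0"]) simp
      fix j assume "j \<in> {..<N \<nu>}"
      then show "\<Delta>B (t \<nu> j) (t \<nu> (Suc j)) \<in> \<Omega> \<rightarrow>\<^sub>M PiM {..<d} (\<lambda>_. borel)"
        using g.grid_step[of j] by (intro measurable_F_\<Omega>[OF \<Delta>B_adapted]) auto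
    qed
    from measurable_compose[OF this g.eul_measurable[OF idx(1)[OF k(1)] k(2)]]
    show "(\<lambda>\<omega>. eul (t \<nu>) (idx \<nu> k) (X\<^sub>0 \<omega>) (\<lambda>j. \<Delta>B (t \<nu> j) (t \<nu> (Suc j)) \<omega>) i) \<in> borel_measurable \<Omega>"
      by (simp add: g.eul_restrict idx(1)[OF k(1)])
  qed
  have Xm: "(\<lambda>\<omega>. f (bernstein_path d r (\<lambda>k. X \<omega> (real k / real r)))) \<in> borel_measurable \<Omega>"
  proof (rule borel_measurable_bernstein)
    fix k i assume "k \<le> r" "i < d"
    have "(\<lambda>\<omega>. X \<omega> s i) \<in> borel_measurable \<Omega>" if s: "s \<in> {0..1}" for s
      by (rule path_evaluation_measurable[OF X_meas s])
    then show "(\<lambda>\<omega>. X \<omega> (real k / real r) i) \<in> borel_measurable \<Omega>" using \<open>k \<le> r\<close> r by (simp add: divide_le_eq)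
  qed
  have "(\<lambda>\<nu>. expectation (\<lambda>\<omega>. f (x \<nu> \<omega>))) \<longlonglongrightarrow> ?EX"
  proof (rule integral_dominated_convergence[where w="\<lambda>_. 1"])
    show "AE \<omega> in \<Omega>. (\<lambda>\<nu>. f (x \<nu> \<omega>)) \<longlonglongrightarrow> f (bernstein_path d r (\<lambda>k. X \<omega> (real k / real r)))"
      using X_eq AE_B_0 AE_space
    proof eventually_elim
      case (elim \<omega>)
      show ?case unfolding x_def
      proof (rule bernstein_tendsto_arg)
        fix k i assume k: "k \<le> r" "i < d"
        show "(\<lambda>\<nu>. eul (t \<nu>) (idx \<nu> k) (X\<^sub>0 \<omega>) (\<lambda>j. \<Delta>B (t \<nu> j) (t \<nu> (Suc j)) \<omega>) i) \<longlonglongrightarrow> X \<omega> (real k / real r) i"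
        proof (rule LIMSEQ_I)
          fix e :: real assume e: "0 < e"
          then have "0 < e / 2" by simp
          from eul_converges[OF elim(3,1,2) this] obtain \<delta> where \<delta>: "0 < \<delta>"
            "\<forall>t N. t 0 = 0 \<and> t N = 1 \<and> (\<forall>j<N. t j < t (Suc j) \<and> t (Suc j) - t j \<le> \<delta>) \<longrightarrow>
              (\<forall>j\<le>N. \<forall>i<d. \<bar>eul t j (X\<^sub>0 \<omega>) (\<lambda>j. \<Delta>B (t j) (t (Suc j)) \<omega>) i - X \<omega> (t j) i\<bar> \<le> e / 2)"
            by (elim exE conjE)
          obtain \<nu>0 where \<nu>0: "inverse (real (Suc \<nu>0)) < \<delta>" using reals_Archimedean[OF \<delta>(1)] by blast
          show "\<exists>\<nu>0. \<forall>\<nu>\<ge>\<nu>0. norm (eul (t \<nu>) (idx \<nu> k) (X\<^sub>0 \<omega>) (\<lambda>j. \<Delta>B (t \<nu> j) (t \<nu> (Suc j)) \<omega>) i - X \<omega> (real k / real r) i) < e"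
          proof (intro exI[of _ \<nu>0] allI impI)
            fix \<nu> assume "\<nu>0 \<le> \<nu>"
            then have "inverse (real (Suc \<nu>)) \<le> inverse (real (Suc \<nu>0))" by (intro le_imp_inverse_le) auto
            with \<nu>0 have "inverse (real (Suc \<nu>)) \<le> \<delta>" by linarith
            then have "\<forall>j<N \<nu>. t \<nu> j < t \<nu> (Suc j) \<and> t \<nu> (Suc j) - t \<nu> j \<le> \<delta>"
              using tN(3)[of _ \<nu>] by (meson order_trans)
            with \<delta>(2)[rule_format, of "t \<nu>" "N \<nu>" "idx \<nu> k" i] tN(1,2)[of \<nu>] idx(1)[OF k(1), of \<nu>] k(2)
            have "\<bar>eul (t \<nu>) (idx \<nu> k) (X\<^sub>0 \<omega>) (\<lambda>j. \<Delta>B (t \<nu> j) (t \<nu> (Suc j)) \<omega>) i - X \<omega> (t \<nu> (idx \<nu> k)) i\<bar> \<le> e / 2"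
              by simp
            then show "norm (eul (t \<nu>) (idx \<nu> k) (X\<^sub>0 \<omega>) (\<lambda>j. \<Delta>B (t \<nu> j) (t \<nu> (Suc j)) \<omega>) i - X \<omega> (real k / real r) i) < e"
              unfolding idx(2)[OF k(1)] real_norm_def using e by linarith
          qed
        qed
      qed
    qed
  qed (use Xm xm range in auto)
  then have "(\<lambda>\<nu>. \<bar>expectation (\<lambda>\<omega>. f (x \<nu> \<omega>)) - ?EY\<bar>)
      \<longlonglongrightarrow> \<bar>?EX - ?EY\<bar>"
    by (intro tendsto_rabs tendsto_diff tendsto_const)
  then show ?thesis by (rule LIMSEQ_le_const2) (use dist in auto)
qed

lemma path_functional_distance:
  assumes f: "path_functional d f c"
  shows "\<bar>expectation (\<lambda>\<omega>. f (X \<omega>)) - expectation (\<lambda>\<omega>. f (Y \<omega>))\<bar> \<le> 2 * sqrt KL_bound"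
proof -
  interpret path_functional d f c by fact
  have lim: "(\<lambda>r. expectation (\<lambda>\<omega>. f (bernstein_path d r (\<lambda>k. Z \<omega> (real k / real r))))) \<longlonglongrightarrow> expectation (\<lambda>\<omega>. f (Z \<omega>))"
    if Z: "Z \<in> \<Omega> \<rightarrow>\<^sub>M path_borel d" for Z
  proof (rule integral_dominated_convergence[where w="\<lambda>_. 1"])
    show "(\<lambda>\<omega>. f (Z \<omega>)) \<in> borel_measurable \<Omega>" by (rule measurable_compose[OF Z borel_measurable_path])
    show "(\<lambda>\<omega>. f (bernstein_path d r (\<lambda>k. Z \<omega> (real k / real r)))) \<in> borel_measurable \<Omega>" for r
    proof (rule borel_measurable_bernstein)
      fix k i assume "k \<le> r"
      \<comment> \<open>For \<open>r = 0\<close> the node is 0/0 = 0, still in the unit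
        interval.\<close>
      then show "(\<lambda>\<omega>. Z \<omega> (real k / real r) i) \<in> borel_measurable \<Omega>"
        by (intro path_evaluation_measurable[OF Z]) (cases "r = 0"; auto simp: divide_le_eq)
    qed
    have "Z \<omega> \<in> mspace (path_metric d)" if "\<omega> \<in> space \<Omega>" for \<omega>
      using measurable_space[OF Z that] by (simp only: space_path_borel)
    then show "AE \<omega> in \<Omega>. (\<lambda>r. f (bernstein_path d r (\<lambda>k. Z \<omega> (real k / real r)))) \<longlonglongrightarrow> f (Z \<omega>)"
      by (intro AE_I2 bernstein_tendsto_path)
  qed (use range in auto)
  have "expectation (\<lambda>\<omega>. f (bernstein_path d r (\<lambda>k. Y \<omega> (real k / real r))))
      = expectation (\<lambda>\<omega>. f (bernstein_path d r (\<lambda>k. Y' (real k / real r) \<omega>)))" if r: "0 < r" for r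
  proof (rule integral_cong_AE)
    have k1: "real k / real r \<in> {0..1}" if "k \<le> r" for k using that r by (simp add: divide_le_eq)
    show "(\<lambda>\<omega>. f (bernstein_path d r (\<lambda>k. Y \<omega> (real k / real r)))) \<in> borel_measurable \<Omega>"
      by (intro borel_measurable_bernstein path_evaluation_measurable[OF Y_meas] k1)
    show "(\<lambda>\<omega>. f (bernstein_path d r (\<lambda>k. Y' (real k / real r) \<omega>))) \<in> borel_measurable \<Omega>"
      by (intro borel_measurable_bernstein measurable_F_\<Omega>[OF Y'_adapted] k1)
    show "AE \<omega> in \<Omega>. f (bernstein_path d r (\<lambda>k. Y \<omega> (real k / real r))) = f (bernstein_path d r (\<lambda>k. Y' (real k / real r) \<omega>))"
      using AE_Y_eq_Y'
    proof eventually_elim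
      case (elim \<omega>)
      have "bernstein_path d r (\<lambda>k. Y \<omega> (real k / real r)) = bernstein_path d r (\<lambda>k. Y' (real k / real r) \<omega>)"
        using elim k1 by (intro bernstein_path_cong) auto
      then show ?case by simp
    qed
  qed
  then have "\<bar>expectation (\<lambda>\<omega>. f (bernstein_path d r (\<lambda>k. X \<omega> (real k / real r))))
      - expectation (\<lambda>\<omega>. f (bernstein_path d r (\<lambda>k. Y \<omega> (real k / real r))))\<bar> \<le> 2 * sqrt KL_bound" if "1 \<le> r" for r
    using bernstein_distance[OF f, of r] that by simp
  moreover have "(\<lambda>r. \<bar>expectation (\<lambda>\<omega>. f (bernstein_path d r (\<lambda>k. X \<omega> (real k / real r))))
      - expectation (\<lambda>\<omega>. f (bernstein_path d r (\<lambda>k. Y \<omega> (real k / real r))))\<bar>)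
      \<longlonglongrightarrow> \<bar>expectation (\<lambda>\<omega>. f (X \<omega>)) - expectation (\<lambda>\<omega>. f (Y \<omega>))\<bar>"
    by (intro tendsto_rabs tendsto_diff lim X_meas Y_meas)
  ultimately show ?thesis by (intro LIMSEQ_le_const2) auto
qed

theorem tv_dist_le: "tv_dist (distr \<Omega> (path_borel d) X) (distr \<Omega> (path_borel d) Y) \<le> 2 * sqrt KL_bound"
proof (rule tv_dist_path_le)
  fix f c assume f: "path_functional d f c"
  then interpret path_functional d f c .
  show "\<bar>(\<integral>x. f x \<partial>distr \<Omega> (path_borel d) X) - (\<integral>x. f x \<partial>distr \<Omega> (path_borel d) Y)\<bar> \<le> 2 * sqrt KL_bound"
    using path_functional_distance[OF f] by (simp add: integral_distr X_meas Y_meas borel_measurable_path)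
qed (auto intro: prob_space_distr X_meas Y_meas)

end

section \<open>Asymptotics\<close>

text \<open>The Landau estimate concerns the absolute value. A supremum of reals dominates its terms
  only when it is bounded, hence the bound 1.\<close>

lemma tv_dist_nonneg:
  assumes "prob_space \<mu>" "prob_space \<nu>"
  shows "0 \<le> tv_dist \<mu> \<nu>"
proof -
  interpret \<mu>: prob_space \<mu> by fact
  interpret \<nu>: prob_space \<nu> by fact
  have "bdd_above ((\<lambda>A. \<bar>measure \<mu> A - measure \<nu> A\<bar>) ` sets \<mu>)"
  proof (rule bdd_aboveI2)
    fix A
    show "\<bar>measure \<mu> A - measure \<nu> A\<bar> \<le> 1"
      using \<mu>.prob_le_1[of A] \<nu>.prob_le_1[of A] measure_nonneg[of \<mu> A] measure_nonneg[of \<nu> A] by linarith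
  qed
  from cSUP_upper[OF sets.empty_sets this] show ?thesis by (simp add: tv_dist_def)
qed

text \<open>Here p stands for d^q. Each term of the bound is written as h/\<epsilon>^2 times a
  remainder, and the remainder is estimated by powers of C, p and d.\<close>

lemma (in langevin_euler_small_step) KL_bound_le:
  assumes C: "1 \<le> C" and p: "1 \<le> p"
    and M2: "M\<^sup>2 \<le> C * p" and L4: "L ^ 4 \<le> C * p" and K1: "inverse K \<le> C * p" and S2: "S2 \<le> C * p"
    and a0: "a\<^sub>0 \<le> C * (p * real d)" and hd: "h / \<epsilon> * real d \<le> C" and \<epsilon>1: "\<epsilon> \<le> 1"
  shows "KL_bound \<le> 61 * C ^ 5 * (h / \<epsilon>\<^sup>2 * (p ^ 4 * real d))"
proof -
  define D where "D = real d"
  define u where "u = h / \<epsilon>\<^sup>2"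
  have D: "1 \<le> D" using d_pos by (simp add: D_def)
  have u: "0 \<le> u" using h_pos by (simp add: u_def)
  have pw: "C ^ a \<le> C ^ b" "p ^ a \<le> p ^ b" if "a \<le> b" for a b
    using that C p by (auto intro: power_increasing)
  have C1: "1 \<le> C ^ a" "1 \<le> p ^ a" for a using C p by (auto intro: one_le_power)
  have mono: "C ^ a * (p ^ b * D) \<le> C ^ a' * (p ^ b' * D)" if "a \<le> a'" "b \<le> b'" for a b a' b'
    using that C p D by (intro mult_mono pw) auto
  have one: "1 \<le> C ^ a * (p ^ b * D)" for a b
    using mult_mono[OF C1(1)[of a] mult_mono[OF C1(2)[of b] D]] C p D by simp
  \<comment> \<open>13 = 1 + 8 + 4, from the initial moment, the speed of the minimiser and the
    noise. The factor p^3 arises from \<open>S2\<close> together with the squared inverse of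
    K.\<close>
  have A_le: "A \<le> 13 * (C ^ 3 * (p ^ 3 * D))"
  proof -
    have "a\<^sub>0 \<le> C ^ 3 * (p ^ 3 * D)" using a0 mono[of 1 3 1 3] by (simp add: D_def)
    moreover have "8 * \<epsilon>\<^sup>2 * S2 / K\<^sup>2 \<le> 8 * (C ^ 3 * (p ^ 3 * D))"
    proof -
      have "8 * \<epsilon>\<^sup>2 * S2 / K\<^sup>2 = 8 * (\<epsilon>\<^sup>2 * (S2 * (inverse K)\<^sup>2))" by (simp add: field_simps)
      also have "\<dots> \<le> 8 * (1 * ((C * p) * (C * p)\<^sup>2))"
        using S2 S2_nonneg K1 K_pos \<epsilon>_pos \<epsilon>1 C p
        by (intro mult_left_mono mult_mono power_mono) (auto simp: power_le_one)
      also have "\<dots> = 8 * (C ^ 3 * (p ^ 3 * 1))" by (simp add: power2_eq_square power3_eq_cube)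
      also have "\<dots> \<le> 8 * (C ^ 3 * (p ^ 3 * D))" using C p D by (intro mult_left_mono) auto
      finally show ?thesis .
    qed
    moreover have "4 * D / K \<le> 4 * (C ^ 3 * (p ^ 3 * D))"
    proof -
      have "4 * D / K = 4 * (inverse K * D)" by (simp add: field_simps)
      also have "\<dots> \<le> 4 * ((C * p) * D)" using K1 D by (intro mult_left_mono mult_right_mono) auto
      also have "\<dots> \<le> 4 * (C ^ 3 * (p ^ 3 * D))" using mono[of 1 3 1 3] by simp
      finally show ?thesis .
    qed
    ultimately show ?thesis unfolding A_def D_def by linarith
  qed
  \<comment> \<open>The hypothesis controls the fourth power of L; the square is compared with it
    through L^2 \<le> 1 + L^4.\<close>
  have L2: "L\<^sup>2 \<le> 2 * (C * p)"
  proof -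
    have "L\<^sup>2 \<le> 1 + L ^ 4"
    proof -
      have "0 \<le> (L\<^sup>2 - 1)\<^sup>2" by simp
      also have "(L\<^sup>2 - 1)\<^sup>2 = L ^ 4 - 2 * L\<^sup>2 + 1" by (simp add: power2_diff)
      finally show ?thesis using zero_le_power2[of L] by linarith
    qed
    moreover have "1 \<le> C * p" using mult_mono[OF C p] C by simp
    ultimately show ?thesis using L4 by linarith
  qed
  let ?T = "C ^ 5 * (p ^ 4 * D)"
  have T4: "C ^ 4 * (p ^ 4 * D) \<le> ?T" by (rule mono) auto
  \<comment> \<open>The dimension inside \<open>A\<close> is absorbed by h d/\<epsilon> \<le> C, at
    the price of the fifth power of C.\<close>
  have t1: "L ^ 4 * (h / \<epsilon>)\<^sup>2 * A / \<epsilon> \<le> 13 * ?T * u"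
  proof -
    have "L ^ 4 * (h / \<epsilon>)\<^sup>2 * A / \<epsilon> = (L ^ 4 * (h / \<epsilon> * A)) * u"
      using \<epsilon>_pos by (simp add: u_def field_simps power2_eq_square)
    also have "\<dots> \<le> ((C * p) * (h / \<epsilon> * (13 * (C ^ 3 * (p ^ 3 * D))))) * u"
      using L4 A_le A_nonneg u h_pos \<epsilon>_pos C p by (intro mult_right_mono mult_mono mult_left_mono) auto
    also have "\<dots> = (13 * C ^ 4 * p ^ 4 * (h / \<epsilon> * D)) * u"
      by (simp add: power4_eq_xxxx power3_eq_cube mult_ac)
    also have "\<dots> \<le> (13 * C ^ 4 * p ^ 4 * C) * u"
      using hd u C p by (intro mult_right_mono mult_left_mono) (auto simp: D_def)
    also have "\<dots> = 13 * (C ^ 5 * (p ^ 4 * 1)) * u" by (simp add: eval_nat_numeral mult_ac)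
    also have "\<dots> \<le> 13 * ?T * u" using C p D u by (intro mult_right_mono mult_left_mono) auto
    finally show ?thesis .
  qed
  have t2: "L\<^sup>2 * h * D / \<epsilon> / \<epsilon> \<le> 2 * ?T * u"
  proof -
    have "L\<^sup>2 * h * D / \<epsilon> / \<epsilon> = (L\<^sup>2 * D) * u" by (simp add: u_def power2_eq_square)
    also have "\<dots> \<le> (2 * (C * p) * D) * u" using L2 D u by (intro mult_right_mono) auto
    also have "\<dots> \<le> 2 * ?T * u" using mono[of 1 5 1 4] u by (intro mult_right_mono) auto
    finally show ?thesis .
  qed
  have t3: "M\<^sup>2 * h\<^sup>2 * (1 + A) / \<epsilon> \<le> 14 * ?T * u"
  proof -
    have "M\<^sup>2 * h\<^sup>2 * (1 + A) / \<epsilon> = (M\<^sup>2 * (h * \<epsilon>) * (1 + A)) * u"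
      using \<epsilon>_pos by (simp add: u_def field_simps power2_eq_square)
    also have "\<dots> \<le> ((C * p) * 1 * (14 * (C ^ 3 * (p ^ 3 * D)))) * u"
      using M2 A_le one[of 3 3] A_nonneg u h_pos \<epsilon>_pos h_le_1 \<epsilon>1 C p
      by (intro mult_right_mono mult_mono) (auto intro: mult_le_one)
    also have "\<dots> = 14 * (C ^ 4 * (p ^ 4 * D)) * u" by (simp add: power4_eq_xxxx power3_eq_cube mult_ac)
    also have "\<dots> \<le> 14 * ?T * u" using T4 u by (intro mult_right_mono) auto
    finally show ?thesis .
  qed
  have t4: "h * L\<^sup>2 * A / \<epsilon> \<le> 26 * ?T * u"
  proof -
    have "h * L\<^sup>2 * A / \<epsilon> = (L\<^sup>2 * \<epsilon> * A) * u"
      using \<epsilon>_pos by (simp add: u_def field_simps power2_eq_square)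
    also have "\<dots> \<le> ((2 * (C * p)) * 1 * (13 * (C ^ 3 * (p ^ 3 * D)))) * u"
      using L2 A_le A_nonneg u \<epsilon>_pos \<epsilon>1 C p by (intro mult_right_mono mult_mono) auto
    also have "\<dots> = 26 * (C ^ 4 * (p ^ 4 * D)) * u" by (simp add: power4_eq_xxxx power3_eq_cube mult_ac)
    also have "\<dots> \<le> 26 * ?T * u" using T4 u by (intro mult_right_mono) auto
    finally show ?thesis .
  qed
  have "KL_bound = 2 * (L ^ 4 * (h / \<epsilon>)\<^sup>2 * A / \<epsilon>) + 4 * (L\<^sup>2 * h * D / \<epsilon> / \<epsilon>)
      + M\<^sup>2 * h\<^sup>2 * (1 + A) / \<epsilon> + h * L\<^sup>2 * A / \<epsilon> / 2"
  proof -
    have "(2 * (4 * a + 8 * b + 2 * c) + 2 * e) / (4 * \<epsilon>) = 2 * (a / \<epsilon>) + 4 * (b / \<epsilon>) + c / \<epsilon> + e / \<epsilon> / 2"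
      for a b c e :: real using \<epsilon>_pos by (simp add: field_simps)
    from this[of "L ^ 4 * (h / \<epsilon>)\<^sup>2 * A" "L\<^sup>2 * h * D / \<epsilon>" "M\<^sup>2 * h\<^sup>2 * (1 + A)" "h * L\<^sup>2 * A"]
    show ?thesis unfolding KL_bound_def G_def D_def by (simp only: mult.assoc times_divide_eq_right)
  qed
  \<comment> \<open>61 = 2 * 13 + 4 * 2 + 14 + 26 / 2.\<close>
  also have "\<dots> \<le> 61 * (?T * u)"
  proof -
    have "2 * a + 4 * b + c + e / 2 \<le> 61 * T" if "a \<le> 13 * T" "b \<le> 2 * T" "c \<le> 14 * T" "e \<le> 26 * T"
      for a b c e T :: real using that by linarith
    from this[OF t1[unfolded mult.assoc[of _ ?T]] t2[unfolded mult.assoc[of _ ?T]]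
        t3[unfolded mult.assoc[of _ ?T]] t4[unfolded mult.assoc[of _ ?T]]]
    show ?thesis .
  qed
  finally show ?thesis by (simp add: D_def u_def mult_ac)
qed

theorem proposition10:
  fixes q :: real
    and U :: "nat \<Rightarrow> real \<Rightarrow> (nat \<Rightarrow> real) \<Rightarrow> real"
    and L K M \<epsilon> h :: "nat \<Rightarrow> real"
    and \<mu>\<^sub>0 :: "nat \<Rightarrow> (nat \<Rightarrow> real) measure"
    and \<Omega> :: "nat \<Rightarrow> 'w measure"
    and F :: "nat \<Rightarrow> real \<Rightarrow> 'w measure"
    and X\<^sub>0 :: "nat \<Rightarrow> 'w \<Rightarrow> nat \<Rightarrow> real"
    and B X Y :: "nat \<Rightarrow> 'w \<Rightarrow> real \<Rightarrow> nat \<Rightarrow> real"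
  assumes "0 \<le> q"
    and "\<And>d. 1 \<le> d \<Longrightarrow> potential d (U d) (L d) (K d) (M d)"
    and "\<And>d. 1 \<le> d \<Longrightarrow> 0 < \<epsilon> d"
    and "\<And>d. 1 \<le> d \<Longrightarrow> 0 < h d \<and> h d \<le> 1"
    and "\<And>d. 1 \<le> d \<Longrightarrow> brownian_motion (\<Omega> d) (F d) d (B d)"
    and "\<And>d. 1 \<le> d \<Longrightarrow> X\<^sub>0 d \<in> F d 0 \<rightarrow>\<^sub>M borel_of (Euclidean_space d)"
    and "\<And>d. 1 \<le> d \<Longrightarrow> distr (\<Omega> d) (borel_of (Euclidean_space d)) (X\<^sub>0 d) = \<mu>\<^sub>0 d"
    and "\<And>d. 1 \<le> d \<Longrightarrow> X d \<in> \<Omega> d \<rightarrow>\<^sub>M path_borel d"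
    and "\<And>d. 1 \<le> d \<Longrightarrow> AE \<omega> in \<Omega> d.
           path_eq d (\<epsilon> d) (langevin_drift (U d) (X d \<omega>)) (X\<^sub>0 d \<omega>) (B d \<omega>) (X d \<omega>)"
    and "\<And>d. 1 \<le> d \<Longrightarrow> Y d \<in> \<Omega> d \<rightarrow>\<^sub>M path_borel d"
    and "\<And>d. 1 \<le> d \<Longrightarrow> AE \<omega> in \<Omega> d.
           path_eq d (\<epsilon> d) (euler_drift (U d) (h d) (Y d \<omega>)) (X\<^sub>0 d \<omega>) (B d \<omega>) (Y d \<omega>)"
    and "\<And>d t i. 1 \<le> d \<Longrightarrow> t \<in> {0..1} \<Longrightarrow> i < d \<Longrightarrow>
           (\<lambda>s. minimizer d (U d) s i) differentiable (at t within {0..1})"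
    and "(\<lambda>d. Max {(M d)\<^sup>2, L d ^ 4, inverse (K d),
                   SUP t\<in>{0..1}. (enorm d (\<lambda>i. time_deriv (\<lambda>s. minimizer d (U d) s i) t))\<^sup>2})
           \<in> O(\<lambda>d. real d powr q)"
    and "\<forall>\<^sub>F d in sequentially. integrable (\<mu>\<^sub>0 d) (\<lambda>x. (enorm d x)\<^sup>2)"
    and "(\<lambda>d. \<integral>x. (enorm d x)\<^sup>2 \<partial>\<mu>\<^sub>0 d) \<in> O(\<lambda>d. real d powr (q + 1))"
    and "(\<lambda>d. Max {h d, \<epsilon> d, h d / \<epsilon> d * ((L d)\<^sup>2 / K d)}) \<in> o(\<lambda>_. 1)"
    and "(\<lambda>d. h d / \<epsilon> d * real d) \<in> O(\<lambda>_. 1)"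
  shows "(\<lambda>d. tv_dist (distr (\<Omega> d) (path_borel d) (X d)) (distr (\<Omega> d) (path_borel d) (Y d)))
           \<in> O(\<lambda>d. sqrt (h d / (\<epsilon> d)\<^sup>2 * real d powr (4 * q + 1)))"
proof -
  let ?tv = "\<lambda>d. tv_dist (distr (\<Omega> d) (path_borel d) (X d)) (distr (\<Omega> d) (path_borel d) (Y d))"
  obtain C1 where C1: "\<forall>\<^sub>F d in sequentially. norm (Max {(M d)\<^sup>2, L d ^ 4, inverse (K d),
      SUP t\<in>{0..1}. (enorm d (\<lambda>i. time_deriv (\<lambda>s. minimizer d (U d) s i) t))\<^sup>2}) \<le> C1 * norm (real d powr q)"
    using assms(13) by (elim landau_o.bigE)
  obtain C2 where C2: "\<forall>\<^sub>F d in sequentially. norm (\<integral>x. (enorm d x)\<^sup>2 \<partial>\<mu>\<^sub>0 d) \<le> C2 * norm (real d powr (q + 1))"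
    using assms(15) by (elim landau_o.bigE)
  obtain C3 where C3: "\<forall>\<^sub>F d in sequentially. norm (h d / \<epsilon> d * real d) \<le> C3 * norm (1::real)"
    using assms(17) by (elim landau_o.bigE)
  \<comment> \<open>Smallness enters as the eventual bound 1, which supplies \<epsilon> \<le> 1 and
    the step condition of the contraction.\<close>
  have o1: "\<forall>\<^sub>F d in sequentially. norm (Max {h d, \<epsilon> d, h d / \<epsilon> d * ((L d)\<^sup>2 / K d)}) \<le> 1 * norm (1::real)"
    by (rule landau_o.smallD[OF assms(16)]) simp
  \<comment> \<open>One constant for all hypotheses, at least 1 so that its powers increase.\<close>
  define C where "C = Max {1, C1, C2, C3}"
  have C: "1 \<le> C" "C1 \<le> C" "C2 \<le> C" "C3 \<le> C" by (auto simp: C_def)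
  show ?thesis
  proof (rule landau_o.bigI)
    show "0 < 2 * sqrt (61 * C ^ 5)" using C by simp
    show "\<forall>\<^sub>F d in sequentially. norm (?tv d)
        \<le> 2 * sqrt (61 * C ^ 5) * norm (sqrt (h d / (\<epsilon> d)\<^sup>2 * real d powr (4 * q + 1)))"
      using C1 C2 C3 o1 assms(14) eventually_ge_at_top[of 1]
    proof eventually_elim
      case (elim d)
      note d = elim(6)
      define p where "p = real d powr q"
      have p: "1 \<le> p" unfolding p_def using d assms(1) by (intro ge_one_powr_ge_zero) auto
      have pd: "real d powr (q + 1) = p * real d" using d by (simp add: p_def powr_add)
      have "real d powr (4 * q) = p powr real 4" unfolding p_def by (simp add: powr_powr mult.commute)
      also have "\<dots> = p ^ 4" using p by (subst powr_realpow) auto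
      finally have p4: "real d powr (4 * q + 1) = p ^ 4 * real d" using d by (simp add: powr_add)
      have X0m: "X\<^sub>0 d \<in> \<Omega> d \<rightarrow>\<^sub>M borel_of (Euclidean_space d)"
      proof -
        have "sets (F d 0) \<subseteq> sets (\<Omega> d)" "space (F d 0) = space (\<Omega> d)"
          using assms(5)[OF d] filtration.space_F[of "space (\<Omega> d)" "F d" 0] by (auto simp: brownian_motion_def)
        then show ?thesis using measurable_mono[of "borel_of (Euclidean_space d)" "borel_of (Euclidean_space d)" "F d 0" "\<Omega> d"] assms(6)[OF d] by auto
      qed
      have em: "(\<lambda>x. (enorm d x)\<^sup>2) \<in> borel_measurable (borel_of (Euclidean_space d))"
        by (rule borel_measurable_enorm_power2, rule borel_measurable_Euclidean_coordinate[where f="\<lambda>x. x" and d=d]) simp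
      \<comment> \<open>From here on the dimension is fixed, and large enough for all the eventual
        hypotheses.\<close>
      interpret potential_data d "U d" "L d" "K d" "M d"
        by standard (use assms(2,12) d in auto)
      interpret langevin_euler d "U d" "L d" "K d" "M d" "\<epsilon> d" "h d" "\<Omega> d" "F d" "X\<^sub>0 d" "B d" "X d" "Y d"
      proof
        show "integrable (\<Omega> d) (\<lambda>\<omega>. (enorm d (X\<^sub>0 d \<omega>))\<^sup>2)"
          using elim(5) unfolding assms(7)[OF d, symmetric] integrable_distr_eq[OF X0m em] .
      qed (use assms(3-11) d in auto)
      have small: "h d \<le> 1" "\<epsilon> d \<le> 1" "h d / \<epsilon> d * ((L d)\<^sup>2 / K d) \<le> 1"
        using elim(4) by (auto simp: abs_le_iff)
      interpret langevin_euler_small_step d "U d" "L d" "K d" "M d" "\<epsilon> d" "h d" "\<Omega> d" "F d" "X\<^sub>0 d" "B d" "X d" "Y d"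
        by standard (fact small(3))
      have "C1 * norm (real d powr q) \<le> C * p" using C p by (simp add: p_def mult_right_mono)
      then have Mx: "(M d)\<^sup>2 \<le> C * p" "L d ^ 4 \<le> C * p" "inverse (K d) \<le> C * p" "S2 \<le> C * p"
        using elim(1) unfolding S2_def by (auto simp: abs_le_iff)
      have "a\<^sub>0 = (\<integral>x. (enorm d x)\<^sup>2 \<partial>\<mu>\<^sub>0 d)"
        unfolding a\<^sub>0_def assms(7)[OF d, symmetric] by (rule integral_distr[OF X0m em, symmetric])
      also have "\<dots> \<le> C2 * (p * real d)" using elim(2) p by (simp add: pd)
      also have "\<dots> \<le> C * (p * real d)" using C p by (intro mult_right_mono) auto
      finally have a0: "a\<^sub>0 \<le> C * (p * real d)" .
      have "\<bar>h d / \<epsilon> d * real d\<bar> \<le> C3" using elim(3) by (simp only: real_norm_def abs_one mult_1_right)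
      then have hd: "h d / \<epsilon> d * real d \<le> C" using C(4) by linarith
      have "?tv d \<le> 2 * sqrt KL_bound"
        by (rule tv_dist_le)
      also have "\<dots> \<le> 2 * sqrt (61 * C ^ 5 * (h d / (\<epsilon> d)\<^sup>2 * (p ^ 4 * real d)))"
        using KL_bound_le[OF C(1) p Mx a0 hd small(2)] by simp
      also have "\<dots> = 2 * sqrt (61 * C ^ 5) * sqrt (h d / (\<epsilon> d)\<^sup>2 * real d powr (4 * q + 1))"
        unfolding p4 by (simp only: real_sqrt_mult mult.assoc)
      finally have "?tv d
          \<le> 2 * sqrt (61 * C ^ 5) * sqrt (h d / (\<epsilon> d)\<^sup>2 * real d powr (4 * q + 1))" .
      moreover have "0 \<le> ?tv d"
        by (intro tv_dist_nonneg prob_space_distr X_meas Y_meas)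
      moreover have "0 \<le> sqrt (h d / (\<epsilon> d)\<^sup>2 * real d powr (4 * q + 1))" using h_pos by simp
      ultimately show ?case by simp
    qed
  qed
qed

end
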